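(* Let $\kappa$ be an uncountable cardinal and let $l^2(\kappa)$ be the Hilbert space with orthonormal basis indexed by $\kappa$. Then: (i) $\kappa$ is Ulam real-valued measurable if and only if there is a singular countably additive state on $B(l^2(\kappa))$; (ii) $\kappa$ is Ulam measurable if and only if there is a singular countably additive pure state on $B(l^2(\kappa))$; (iii) $\kappa$ is real-valued measurable if and only if there is a singular ${<}\,\kappa$-additive state on $B(l^2(\kappa))$; (iv) $\kappa$ is measurable if and only if there is a singular ${<}\,\kappa$-additive pure state on $B(l^2(\kappa))$.
   Context: A "measure on $\kappa$" is defined on all subsets of $\kappa$; a measure is ${<}\,\kappa$-additive if it is additive on any family of fewer than $\kappa$ pairwise disjoint sets. An uncountable cardinal $\kappa$ is measurable if there is a nonzero ${<}\,\kappa$-additive $\{0,1\}$-valued measure on $\kappa$ vanishing on singletons; real-valued measurable if there is a ${<}\,\kappa$-additive probability measure on $\kappa$ vanishing on singletons; Ulam measurable if there is a nonzero countably additive $\{0,1\}$-valued measure on $\kappa$ vanishing on singletons; Ulam real-valued measurable if there is a countably additive probability measure on $\kappa$ vanishing on singletons. A state $\phi$ on a von Neumann algebra is countably additive if $\phi(\sum p_n)=\sum\phi(p_n)$ for every countable family of mutually orthogonal projections, and ${<}\,\kappa$-additive if for every cardinal $\lambda<\kappa$ and every family $\{p_\alpha:\alpha\in\lambda\}$ of mutually orthogonal projections, $\phi(\sum p_\alpha)=\sum\phi(p_\alpha)$. A state on $B(l^2(\kappa))$ is singular if it vanishes on all rank one projections (equivalently, on the compact operators). *)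

theory Defs
  imports "HOL-Analysis.Analysis" "HOL-Library.Function_Algebras"
begin

section \<open>The Hilbert space l^2(kappa), kappa represented by the type 'a\<close>

type_synonym 'a vec = "'a \<Rightarrow> complex"
type_synonym 'a op = "'a vec \<Rightarrow> 'a vec"

definition l2 :: "'a vec set" where
  "l2 = {x. (\<lambda>i. (cmod (x i))^2) summable_on UNIV}"

definition l2inner :: "'a vec \<Rightarrow> 'a vec \<Rightarrow> complex" where
  "l2inner x y = infsum (\<lambda>i. cnj (x i) * y i) UNIV"

definition l2norm :: "'a vec \<Rightarrow> real" where
  "l2norm x = sqrt (infsum (\<lambda>i. (cmod (x i))^2) UNIV)"

section \<open>B(l^2(kappa)): bounded linear operators (canonically zero off l2)\<close>

definition bounded_op :: "'a op \<Rightarrow> bool" where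
  "bounded_op T \<longleftrightarrow>
     (\<forall>x\<in>l2. T x \<in> l2) \<and>
     (\<forall>x. x \<notin> l2 \<longrightarrow> T x = 0) \<and>
     (\<forall>x\<in>l2. \<forall>y\<in>l2. T (x + y) = T x + T y) \<and>
     (\<forall>x\<in>l2. \<forall>c. T (\<lambda>i. c * x i) = (\<lambda>i. c * T x i)) \<and>
     (\<exists>C. \<forall>x\<in>l2. l2norm (T x) \<le> C * l2norm x)"

definition id_op :: "'a op" where
  "id_op x = (if x \<in> l2 then x else 0)"

definition positive_op :: "'a op \<Rightarrow> bool" where
  "positive_op T \<longleftrightarrow> bounded_op T \<and>
     (\<forall>x\<in>l2. Im (l2inner x (T x)) = 0 \<and> Re (l2inner x (T x)) \<ge> 0)"

definition projection :: "'a op \<Rightarrow> bool" where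
  "projection P \<longleftrightarrow> bounded_op P \<and>
     (\<forall>x\<in>l2. P (P x) = P x) \<and>
     (\<forall>x\<in>l2. \<forall>y\<in>l2. l2inner (P x) y = l2inner x (P y))"

definition orthogonal_ops :: "'a op \<Rightarrow> 'a op \<Rightarrow> bool" where
  "orthogonal_ops P Q \<longleftrightarrow> (\<forall>x\<in>l2. P (Q x) = 0)"

definition rank_one_proj :: "'a vec \<Rightarrow> 'a op" where
  "rank_one_proj e x = (if x \<in> l2 then (\<lambda>i. l2inner e x * e i) else 0)"

definition sot_sum_of :: "('b \<Rightarrow> 'a op) \<Rightarrow> 'b set \<Rightarrow> 'a op \<Rightarrow> bool" where
  "sot_sum_of p I S \<longleftrightarrow> bounded_op S \<and>
     (\<forall>x\<in>l2. ((\<lambda>F. l2norm (sum (\<lambda>\<alpha>. p \<alpha> x) F - S x)) \<longlongrightarrow> 0)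
                 (finite_subsets_at_top I))"

definition sot_sum :: "('b \<Rightarrow> 'a op) \<Rightarrow> 'b set \<Rightarrow> 'a op" where
  "sot_sum p I = (THE S. sot_sum_of p I S)"

definition state :: "('a op \<Rightarrow> complex) \<Rightarrow> bool" where
  "state \<phi> \<longleftrightarrow>
     (\<forall>S T. bounded_op S \<and> bounded_op T \<longrightarrow> \<phi> (S + T) = \<phi> S + \<phi> T) \<and>
     (\<forall>c T. bounded_op T \<longrightarrow> \<phi> (\<lambda>x i. c * T x i) = c * \<phi> T) \<and>
     (\<forall>T. positive_op T \<longrightarrow> Im (\<phi> T) = 0 \<and> Re (\<phi> T) \<ge> 0) \<and>
     \<phi> id_op = 1"

definition pure_state :: "('a op \<Rightarrow> complex) \<Rightarrow> bool" where
  "pure_state \<phi> \<longleftrightarrow> state \<phi> \<and>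
     (\<forall>\<psi>1 \<psi>2 (t::real). state \<psi>1 \<and> state \<psi>2 \<and> 0 < t \<and> t < 1 \<and>
        (\<forall>T. bounded_op T \<longrightarrow> \<phi> T = complex_of_real t * \<psi>1 T + complex_of_real (1 - t) * \<psi>2 T)
        \<longrightarrow> (\<forall>T. bounded_op T \<longrightarrow> \<psi>1 T = \<phi> T))"

definition singular_state :: "('a op \<Rightarrow> complex) \<Rightarrow> bool" where
  "singular_state \<phi> \<longleftrightarrow> state \<phi> \<and>
     (\<forall>e\<in>l2. l2norm e = 1 \<longrightarrow> \<phi> (rank_one_proj e) = 0)"

definition countably_additive_state :: "('a op \<Rightarrow> complex) \<Rightarrow> bool" where
  "countably_additive_state \<phi> \<longleftrightarrow>
     (\<forall>p :: nat \<Rightarrow> 'a op. (\<forall>n. projection (p n)) \<and>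
        (\<forall>m n. m \<noteq> n \<longrightarrow> orthogonal_ops (p m) (p n))
        \<longrightarrow> ((\<lambda>n. \<phi> (p n)) has_sum \<phi> (sot_sum p UNIV)) UNIV)"

text \<open>${<}\kappa$-additivity; families of size lambda < kappa are indexed by subsets
  I of kappa (= UNIV :: 'a set) with |I| < kappa.\<close>
definition lt_kappa_additive_state :: "('a op \<Rightarrow> complex) \<Rightarrow> bool" where
  "lt_kappa_additive_state \<phi> \<longleftrightarrow>
     (\<forall>(I :: 'a set) (p :: 'a \<Rightarrow> 'a op).
        (card_of I, card_of (UNIV :: 'a set)) \<in> ordLess \<and>
        (\<forall>\<alpha>\<in>I. projection (p \<alpha>)) \<and>
        (\<forall>\<alpha>\<in>I. \<forall>\<beta>\<in>I. \<alpha> \<noteq> \<beta> \<longrightarrow> orthogonal_ops (p \<alpha>) (p \<beta>))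
        \<longrightarrow> ((\<lambda>\<alpha>. \<phi> (p \<alpha>)) has_sum \<phi> (sot_sum p I)) I)"

definition countably_additive_meas :: "('a set \<Rightarrow> real) \<Rightarrow> bool" where
  "countably_additive_meas \<mu> \<longleftrightarrow>
     (\<forall>A :: nat \<Rightarrow> 'a set. disjoint_family A \<longrightarrow> (\<lambda>n. \<mu> (A n)) sums \<mu> (\<Union>n. A n))"

definition lt_kappa_additive_meas :: "('a set \<Rightarrow> real) \<Rightarrow> bool" where
  "lt_kappa_additive_meas \<mu> \<longleftrightarrow>
     (\<forall>(I :: 'a set) (A :: 'a \<Rightarrow> 'a set).
        (card_of I, card_of (UNIV :: 'a set)) \<in> ordLess \<and> disjoint_family_on A I
        \<longrightarrow> ((\<lambda>\<alpha>. \<mu> (A \<alpha>)) has_sum \<mu> (\<Union>\<alpha>\<in>I. A \<alpha>)) I)"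

definition vanishes_on_singletons :: "('a set \<Rightarrow> real) \<Rightarrow> bool" where
  "vanishes_on_singletons \<mu> \<longleftrightarrow> (\<forall>x. \<mu> {x} = 0)"

definition probability_meas :: "('a set \<Rightarrow> real) \<Rightarrow> bool" where
  "probability_meas \<mu> \<longleftrightarrow> (\<forall>A. \<mu> A \<ge> 0) \<and> \<mu> UNIV = 1"

definition two_valued_nonzero :: "('a set \<Rightarrow> real) \<Rightarrow> bool" where
  "two_valued_nonzero \<mu> \<longleftrightarrow> (\<forall>A. \<mu> A \<in> {0, 1}) \<and> (\<exists>A. \<mu> A \<noteq> 0)"

definition measurable_card :: "'a itself \<Rightarrow> bool" where
  "measurable_card _ \<longleftrightarrow> \<not> countable (UNIV :: 'a set) \<and>
     (\<exists>\<mu> :: 'a set \<Rightarrow> real. two_valued_nonzero \<mu> \<and> lt_kappa_additive_meas \<mu> \<and> vanishes_on_singletons \<mu>)"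

definition real_valued_measurable :: "'a itself \<Rightarrow> bool" where
  "real_valued_measurable _ \<longleftrightarrow> \<not> countable (UNIV :: 'a set) \<and>
     (\<exists>\<mu> :: 'a set \<Rightarrow> real. probability_meas \<mu> \<and> lt_kappa_additive_meas \<mu> \<and> vanishes_on_singletons \<mu>)"

definition ulam_measurable :: "'a itself \<Rightarrow> bool" where
  "ulam_measurable _ \<longleftrightarrow> \<not> countable (UNIV :: 'a set) \<and>
     (\<exists>\<mu> :: 'a set \<Rightarrow> real. two_valued_nonzero \<mu> \<and> countably_additive_meas \<mu> \<and> vanishes_on_singletons \<mu>)"

definition ulam_real_valued_measurable :: "'a itself \<Rightarrow> bool" where
  "ulam_real_valued_measurable _ \<longleftrightarrow> \<not> countable (UNIV :: 'a set) \<and>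
     (\<exists>\<mu> :: 'a set \<Rightarrow> real. probability_meas \<mu> \<and> countably_additive_meas \<mu> \<and> vanishes_on_singletons \<mu>)"

end

theory Submission
  imports Defs
begin

text \<open>
  A measure \<open>\<mu>\<close> yields the state \<open>T \<mapsto> \<integral> \<langle>e\<^sub>a, T e\<^sub>a\<rangle> d\<mu>(a)\<close>, and a state yields the measure
  \<open>A \<mapsto> \<phi>(P\<^sub>A)\<close> with \<open>P\<^sub>A\<close> the diagonal projection; only purity needs an argument. In both directions it
  rests on the fact that the matrices of countably many operators have countable supports in each
  row and column, so that the index set splits into countable blocks reducing all of them; taking
  one element from each block covers the index set by countably many transversals.

  If \<open>\<mu>\<close> is two-valued and \<open>H\<close> is hermitian, one transversal has measure \<open>1\<close>, so on some set \<open>A\<close> of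
  measure \<open>1\<close> the corner \<open>P\<^sub>A H P\<^sub>A\<close> is a scalar multiple of \<open>P\<^sub>A\<close>. Any state occurring in a convex
  decomposition of \<open>\<phi>\<close> is \<open>1\<close> on \<open>P\<^sub>A\<close>, hence agrees with \<open>\<phi>\<close> at \<open>H\<close>.

  Conversely let \<open>\<phi>\<close> be pure. By Hahn-Banach and extremality, for each set \<open>A\<close> and \<open>\<delta> > 0\<close> there is
  \<open>h \<ge> 0\<close> with \<open>\<phi>(h) \<le> \<delta>\<close> and \<open>\<plusminus>(P\<^sub>A - \<mu>(A)) \<le> h\<close>. For a sequence of sets, a weighted sum of such
  operators is a quadratic form that is finite at some nonzero vector: otherwise it would dominate
  arbitrarily large multiples of the projections onto transversals, contradicting countable
  additivity of \<open>\<mu>\<close>. Such a vector \<open>x\<close> satisfies \<open>\<parallel>P\<^sub>A x\<parallel>\<^sup>2 = \<mu>(A) \<parallel>x\<parallel>\<^sup>2\<close> for all sets of the sequence.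
  As \<open>\<bar>x\<bar>\<^sup>2\<close> is a purely atomic measure, \<open>\<mu>\<close> cannot be atomless; restricting it to an atom and
  normalising gives a two-valued measure.
\<close>

section \<open>Square-summable vectors\<close>

text \<open>The measure of a pure state need not be two-valued. Conjugating the state of a
  two-valued measure by a unitary that mixes basis vectors in pairs gives a pure state whose measure
  can be the average of two different two-valued measures. This is why the converse looks for an
  atom instead of showing that every \<open>\<mu>(A)\<close> is \<open>0\<close> or
  \<open>1\<close>. Countability is the resource that every purity argument has to respect:
  \<open>\<mu>\<close> controls only countable covers. Vectors in \<open>l2\<close> have countable
  support, so the blocks are countable, and numbering the members of each block turns arbitrarily
  many blocks into countably many transversals. Distinct basis vectors of one transversal do not
  interact under the given operators, so lower bounds on single coordinates add up to an operator
  inequality, which a state respects. The weighted sum of the operators \<open>h\<close> need not be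
  a bounded operator: the state bounds only its partial sums. Finiteness at a nonzero vector is
  therefore a claim of its own. Since \<open>\<kappa>\<close> is uncountable,
  \<open><\<kappa>\<close>-additivity implies countable additivity, and the purity arguments use
  only the latter.\<close>

lemma l2_bounded_sums:
  assumes "\<And>F. finite F \<Longrightarrow> (\<Sum>i\<in>F. (cmod (x i))^2) \<le> C"
  shows "x \<in> l2" and "(l2norm x)^2 \<le> C"
proof -
  have s: "(\<lambda>i. (cmod (x i))^2) summable_on UNIV"
    by (rule nonneg_bdd_above_summable_on) (use assms in \<open>auto simp: bdd_above_def\<close>)
  show "x \<in> l2" using s by (simp add: l2_def)
  have "(l2norm x)^2 = infsum (\<lambda>i. (cmod (x i))^2) UNIV"
    by (simp add: l2norm_def infsum_nonneg)
  also have "\<dots> \<le> C"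
    by (rule infsum_le_finite_sums[OF s]) (use assms in auto)
  finally show "(l2norm x)^2 \<le> C" .
qed

lemma l2norm_nonneg [simp]: "l2norm x \<ge> 0"
  by (simp add: l2norm_def infsum_nonneg)

lemma l2norm_sq: "(l2norm x)^2 = infsum (\<lambda>i. (cmod (x i))^2) UNIV"
  by (simp add: l2norm_def infsum_nonneg)

lemma sum_le_l2norm_sq:
  assumes "x \<in> l2" "finite F"
  shows "(\<Sum>i\<in>F. (cmod (x i))^2) \<le> (l2norm x)^2"
  unfolding l2norm_sq
  by (rule finite_sum_le_infsum) (use assms in \<open>auto simp: l2_def\<close>)

lemma cmod_le_l2norm:
  assumes "x \<in> l2" shows "cmod (x i) \<le> l2norm x"
  using sum_le_l2norm_sq[OF assms, of "{i}"] by (auto intro: power2_le_imp_le[OF _ l2norm_nonneg])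

lemma l2norm_eq_0:
  assumes "x \<in> l2" "l2norm x = 0" shows "x = 0"
proof
  fix i show "x i = 0 i" using cmod_le_l2norm[OF assms(1), of i] assms(2) by simp
qed

lemma l2_inner_abs_summable:
  assumes "x \<in> l2" "y \<in> l2"
  shows "(\<lambda>i. cmod (cnj (x i) * y i)) summable_on UNIV"
proof (rule summable_on_comparison_test)
  show "(\<lambda>i. (cmod (x i))^2 + (cmod (y i))^2) summable_on UNIV"
    using assms by (intro summable_on_add) (auto simp: l2_def)
  fix i
  have "2 * cmod (x i) * cmod (y i) \<le> (cmod (x i))^2 + (cmod (y i))^2"
    by (rule sum_squares_bound)
  moreover have "0 \<le> cmod (x i) * cmod (y i)" by simp
  ultimately show "cmod (cnj (x i) * y i) \<le> (cmod (x i))^2 + (cmod (y i))^2"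
    unfolding norm_mult complex_mod_cnj by linarith
qed simp

lemma l2_inner_summable:
  assumes "x \<in> l2" "y \<in> l2"
  shows "(\<lambda>i. cnj (x i) * y i) summable_on UNIV"
  by (rule Infinite_Sum.abs_summable_summable[OF l2_inner_abs_summable[OF assms]])

lemma l2_0 [simp]: "0 \<in> l2"
  by (simp add: l2_def)

lemma l2_add [simp]:
  assumes "x \<in> l2" "y \<in> l2" shows "x + y \<in> l2"
proof (rule l2_bounded_sums(1))
  fix F :: "'a set" assume F: "finite F"
  have "(cmod ((x + y) i))^2 \<le> 2 * (cmod (x i))^2 + 2 * (cmod (y i))^2" for i
  proof -
    have "(cmod ((x + y) i))^2 \<le> (cmod (x i) + cmod (y i))^2"
      by (intro power_mono) (auto simp: norm_triangle_ineq)
    also have "\<dots> \<le> 2 * (cmod (x i))^2 + 2 * (cmod (y i))^2"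
      using sum_squares_bound[of "cmod (x i)" "cmod (y i)"] by (simp add: power2_sum)
    finally show ?thesis .
  qed
  then have "(\<Sum>i\<in>F. (cmod ((x + y) i))^2) \<le> (\<Sum>i\<in>F. 2 * (cmod (x i))^2 + 2 * (cmod (y i))^2)"
    by (intro sum_mono) auto
  also have "\<dots> = 2 * (\<Sum>i\<in>F. (cmod (x i))^2) + 2 * (\<Sum>i\<in>F. (cmod (y i))^2)"
    by (simp add: sum.distrib sum_distrib_left)
  also have "\<dots> \<le> 2 * (l2norm x)^2 + 2 * (l2norm y)^2"
    using sum_le_l2norm_sq[OF assms(1) F] sum_le_l2norm_sq[OF assms(2) F] by simp
  finally show "(\<Sum>i\<in>F. (cmod ((x + y) i))^2) \<le> 2 * (l2norm x)^2 + 2 * (l2norm y)^2" .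
qed

lemma l2_scale [simp]:
  assumes "x \<in> l2" shows "(\<lambda>i. c * x i) \<in> l2"
  using assms summable_on_cmult_right[of "\<lambda>i. (cmod (x i))^2" UNIV "(cmod c)^2"]
  by (simp add: l2_def norm_mult power_mult_distrib)

lemma l2_uminus [simp]: "x \<in> l2 \<Longrightarrow> - x \<in> l2"
  by (simp add: l2_def)

lemma l2_diff [simp]: "x \<in> l2 \<Longrightarrow> y \<in> l2 \<Longrightarrow> x - y \<in> l2"
  using l2_add[of x "- y"] by simp

lemma l2_sum [simp]: "(\<And>a. a \<in> F \<Longrightarrow> f a \<in> l2) \<Longrightarrow> sum f F \<in> l2"
  by (induction F rule: infinite_finite_induct) auto

lemma sum_vec_apply: "sum f F i = (\<Sum>a\<in>F. f a i)"
  by (induction F rule: infinite_finite_induct) auto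

lemma l2inner_add_right:
  assumes "x \<in> l2" "y \<in> l2" "z \<in> l2"
  shows "l2inner x (y + z) = l2inner x y + l2inner x z"
  unfolding l2inner_def using assms
  by (simp add: distrib_left infsum_add l2_inner_summable)

lemma l2inner_scale_right: "l2inner x (\<lambda>i. c * y i) = c * l2inner x y"
  unfolding l2inner_def
  by (subst infsum_cmult_right'[symmetric]) (simp add: mult_ac)

lemma l2inner_commute: "l2inner y x = cnj (l2inner x y)"
  unfolding l2inner_def
  by (subst infsum_cnj[symmetric]) (simp add: mult_ac)

lemma l2inner_add_left:
  assumes "x \<in> l2" "y \<in> l2" "z \<in> l2"
  shows "l2inner (x + y) z = l2inner x z + l2inner y z"
  unfolding l2inner_commute[of "x + y" z] l2inner_commute[of x z] l2inner_commute[of y z]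
  using assms by (simp add: l2inner_add_right)

lemma l2inner_scale_left: "l2inner (\<lambda>i. c * x i) y = cnj c * l2inner x y"
  using l2inner_scale_right[of y c x] l2inner_commute[of "\<lambda>i. c * x i" y] l2inner_commute[of x y]
  by simp

lemma l2inner_uminus_right [simp]: "l2inner x (- y) = - l2inner x y"
  using l2inner_scale_right[of x "-1" y] by (simp add: fun_Compl_def)

lemma l2inner_uminus_left [simp]: "l2inner (- x) y = - l2inner x y"
  using l2inner_scale_left[of "-1" x y] by (simp add: fun_Compl_def)

lemma l2inner_zero [simp]: "l2inner x 0 = 0" "l2inner 0 x = 0"
  by (simp_all add: l2inner_def)

lemma l2inner_diff_right:
  "x \<in> l2 \<Longrightarrow> y \<in> l2 \<Longrightarrow> z \<in> l2 \<Longrightarrow> l2inner x (y - z) = l2inner x y - l2inner x z"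
  using l2inner_add_right[of x y "- z"] by simp

lemma l2inner_diff_left:
  "x \<in> l2 \<Longrightarrow> y \<in> l2 \<Longrightarrow> z \<in> l2 \<Longrightarrow> l2inner (x - y) z = l2inner x z - l2inner y z"
  using l2inner_add_left[of x "- y" z] by simp

lemma l2inner_self:
  assumes "x \<in> l2" shows "l2inner x x = complex_of_real ((l2norm x)^2)"
proof -
  have "((\<lambda>i. complex_of_real ((cmod (x i))^2)) has_sum complex_of_real ((l2norm x)^2)) UNIV"
    unfolding l2norm_sq using assms by (intro has_sum_of_real has_sum_infsum) (simp add: l2_def)
  also have "(\<lambda>i. complex_of_real ((cmod (x i))^2)) = (\<lambda>i. cnj (x i) * x i)"
    by (subst complex_norm_square) (simp add: mult.commute)
  finally show ?thesis unfolding l2inner_def by (rule infsumI)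
qed

lemma l2_Cauchy_Schwarz:
  assumes "x \<in> l2" "y \<in> l2"
  shows "cmod (l2inner x y) \<le> l2norm x * l2norm y"
proof -
  have "cmod (l2inner x y) \<le> infsum (\<lambda>i. cmod (cnj (x i) * y i)) UNIV"
    unfolding l2inner_def by (rule norm_infsum_bound[OF l2_inner_abs_summable[OF assms]])
  also have "\<dots> \<le> l2norm x * l2norm y"
  proof (rule infsum_le_finite_sums[OF l2_inner_abs_summable[OF assms]])
    fix F :: "'a set" assume F: "finite F"
    have "(\<Sum>i\<in>F. cmod (cnj (x i) * y i)) = (\<Sum>i\<in>F. \<bar>cmod (x i)\<bar> * \<bar>cmod (y i)\<bar>)"
      by (simp add: norm_mult)
    also have "\<dots> \<le> L2_set (\<lambda>i. cmod (x i)) F * L2_set (\<lambda>i. cmod (y i)) F"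
      by (rule L2_set_mult_ineq)
    also have "\<dots> \<le> l2norm x * l2norm y"
      unfolding L2_set_def using assms F sum_le_l2norm_sq
      by (intro mult_mono real_le_lsqrt) (auto intro!: sum_nonneg)
    finally show "(\<Sum>i\<in>F. cmod (cnj (x i) * y i)) \<le> l2norm x * l2norm y" .
  qed
  finally show ?thesis .
qed

lemma l2norm_add_sq:
  assumes "x \<in> l2" "y \<in> l2"
  shows "(l2norm (x + y))^2 = (l2norm x)^2 + 2 * Re (l2inner x y) + (l2norm y)^2"
proof -
  have "complex_of_real ((l2norm (x + y))^2) = l2inner (x + y) (x + y)"
    using assms by (simp add: l2inner_self)
  also have "\<dots> = l2inner x x + l2inner x y + cnj (l2inner x y) + l2inner y y"
    using assms by (simp add: l2inner_add_left l2inner_add_right flip: l2inner_commute[of y x])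
  finally have "Re (complex_of_real ((l2norm (x + y))^2)) = Re \<dots>" by simp
  then show ?thesis using assms by (simp add: l2inner_self)
qed

lemma l2norm_uminus [simp]: "l2norm (- x) = l2norm x"
  by (simp add: l2norm_def)

lemma l2norm_minus_commute: "l2norm (x - y) = l2norm (y - x)"
  using l2norm_uminus[of "x - y"] by simp

lemma l2norm_0 [simp]: "l2norm 0 = 0"
  by (simp add: l2norm_def)

lemma l2norm_scale: "l2norm (\<lambda>i. c * x i) = cmod c * l2norm x"
  unfolding l2norm_def
  by (simp add: norm_mult power_mult_distrib infsum_cmult_right' real_sqrt_mult)

lemma l2norm_triangle:
  assumes "x \<in> l2" "y \<in> l2" shows "l2norm (x + y) \<le> l2norm x + l2norm y"
proof (rule power2_le_imp_le)
  have "Re (l2inner x y) \<le> l2norm x * l2norm y"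
    using l2_Cauchy_Schwarz[OF assms] complex_Re_le_cmod order_trans by blast
  then show "(l2norm (x + y))^2 \<le> (l2norm x + l2norm y)^2"
    by (simp add: l2norm_add_sq[OF assms] power2_sum)
qed simp

text \<open>Lower semicontinuity of the norm under coordinatewise limits: each finite partial sum
  passes to the limit. The filter is arbitrary, so the fact serves sequences as well as nets of
  finite subsets.\<close>

lemma l2_limit_of_bounded:
  assumes ne: "F \<noteq> bot"
    and lim: "\<And>i. ((\<lambda>n. z n i) \<longlongrightarrow> w i) F"
    and bd: "eventually (\<lambda>n. z n \<in> l2 \<and> l2norm (z n) \<le> C) F"
  shows "w \<in> l2" and "l2norm w \<le> C"
proof -
  have C0: "C \<ge> 0"
    using eventually_happens[OF bd] ne l2norm_nonneg order_trans by blast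
  have fin: "(\<Sum>i\<in>G. (cmod (w i))^2) \<le> C^2" if G: "finite G" for G
  proof (rule tendsto_upperbound[OF _ _ ne])
    show "((\<lambda>n. \<Sum>i\<in>G. (cmod (z n i))^2) \<longlongrightarrow> (\<Sum>i\<in>G. (cmod (w i))^2)) F"
      by (intro tendsto_intros lim)
    show "eventually (\<lambda>n. (\<Sum>i\<in>G. (cmod (z n i))^2) \<le> C^2) F"
      using bd
    proof eventually_elim
      case (elim n)
      then have "(l2norm (z n))^2 \<le> C^2" by (intro power_mono) auto
      then show ?case using sum_le_l2norm_sq[of "z n" G] elim G by linarith
    qed
  qed
  show "w \<in> l2" by (rule l2_bounded_sums(1)[OF fin])
  have "(l2norm w)^2 \<le> C^2" by (rule l2_bounded_sums(2)[OF fin])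
  then show "l2norm w \<le> C" using C0 power2_le_imp_le by blast
qed

text \<open>The coordinatewise limit is also the norm limit: in a bound on \<open>z n - z m\<close>,
  fix \<open>n\<close>, let \<open>m\<close> tend to infinity and use lower semicontinuity of the
  norm.\<close>

lemma l2_complete:
  assumes l2: "\<And>n::nat. z n \<in> l2"
    and cauchy: "\<And>e. e > 0 \<Longrightarrow> \<exists>N. \<forall>m\<ge>N. \<forall>n\<ge>N. l2norm (z m - z n) \<le> e"
  obtains w where "w \<in> l2" "(\<lambda>n. l2norm (z n - w)) \<longlonglongrightarrow> 0"
proof -
  have "Cauchy (\<lambda>n. z n i)" for i
  proof (rule CauchyI)
    fix e :: real assume "e > 0"
    then obtain N where N: "\<forall>m\<ge>N. \<forall>n\<ge>N. l2norm (z m - z n) \<le> e/2"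
      using cauchy[of "e/2"] by auto
    have "cmod (z m i - z n i) < e" if "m \<ge> N" "n \<ge> N" for m n
    proof -
      have "cmod ((z m - z n) i) \<le> e/2"
        using cmod_le_l2norm[of "z m - z n" i] N that l2 by (meson l2_diff order.trans)
      then show ?thesis using \<open>e > 0\<close> by simp
    qed
    then show "\<exists>M. \<forall>m\<ge>M. \<forall>n\<ge>M. norm (z m i - z n i) < e" by blast
  qed
  then have "\<forall>i. \<exists>l. (\<lambda>n. z n i) \<longlonglongrightarrow> l"
    using Cauchy_convergent convergentD by blast
  then obtain w where w: "\<And>i. (\<lambda>n. z n i) \<longlonglongrightarrow> w i" by metis
  have bd: "z n - w \<in> l2 \<and> l2norm (z n - w) \<le> e"
    if N: "\<forall>m\<ge>N. \<forall>n\<ge>N. l2norm (z m - z n) \<le> e" and n: "n \<ge> N" for N n e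
  proof -
    have lim: "((\<lambda>m. (z n - z m) i) \<longlonglongrightarrow> (z n - w) i)" for i
      by (auto intro!: tendsto_intros w)
    have ev: "eventually (\<lambda>m. z n - z m \<in> l2 \<and> l2norm (z n - z m) \<le> e) sequentially"
      unfolding eventually_sequentially by (intro exI[of _ N]) (use N n l2 in simp)
    show ?thesis using l2_limit_of_bounded[OF sequentially_bot lim ev] by blast
  qed
  obtain N where "\<forall>m\<ge>N. \<forall>n\<ge>N. l2norm (z m - z n) \<le> 1" using cauchy[of 1] by auto
  then have "z N - w \<in> l2" using bd by blast
  then have "z N - (z N - w) \<in> l2" using l2 l2_diff by blast
  then have wl: "w \<in> l2" by simp
  have "(\<lambda>n. l2norm (z n - w)) \<longlonglongrightarrow> 0"
  proof (rule LIMSEQ_I)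
    fix e :: real assume e: "e > 0"
    then obtain N where "\<forall>m\<ge>N. \<forall>n\<ge>N. l2norm (z m - z n) \<le> e/2"
      using cauchy[of "e/2"] by auto
    then have "\<forall>n\<ge>N. l2norm (z n - w) \<le> e/2"
      using bd by blast
    then have "\<forall>n\<ge>N. norm (l2norm (z n - w) - 0) < e"
      using e by (metis abs_of_nonneg diff_zero half_gt_zero_iff l2norm_nonneg le_less_trans field_sum_of_halves less_add_same_cancel1 real_norm_def)
    then show "\<exists>N. \<forall>n\<ge>N. norm (l2norm (z n - w) - 0) < e" by blast
  qed
  then show ?thesis using that wl by blast
qed

section \<open>Coordinate vectors and restriction to coordinates\<close>

definition std_basis :: "'a \<Rightarrow> 'a vec" where
  "std_basis a = (\<lambda>i. if i = a then 1 else 0)"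

lemma l2inner_std_basis_left [simp]: "l2inner (std_basis a) x = x a"
proof -
  have "l2inner (std_basis a) x = infsum (\<lambda>i. cnj (std_basis a i) * x i) {a}"
    unfolding l2inner_def by (rule infsum_cong_neutral) (auto simp: std_basis_def)
  then show ?thesis by (simp add: std_basis_def)
qed

lemma l2inner_std_basis_right [simp]: "l2inner x (std_basis a) = cnj (x a)"
  by (subst l2inner_commute) simp

lemma std_basis_l2 [simp]: "std_basis a \<in> l2"
proof (rule l2_bounded_sums(1))
  fix F :: "'a set" assume "finite F"
  have "(\<Sum>i\<in>F. (cmod (std_basis a i))^2) = (\<Sum>i\<in>F. if i = a then 1 else 0)"
    by (rule sum.cong) (auto simp: std_basis_def)
  also have "\<dots> \<le> (1::real)" using \<open>finite F\<close> by simp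
  finally show "(\<Sum>i\<in>F. (cmod (std_basis a i))^2) \<le> (1::real)" .
qed

lemma l2norm_std_basis [simp]: "l2norm (std_basis a) = 1"
proof -
  have "complex_of_real ((l2norm (std_basis a))^2) = std_basis a a"
    by (subst l2inner_self[symmetric]) (simp_all del: l2inner_std_basis_right)
  then have "complex_of_real ((l2norm (std_basis a))^2) = 1" by (simp add: std_basis_def)
  then have "(l2norm (std_basis a))^2 = 1" using of_real_eq_1_iff by blast
  then show ?thesis using l2norm_nonneg[of "std_basis a"] by (simp add: power2_eq_1_iff)
qed

definition restrict_vec :: "'a set \<Rightarrow> 'a vec \<Rightarrow> 'a vec" where
  "restrict_vec A x = (\<lambda>i. if i \<in> A then x i else 0)"

lemma restrict_vec_l2 [simp]: "x \<in> l2 \<Longrightarrow> restrict_vec A x \<in> l2"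
proof (rule l2_bounded_sums(1)[where C = "(l2norm x)^2"])
  fix F :: "'a set" assume "x \<in> l2" "finite F"
  have "(\<Sum>i\<in>F. (cmod (restrict_vec A x i))^2) \<le> (\<Sum>i\<in>F. (cmod (x i))^2)"
    by (intro sum_mono) (auto simp: restrict_vec_def)
  then show "(\<Sum>i\<in>F. (cmod (restrict_vec A x i))^2) \<le> (l2norm x)^2"
    using sum_le_l2norm_sq[OF \<open>x \<in> l2\<close> \<open>finite F\<close>] by linarith
qed

lemma l2inner_restrict_vec_cong:
  "l2inner (restrict_vec A x) (restrict_vec A y) = l2inner x (restrict_vec A y)"
  "l2inner (restrict_vec A x) y = l2inner x (restrict_vec A y)"
  unfolding l2inner_def restrict_vec_def by (auto intro!: infsum_cong)

lemma restrict_vec_split: "x = restrict_vec A x + restrict_vec (- A) x"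
  by (auto simp: restrict_vec_def)

lemma l2norm_split:
  assumes "x \<in> l2"
  shows "(l2norm x)^2 = (l2norm (restrict_vec A x))^2 + (l2norm (restrict_vec (- A) x))^2"
proof -
  have "l2inner (restrict_vec A x) (restrict_vec (- A) x) = 0"
    unfolding l2inner_def by (rule infsum_0) (auto simp: restrict_vec_def)
  then show ?thesis
    using l2norm_add_sq[of "restrict_vec A x" "restrict_vec (- A) x"] assms
    by (simp flip: restrict_vec_split)
qed

lemma l2norm_restrict_le:
  assumes "x \<in> l2" shows "l2norm (restrict_vec A x) \<le> l2norm x"
  using l2norm_split[OF assms, of A] by (auto intro: power2_le_imp_le[OF _ l2norm_nonneg])

section \<open>Bounded operators and sums of projections\<close>

lemma bounded_op_l2: "bounded_op T \<Longrightarrow> x \<in> l2 \<Longrightarrow> T x \<in> l2"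
  by (simp add: bounded_op_def)

lemma bounded_op_outside: "bounded_op T \<Longrightarrow> x \<notin> l2 \<Longrightarrow> T x = 0"
  by (simp add: bounded_op_def)

lemma bounded_op_plus:
  "bounded_op T \<Longrightarrow> x \<in> l2 \<Longrightarrow> y \<in> l2 \<Longrightarrow> T (x + y) = T x + T y"
  by (simp add: bounded_op_def)

lemma bounded_op_cmult:
  "bounded_op T \<Longrightarrow> x \<in> l2 \<Longrightarrow> T (\<lambda>i. c * x i) = (\<lambda>i. c * T x i)"
  by (simp add: bounded_op_def)

lemma bounded_op_minus:
  assumes "bounded_op T" "x \<in> l2" "y \<in> l2" shows "T (x - y) = T x - T y"
  using bounded_op_plus[OF assms(1), of "x - y" y] assms(2,3) by (simp add: eq_diff_eq)

lemma bounded_op_bound: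
  assumes "bounded_op T"
  obtains C where "C \<ge> 0" "\<And>x. x \<in> l2 \<Longrightarrow> l2norm (T x) \<le> C * l2norm x"
proof -
  obtain C where C: "\<forall>x\<in>l2. l2norm (T x) \<le> C * l2norm x"
    using assms by (auto simp: bounded_op_def)
  have "l2norm (T x) \<le> \<bar>C\<bar> * l2norm x" if "x \<in> l2" for x
    using C that abs_ge_self[of C] l2norm_nonneg[of x]
    by (meson mult_right_mono order.trans)
  then show ?thesis using that[of "\<bar>C\<bar>"] by simp
qed

lemma bounded_opI:
  assumes "\<And>x. x \<in> l2 \<Longrightarrow> T x \<in> l2" "\<And>x. x \<notin> l2 \<Longrightarrow> T x = 0"
    "\<And>x y. x \<in> l2 \<Longrightarrow> y \<in> l2 \<Longrightarrow> T (x + y) = T x + T y"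
    "\<And>x c. x \<in> l2 \<Longrightarrow> T (\<lambda>i. c * x i) = (\<lambda>i. c * T x i)"
    "\<And>x. x \<in> l2 \<Longrightarrow> l2norm (T x) \<le> C * l2norm x"
  shows "bounded_op T"
  using assms unfolding bounded_op_def by blast

text \<open>A name for the lambda term in \<open>state\<close>, so that it can act as the scalar
  multiplication of a vector space of operators.\<close>

definition op_scale :: "complex \<Rightarrow> 'a op \<Rightarrow> 'a op" where
  "op_scale c T = (\<lambda>x i. c * T x i)"

definition diag_proj :: "'a set \<Rightarrow> 'a op" where
  "diag_proj A x = (if x \<in> l2 then restrict_vec A x else 0)"

lemma bounded_op_add [simp]:
  assumes "bounded_op S" "bounded_op T" shows "bounded_op (S + T)"
proof -
  obtain C where C: "\<And>x. x \<in> l2 \<Longrightarrow> l2norm (S x) \<le> C * l2norm x"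
    using bounded_op_bound[OF assms(1)] by blast
  obtain D where D: "\<And>x. x \<in> l2 \<Longrightarrow> l2norm (T x) \<le> D * l2norm x"
    using bounded_op_bound[OF assms(2)] by blast
  show ?thesis
  proof (rule bounded_opI)
    fix x :: "'a vec" assume "x \<in> l2"
    then have "l2norm (S x + T x) \<le> C * l2norm x + D * l2norm x"
      using C[of x] D[of x] l2norm_triangle[of "S x" "T x"] bounded_op_l2[OF assms(1)] bounded_op_l2[OF assms(2)] by simp
    then show "l2norm ((S + T) x) \<le> (C + D) * l2norm x" by (simp add: algebra_simps)
  qed (auto simp: bounded_op_l2[OF assms(1)] bounded_op_l2[OF assms(2)]
      bounded_op_outside[OF assms(1)] bounded_op_outside[OF assms(2)]
      bounded_op_plus[OF assms(1)] bounded_op_plus[OF assms(2)]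
      bounded_op_cmult[OF assms(1)] bounded_op_cmult[OF assms(2)] algebra_simps)
qed

lemma bounded_op_scale [simp]:
  assumes "bounded_op T" shows "bounded_op (op_scale c T)"
proof -
  obtain C where C: "\<And>x. x \<in> l2 \<Longrightarrow> l2norm (T x) \<le> C * l2norm x"
    using bounded_op_bound[OF assms(1)] by blast
  show ?thesis
  proof (rule bounded_opI)
    fix x :: "'a vec" assume "x \<in> l2"
    then have "cmod c * l2norm (T x) \<le> cmod c * (C * l2norm x)"
      by (intro mult_left_mono C) auto
    then show "l2norm (op_scale c T x) \<le> (cmod c * C) * l2norm x"
      by (simp add: op_scale_def l2norm_scale algebra_simps)
  qed (auto simp: op_scale_def bounded_op_l2[OF assms] bounded_op_outside[OF assms] bounded_op_plus[OF assms]
      bounded_op_cmult[OF assms] algebra_simps)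
qed

lemma op_uminus_eq: "- T = op_scale (- 1) T"
  by (intro ext) (simp add: op_scale_def)

lemma bounded_op_uminus [simp]: "bounded_op T \<Longrightarrow> bounded_op (- T)"
  unfolding op_uminus_eq by simp

lemma bounded_op_diff [simp]: "bounded_op S \<Longrightarrow> bounded_op T \<Longrightarrow> bounded_op (S - T)"
  using bounded_op_add[of S "- T"] by simp

lemma bounded_op_0 [simp]: "bounded_op 0"
  by (rule bounded_opI[where C = 0]) auto

lemma bounded_op_sum: "(\<And>k. k \<in> F \<Longrightarrow> bounded_op (f k)) \<Longrightarrow> bounded_op (sum f F)"
  by (induction F rule: infinite_finite_induct) auto

lemma bounded_op_diag_proj [simp]: "bounded_op (diag_proj A)"
  by (rule bounded_opI[where C = 1])
    (auto simp: diag_proj_def l2norm_restrict_le, auto simp: restrict_vec_def)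

lemma id_op_eq_diag_proj: "id_op = diag_proj UNIV"
  by (auto simp: id_op_def diag_proj_def restrict_vec_def)

lemma bounded_op_id [simp]: "bounded_op id_op"
  by (simp add: id_op_eq_diag_proj)

lemma op_scale_apply: "op_scale c T x = (\<lambda>i. c * T x i)"
  by (simp add: op_scale_def)

section \<open>Quadratic forms, hermitian and positive operators\<close>

definition qform :: "'a op \<Rightarrow> 'a vec \<Rightarrow> complex" where
  "qform T x = l2inner x (T x)"

lemma qform_add:
  "bounded_op S \<Longrightarrow> bounded_op T \<Longrightarrow> x \<in> l2 \<Longrightarrow> qform (S + T) x = qform S x + qform T x"
  by (simp add: qform_def l2inner_add_right bounded_op_l2[of S] bounded_op_l2[of T])

lemma qform_diff:
  "bounded_op S \<Longrightarrow> bounded_op T \<Longrightarrow> x \<in> l2 \<Longrightarrow> qform (S - T) x = qform S x - qform T x"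
  by (simp add: qform_def l2inner_diff_right bounded_op_l2[of S] bounded_op_l2[of T])

lemma qform_uminus: "qform (- T) x = - qform T x"
  by (simp add: qform_def)

lemma qform_scale: "qform (op_scale c T) x = c * qform T x"
  by (simp add: qform_def op_scale_apply l2inner_scale_right)

lemma qform_0 [simp]: "qform 0 x = 0"
  by (simp add: qform_def)

lemma qform_sum:
  assumes "x \<in> l2" "\<And>k. k \<in> F \<Longrightarrow> bounded_op (f k)"
  shows "qform (sum f F) x = (\<Sum>k\<in>F. qform (f k) x)"
  using assms(2) by (induction F rule: infinite_finite_induct) (auto simp: qform_add bounded_op_sum assms(1))

lemma qform_diag_proj:
  assumes "x \<in> l2" shows "qform (diag_proj A) x = complex_of_real ((l2norm (restrict_vec A x))^2)"
  using assms l2inner_restrict_vec_cong(1)[of A x x] l2inner_self[of "restrict_vec A x"]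
  by (simp add: qform_def diag_proj_def)

lemma qform_id: "x \<in> l2 \<Longrightarrow> qform id_op x = complex_of_real ((l2norm x)^2)"
  by (simp add: qform_def id_op_def l2inner_self)

lemma qform_bound:
  assumes "bounded_op T"
  obtains C where "C \<ge> 0" "\<And>x. x \<in> l2 \<Longrightarrow> cmod (qform T x) \<le> C * (l2norm x)^2"
proof -
  obtain C where C: "C \<ge> 0" "\<And>x. x \<in> l2 \<Longrightarrow> l2norm (T x) \<le> C * l2norm x"
    using bounded_op_bound[OF assms] by blast
  have "cmod (qform T x) \<le> C * (l2norm x)^2" if "x \<in> l2" for x
  proof -
    have "cmod (qform T x) \<le> l2norm x * l2norm (T x)"
      unfolding qform_def using that by (intro l2_Cauchy_Schwarz bounded_op_l2[OF assms])
    also have "\<dots> \<le> l2norm x * (C * l2norm x)"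
      using C that by (intro mult_left_mono) auto
    finally show ?thesis by (simp add: power2_eq_square mult_ac)
  qed
  then show ?thesis using that C(1) by blast
qed

lemma positive_op_iff:
  "positive_op T \<longleftrightarrow> bounded_op T \<and> (\<forall>x\<in>l2. Im (qform T x) = 0 \<and> Re (qform T x) \<ge> 0)"
  by (simp add: positive_op_def qform_def)

text \<open>Stated through the quadratic form, so that positive operators are hermitian at once;
  symmetry of the operator is recovered by polarisation in \<open>hermitian_op_swap\<close>.\<close>

definition hermitian_op :: "'a op \<Rightarrow> bool" where
  "hermitian_op T \<longleftrightarrow> bounded_op T \<and> (\<forall>x\<in>l2. Im (qform T x) = 0)"

lemma positive_imp_hermitian: "positive_op T \<Longrightarrow> hermitian_op T"
  by (simp add: positive_op_iff hermitian_op_def)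

lemma hermitian_bounded: "hermitian_op T \<Longrightarrow> bounded_op T"
  by (simp add: hermitian_op_def)

text \<open>Polarisation: reality of the form at \<open>x + y\<close> compares the imaginary parts
  of the two mixed terms, reality at \<open>x + \<i> y\<close> their real parts.\<close>

lemma hermitian_op_swap:
  assumes h: "hermitian_op T" and x: "x \<in> l2" and y: "y \<in> l2"
  shows "l2inner (T x) y = l2inner x (T y)"
proof -
  have b: "bounded_op T" and z: "\<And>x. x \<in> l2 \<Longrightarrow> Im (l2inner x (T x)) = 0"
    using h by (auto simp: hermitian_op_def qform_def)
  let ?iy = "\<lambda>i. \<i> * y i"
  have iy: "?iy \<in> l2" using y by simp
  have "Im (l2inner (x + y) (T (x + y))) = 0" using z x y by simp
  then have "Im (l2inner x (T y)) + Im (l2inner y (T x)) = 0"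
    using x y z[of x] z[of y]
    by (simp add: bounded_op_plus[OF b] bounded_op_l2[OF b] l2inner_add_left l2inner_add_right)
  moreover have "Im (l2inner (x + ?iy) (T (x + ?iy))) = 0" using z x iy l2_add by blast
  then have "Im (l2inner x (T ?iy)) + Im (l2inner ?iy (T x)) = 0"
    using x iy z[of x] z[of ?iy]
    by (simp only: bounded_op_plus[OF b] l2inner_add_left l2inner_add_right bounded_op_l2[OF b] l2_add) simp
  then have "Re (l2inner x (T y)) - Re (l2inner y (T x)) = 0"
    using x y by (simp add: bounded_op_cmult[OF b] l2inner_scale_left l2inner_scale_right)
  ultimately have "l2inner x (T y) = cnj (l2inner y (T x))"
    by (simp add: complex_eq_iff)
  then show ?thesis by (simp add: l2inner_commute[of "T x" y])
qed

lemma positive_op_add [simp]: "positive_op S \<Longrightarrow> positive_op T \<Longrightarrow> positive_op (S + T)"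
  by (simp add: positive_op_iff qform_add)

lemma positive_op_scale: "positive_op T \<Longrightarrow> r \<ge> 0 \<Longrightarrow> positive_op (op_scale (complex_of_real r) T)"
  by (simp add: positive_op_iff qform_scale)

lemma positive_op_0 [simp]: "positive_op 0"
  by (simp add: positive_op_iff)

lemma positive_op_sum: "(\<And>k. k \<in> F \<Longrightarrow> positive_op (f k)) \<Longrightarrow> positive_op (sum f F)"
  by (induction F rule: infinite_finite_induct) auto

lemma positive_bounded: "positive_op T \<Longrightarrow> bounded_op T"
  by (simp add: positive_op_iff)

lemma positive_op_diag_proj [simp]: "positive_op (diag_proj A)"
  by (simp add: positive_op_iff qform_diag_proj)

lemma positive_op_id [simp]: "positive_op id_op"
  by (simp add: id_op_eq_diag_proj)

lemma projection_diag_proj [simp]: "projection (diag_proj A)"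
  unfolding projection_def
  by (auto simp: diag_proj_def l2inner_restrict_vec_cong(2), auto simp: restrict_vec_def)

lemma projection_qform:
  assumes "projection P" "x \<in> l2"
  shows "qform P x = complex_of_real ((l2norm (P x))^2)"
proof -
  have b: "bounded_op P" and pp: "P (P x) = P x"
    using assms by (auto simp: projection_def)
  have "l2inner (P x) (P x) = l2inner x (P (P x))"
    using assms bounded_op_l2[OF b] by (simp add: projection_def)
  with pp show ?thesis using l2inner_self[OF bounded_op_l2[OF b assms(2)]] by (simp add: qform_def)
qed

section \<open>Adjoints and hermitian parts\<close>

lemma finite_support_approx:
  assumes "x \<in> l2"
  shows "((\<lambda>F. l2norm (x - restrict_vec F x)) \<longlongrightarrow> 0) (finite_subsets_at_top UNIV)"
proof -
  have fin: "(l2norm (restrict_vec F x))^2 = (\<Sum>i\<in>F. (cmod (x i))^2)" if "finite F" for F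
  proof -
    have "(l2norm (restrict_vec F x))^2 = infsum (\<lambda>i. (cmod (x i))^2) F"
      unfolding l2norm_sq by (rule infsum_cong_neutral) (auto simp: restrict_vec_def)
    then show ?thesis using that by simp
  qed
  have "((\<lambda>F. \<Sum>i\<in>F. (cmod (x i))^2) \<longlongrightarrow> (l2norm x)^2) (finite_subsets_at_top UNIV)"
    using assms has_sum_infsum unfolding l2norm_sq l2_def has_sum_def by blast
  then have "((\<lambda>F. sqrt ((l2norm x)^2 - (\<Sum>i\<in>F. (cmod (x i))^2))) \<longlongrightarrow> sqrt ((l2norm x)^2 - (l2norm x)^2))
      (finite_subsets_at_top UNIV)"
    by (intro tendsto_intros)
  moreover have "eventually (\<lambda>F. sqrt ((l2norm x)^2 - (\<Sum>i\<in>F. (cmod (x i))^2)) = l2norm (x - restrict_vec F x))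
      (finite_subsets_at_top UNIV)"
  proof (rule eventually_finite_subsets_at_top_weakI)
    fix F :: "'a set" assume "finite F"
    have "x - restrict_vec F x = restrict_vec (- F) x" by (auto simp: restrict_vec_def)
    then have "(l2norm x)^2 - (\<Sum>i\<in>F. (cmod (x i))^2) = (l2norm (x - restrict_vec F x))^2"
      using l2norm_split[OF assms, of F] fin[OF \<open>finite F\<close>] by simp
    then show "sqrt ((l2norm x)^2 - (\<Sum>i\<in>F. (cmod (x i))^2)) = l2norm (x - restrict_vec F x)"
      by simp
  qed
  ultimately show ?thesis by (simp add: tendsto_cong)
qed

text \<open>Given by its coordinates, the inner products of the columns of \<open>T\<close> with
  \<open>y\<close>. That these are square summable is then a matter of proof.\<close>

definition adjoint_op :: "'a op \<Rightarrow> 'a op" where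
  "adjoint_op T y = (if y \<in> l2 then (\<lambda>i. l2inner (T (std_basis i)) y) else 0)"

lemma restrict_vec_finite:
  assumes "finite F"
  shows "restrict_vec F x = (\<Sum>i\<in>F. (\<lambda>j. x i * std_basis i j))"
proof
  fix j
  have "(\<Sum>i\<in>F. x i * std_basis i j) = (\<Sum>i\<in>F. if i = j then x j else 0)"
    by (rule sum.cong) (auto simp: std_basis_def)
  then show "restrict_vec F x j = (\<Sum>i\<in>F. (\<lambda>j. x i * std_basis i j)) j"
    using assms by (simp add: sum_vec_apply restrict_vec_def)
qed

lemma l2inner_op_finite_support:
  assumes T: "bounded_op T" and y: "y \<in> l2" and F: "finite F"
  shows "l2inner (T (restrict_vec F x)) y = (\<Sum>i\<in>F. cnj (x i) * adjoint_op T y i)"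
  unfolding restrict_vec_finite[OF F] using F
proof induction
  case empty
  have "T 0 = 0" using bounded_op_minus[OF T, of 0 0] by simp
  then show ?case by (simp flip: zero_fun_def)
next
  case (insert k F)
  have l: "(\<Sum>i\<in>F. (\<lambda>j. x i * std_basis i j)) \<in> l2" "(\<lambda>j. x k * std_basis k j) \<in> l2"
    by auto
  have "T (\<lambda>j. x k * std_basis k j) = (\<lambda>j. x k * T (std_basis k) j)"
    by (simp add: bounded_op_cmult[OF T])
  then have "l2inner (T (\<lambda>j. x k * std_basis k j)) y = cnj (x k) * adjoint_op T y k"
    using y by (simp add: l2inner_scale_left adjoint_op_def)
  moreover have "(\<Sum>i\<in>insert k F. (\<lambda>j. x i * std_basis i j)) =
      (\<lambda>j. x k * std_basis k j) + (\<Sum>i\<in>F. (\<lambda>j. x i * std_basis i j))"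
    by (rule sum.insert[OF insert(1,2)])
  then have "l2inner (T (\<Sum>i\<in>insert k F. (\<lambda>j. x i * std_basis i j))) y =
      l2inner (T (\<lambda>j. x k * std_basis k j)) y + l2inner (T (\<Sum>i\<in>F. (\<lambda>j. x i * std_basis i j))) y"
    using l y
    by (simp only: bounded_op_plus[OF T] l2inner_add_left bounded_op_l2[OF T])
  ultimately show ?case
    using insert sum.insert[OF insert(1,2), of "\<lambda>i. cnj (x i) * adjoint_op T y i"] by (simp only:)
qed

text \<open>Duality: a finite truncation \<open>a\<close> of the adjoint vector satisfies
  \<open>l2norm a ^ 2 = l2inner (T a) y\<close>, which is at most
  \<open>C * l2norm a * l2norm y\<close>; cancel one factor.\<close>

lemma adjoint_op_l2_bound:
  assumes T: "bounded_op T" and C: "C \<ge> 0" "\<And>x. x \<in> l2 \<Longrightarrow> l2norm (T x) \<le> C * l2norm x"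
    and y: "y \<in> l2"
  shows "adjoint_op T y \<in> l2" "l2norm (adjoint_op T y) \<le> C * l2norm y"
proof -
  let ?a = "adjoint_op T y"
  have fin: "(\<Sum>i\<in>F. (cmod (?a i))^2) \<le> (C * l2norm y)^2" if F: "finite F" for F
  proof -
    let ?s = "\<Sum>i\<in>F. (cmod (?a i))^2"
    \<comment> \<open>Membership has to come from finiteness of \<open>F\<close>, as a finite
      combination of basis vectors: \<open>?a\<close> itself is not yet known to lie in
      \<open>l2\<close>.\<close>
    have r: "restrict_vec F ?a \<in> l2"
      unfolding restrict_vec_finite[OF F] by simp
    have "(l2norm (restrict_vec F ?a))^2 = infsum (\<lambda>i. (cmod (?a i))^2) F"
      unfolding l2norm_sq by (rule infsum_cong_neutral) (auto simp: restrict_vec_def)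
    then have n: "(l2norm (restrict_vec F ?a))^2 = ?s" using F by simp
    have "complex_of_real ?s = (\<Sum>i\<in>F. cnj (?a i) * ?a i)"
      by (simp add: mult.commute flip: complex_norm_square)
    also have "\<dots> = l2inner (T (restrict_vec F ?a)) y"
      by (simp add: l2inner_op_finite_support[OF T y F])
    finally have eq: "complex_of_real ?s = l2inner (T (restrict_vec F ?a)) y" .
    have "?s = cmod (complex_of_real ?s)"
      unfolding norm_of_real by (rule abs_of_nonneg[symmetric]) (simp add: sum_nonneg)
    then have "?s = cmod (l2inner (T (restrict_vec F ?a)) y)" unfolding eq .
    also have "\<dots> \<le> l2norm (T (restrict_vec F ?a)) * l2norm y"
      using y r by (intro l2_Cauchy_Schwarz bounded_op_l2[OF T])
    also have "\<dots> \<le> (C * l2norm (restrict_vec F ?a)) * l2norm y"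
      using C r by (intro mult_right_mono) auto
    finally have le: "(l2norm (restrict_vec F ?a))^2 \<le> l2norm (restrict_vec F ?a) * (C * l2norm y)"
      using n by (simp add: mult_ac)
    have "l2norm (restrict_vec F ?a) \<le> C * l2norm y"
    proof (cases "l2norm (restrict_vec F ?a) = 0")
      case True then show ?thesis using C(1) by simp
    next
      case False
      then have "l2norm (restrict_vec F ?a) > 0" using l2norm_nonneg less_eq_real_def by metis
      then show ?thesis using le by (simp add: power2_eq_square)
    qed
    then have "(l2norm (restrict_vec F ?a))^2 \<le> (C * l2norm y)^2"
      by (intro power_mono) auto
    then show ?thesis using n by simp
  qed
  show "?a \<in> l2" by (rule l2_bounded_sums(1)[OF fin])
  have "(l2norm ?a)^2 \<le> (C * l2norm y)^2" by (rule l2_bounded_sums(2)[OF fin])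
  then show "l2norm ?a \<le> C * l2norm y" by (rule power2_le_imp_le) (use C in simp)
qed

lemma bounded_op_adjoint [simp]:
  assumes T: "bounded_op T" shows "bounded_op (adjoint_op T)"
proof -
  obtain C where C: "C \<ge> 0" "\<And>x. x \<in> l2 \<Longrightarrow> l2norm (T x) \<le> C * l2norm x"
    using bounded_op_bound[OF T] by blast
  show ?thesis
  proof (rule bounded_opI)
    show "adjoint_op T x \<in> l2" if "x \<in> l2" for x
      by (rule adjoint_op_l2_bound[OF T C that])
    show "l2norm (adjoint_op T x) \<le> C * l2norm x" if "x \<in> l2" for x
      by (rule adjoint_op_l2_bound[OF T C that])
  qed (auto simp: adjoint_op_def l2inner_add_right l2inner_scale_right bounded_op_l2[OF T])
qed

text \<open>The identity holds for truncations of \<open>x\<close> to finite sets by linearity; both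
  sides are continuous along these truncations.\<close>

lemma l2inner_adjoint:
  assumes T: "bounded_op T" and x: "x \<in> l2" and y: "y \<in> l2"
  shows "l2inner x (adjoint_op T y) = l2inner (T x) y"
proof -
  obtain C where C: "C \<ge> 0" "\<And>x. x \<in> l2 \<Longrightarrow> l2norm (T x) \<le> C * l2norm x"
    using bounded_op_bound[OF T] by blast
  let ?U = "finite_subsets_at_top (UNIV :: 'a set)"
  have "(\<lambda>i. cnj (x i) * adjoint_op T y i) summable_on UNIV"
    using x y T by (intro l2_inner_summable bounded_op_l2[of "adjoint_op T"]) auto
  then have 1: "((\<lambda>F. \<Sum>i\<in>F. cnj (x i) * adjoint_op T y i) \<longlongrightarrow> l2inner x (adjoint_op T y)) ?U"
    unfolding l2inner_def by (metis has_sum_def has_sum_infsum)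
  have "((\<lambda>F. l2inner (T x) y - l2inner (T (restrict_vec F x)) y) \<longlongrightarrow> 0) ?U"
  proof (rule Lim_null_comparison)
    show "eventually (\<lambda>F. norm (l2inner (T x) y - l2inner (T (restrict_vec F x)) y)
        \<le> C * l2norm (x - restrict_vec F x) * l2norm y) ?U"
    proof (rule always_eventually, rule allI)
      fix F
      have "l2inner (T x) y - l2inner (T (restrict_vec F x)) y = l2inner (T (x - restrict_vec F x)) y"
        using x y by (simp add: bounded_op_minus[OF T] l2inner_diff_left bounded_op_l2[OF T])
      also have "cmod \<dots> \<le> l2norm (T (x - restrict_vec F x)) * l2norm y"
        using x y by (intro l2_Cauchy_Schwarz bounded_op_l2[OF T]) auto
      also have "\<dots> \<le> C * l2norm (x - restrict_vec F x) * l2norm y"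
        using C x by (intro mult_right_mono) auto
      finally show "norm (l2inner (T x) y - l2inner (T (restrict_vec F x)) y)
        \<le> C * l2norm (x - restrict_vec F x) * l2norm y" .
    qed
    show "((\<lambda>F. C * l2norm (x - restrict_vec F x) * l2norm y) \<longlongrightarrow> 0) ?U"
      using tendsto_mult_left_zero[OF tendsto_mult_right_zero[OF finite_support_approx[OF x], of C]] .
  qed
  then have "((\<lambda>F. l2inner (T x) y - (l2inner (T x) y - l2inner (T (restrict_vec F x)) y))
      \<longlongrightarrow> l2inner (T x) y - 0) ?U"
    by (intro tendsto_intros)
  then have "((\<lambda>F. l2inner (T (restrict_vec F x)) y) \<longlongrightarrow> l2inner (T x) y) ?U" by simp
  moreover have "eventually (\<lambda>F. l2inner (T (restrict_vec F x)) y = (\<Sum>i\<in>F. cnj (x i) * adjoint_op T y i)) ?U"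
    by (rule eventually_finite_subsets_at_top_weakI) (rule l2inner_op_finite_support[OF T y])
  ultimately have "((\<lambda>F. \<Sum>i\<in>F. cnj (x i) * adjoint_op T y i) \<longlongrightarrow> l2inner (T x) y) ?U"
    by (simp add: tendsto_cong)
  then show ?thesis using 1 tendsto_unique finite_subsets_at_top_neq_bot by blast
qed

text \<open>Real and imaginary part of an operator. Equality of two states thereby reduces to
  hermitian operators, whose quadratic forms are real and can be compared.\<close>

lemma hermitian_decomposition:
  assumes T: "bounded_op T"
  obtains H K where "hermitian_op H" "hermitian_op K" "T = H + op_scale \<i> K"
proof -
  define H where "H = op_scale (1/2) (T + adjoint_op T)"
  define K where "K = op_scale (1/(2*\<i>)) (T - adjoint_op T)"
  have q: "qform (adjoint_op T) x = cnj (qform T x)" if "x \<in> l2" for x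
    using l2inner_adjoint[OF T that that] by (simp add: qform_def l2inner_commute[of "T x" x])
  have "hermitian_op H"
    unfolding hermitian_op_def H_def using T by (simp add: qform_scale qform_add q)
  moreover have "hermitian_op K"
    unfolding hermitian_op_def K_def using T by (simp add: qform_scale qform_diff q Im_divide)
  moreover have "T = H + op_scale \<i> K"
    by (intro ext) (simp add: H_def K_def op_scale_def field_simps)
  ultimately show ?thesis using that by blast
qed

section \<open>States as linear functionals\<close>

lemma state_add:
  "state \<phi> \<Longrightarrow> bounded_op S \<Longrightarrow> bounded_op T \<Longrightarrow> \<phi> (S + T) = \<phi> S + \<phi> T"
  by (simp add: state_def)

lemma state_scale: "state \<phi> \<Longrightarrow> bounded_op T \<Longrightarrow> \<phi> (op_scale c T) = c * \<phi> T"
  by (simp add: state_def op_scale_def)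

lemma state_uminus: "state \<phi> \<Longrightarrow> bounded_op T \<Longrightarrow> \<phi> (- T) = - \<phi> T"
  unfolding op_uminus_eq by (simp add: state_scale)

lemma state_diff:
  "state \<phi> \<Longrightarrow> bounded_op S \<Longrightarrow> bounded_op T \<Longrightarrow> \<phi> (S - T) = \<phi> S - \<phi> T"
  using state_add[of \<phi> S "- T"] by (simp add: state_uminus)

lemma state_0: "state \<phi> \<Longrightarrow> \<phi> 0 = 0"
  using state_diff[of \<phi> 0 0] by simp

lemma state_sum:
  "state \<phi> \<Longrightarrow> (\<And>k. k \<in> F \<Longrightarrow> bounded_op (f k)) \<Longrightarrow> \<phi> (sum f F) = (\<Sum>k\<in>F. \<phi> (f k))"
  by (induction F rule: infinite_finite_induct) (auto simp: state_add state_0 bounded_op_sum)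

lemma state_pos: "state \<phi> \<Longrightarrow> positive_op T \<Longrightarrow> Re (\<phi> T) \<ge> 0"
  by (simp add: state_def)

lemma state_pos_real: "state \<phi> \<Longrightarrow> positive_op T \<Longrightarrow> Im (\<phi> T) = 0"
  by (simp add: state_def)

lemma state_id: "state \<phi> \<Longrightarrow> \<phi> id_op = 1"
  by (simp add: state_def)

section \<open>Orthogonal families of projections and their strong sums\<close>

lemma orthogonal_sum_norm:
  assumes "finite F" "\<And>a. a \<in> F \<Longrightarrow> v a \<in> l2"
    and "\<And>a b. a \<in> F \<Longrightarrow> b \<in> F \<Longrightarrow> a \<noteq> b \<Longrightarrow> l2inner (v a) (v b) = 0"
  shows "(l2norm (sum v F))^2 = (\<Sum>a\<in>F. (l2norm (v a))^2)"
  using assms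
proof (induction F)
  case (insert k F)
  have "l2inner (v k) (sum v G) = (\<Sum>a\<in>G. l2inner (v k) (v a))" if "G \<subseteq> F" for G
    using finite_subset[OF that insert(1)] that
    by (induction G) (use insert in \<open>auto simp: l2inner_add_right subset_iff\<close>)
  moreover have "(\<Sum>a\<in>F. l2inner (v k) (v a)) = 0"
    using insert by (intro sum.neutral) auto
  ultimately have "l2inner (v k) (sum v F) = 0" by simp
  then have "(l2norm (v k + sum v F))^2 = (l2norm (v k))^2 + (\<Sum>a\<in>F. (l2norm (v a))^2)"
    using insert l2norm_add_sq[of "v k" "sum v F"] by simp
  moreover have "sum v (insert k F) = v k + sum v F" by (rule sum.insert[OF insert(1,2)])
  ultimately show ?case using sum.insert[OF insert(1,2), of "\<lambda>a. (l2norm (v a))^2"] by (simp only:)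
qed auto

text \<open>For \<open>s\<close> the finite sum at \<open>x\<close>, Pythagoras and the projection
  identity give \<open>l2norm s ^ 2 = l2inner x s\<close>, and Cauchy-Schwarz then gives the bound
  after cancelling one factor.\<close>

lemma projection_Bessel:
  assumes P: "\<And>\<alpha>. \<alpha> \<in> F \<Longrightarrow> projection (p \<alpha>)"
    and orth: "\<And>\<alpha> \<beta>. \<alpha> \<in> F \<Longrightarrow> \<beta> \<in> F \<Longrightarrow> \<alpha> \<noteq> \<beta> \<Longrightarrow> orthogonal_ops (p \<alpha>) (p \<beta>)"
    and F: "finite F" and x: "x \<in> l2"
  shows "(l2norm (\<Sum>\<alpha>\<in>F. p \<alpha> x))^2 = (\<Sum>\<alpha>\<in>F. (l2norm (p \<alpha> x))^2)"
    and "l2norm (\<Sum>\<alpha>\<in>F. p \<alpha> x) \<le> l2norm x"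
proof -
  have b: "bounded_op (p \<alpha>)" if "\<alpha> \<in> F" for \<alpha> using P that by (simp add: projection_def)
  then have l: "p \<alpha> x \<in> l2" if "\<alpha> \<in> F" for \<alpha> using bounded_op_l2 x that by blast
  have "l2inner (p \<alpha> x) (p \<beta> x) = 0" if "\<alpha> \<in> F" "\<beta> \<in> F" "\<alpha> \<noteq> \<beta>" for \<alpha> \<beta>
  proof -
    have "l2inner (p \<alpha> x) (p \<beta> x) = l2inner x (p \<alpha> (p \<beta> x))"
      using P[OF that(1)] x l[OF that(2)] by (simp add: projection_def)
    then show ?thesis using orth[OF that] x by (simp add: orthogonal_ops_def)
  qed
  then show eq: "(l2norm (\<Sum>\<alpha>\<in>F. p \<alpha> x))^2 = (\<Sum>\<alpha>\<in>F. (l2norm (p \<alpha> x))^2)"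
    using F l by (intro orthogonal_sum_norm) auto
  let ?s = "\<Sum>\<alpha>\<in>F. p \<alpha> x"
  have s: "?s \<in> l2" using l by simp
  have "l2inner x ?s = (\<Sum>\<alpha>\<in>F. l2inner x (p \<alpha> x))"
    using F l by (induction F) (auto simp: l2inner_add_right x)
  also have "\<dots> = (\<Sum>\<alpha>\<in>F. complex_of_real ((l2norm (p \<alpha> x))^2))"
    using projection_qform[OF P x] by (intro sum.cong) (auto simp: qform_def)
  finally have "(l2norm ?s)^2 = cmod (l2inner x ?s)"
    unfolding eq by (simp flip: of_real_sum of_real_power)
      (simp add: sum_nonneg)
  also have "\<dots> \<le> l2norm x * l2norm ?s" by (rule l2_Cauchy_Schwarz[OF x s])
  finally have le: "l2norm ?s * l2norm ?s \<le> l2norm x * l2norm ?s" by (simp add: power2_eq_square)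
  show "l2norm ?s \<le> l2norm x"
  proof (cases "l2norm ?s = 0")
    case False
    then have "l2norm ?s > 0" using l2norm_nonneg less_eq_real_def by metis
    then show ?thesis using le by simp
  qed simp
qed

lemma projection_norm_summable:
  assumes P: "\<And>\<alpha>. \<alpha> \<in> I \<Longrightarrow> projection (p \<alpha>)"
    and orth: "\<And>\<alpha> \<beta>. \<alpha> \<in> I \<Longrightarrow> \<beta> \<in> I \<Longrightarrow> \<alpha> \<noteq> \<beta> \<Longrightarrow> orthogonal_ops (p \<alpha>) (p \<beta>)"
    and x: "x \<in> l2"
  shows "(\<lambda>\<alpha>. (l2norm (p \<alpha> x))^2) summable_on I"
proof (rule nonneg_bdd_above_summable_on)
  show "bdd_above (sum (\<lambda>\<alpha>. (l2norm (p \<alpha> x))^2) ` {F. F \<subseteq> I \<and> finite F})"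
  proof (rule bdd_aboveI2)
    fix F assume "F \<in> {F. F \<subseteq> I \<and> finite F}"
    then have F: "F \<subseteq> I" "finite F" by auto
    have "(\<Sum>\<alpha>\<in>F. (l2norm (p \<alpha> x))^2) = (l2norm (\<Sum>\<alpha>\<in>F. p \<alpha> x))^2"
      using F by (intro projection_Bessel(1)[symmetric] P orth x) auto
    also have "\<dots> \<le> (l2norm x)^2"
      using F by (intro power_mono projection_Bessel(2) P orth x) auto
    finally show "(\<Sum>\<alpha>\<in>F. (l2norm (p \<alpha> x))^2) \<le> (l2norm x)^2" .
  qed
qed simp

text \<open>The limit is built coordinatewise, its norm is controlled by lower semicontinuity, and
  strong convergence comes from the tails of the summable squared norms in Bessel's
  inequality.\<close>

lemma sot_sum_of_exists:
  fixes p :: "'b \<Rightarrow> 'a op"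
  assumes P: "\<And>\<alpha>. \<alpha> \<in> I \<Longrightarrow> projection (p \<alpha>)"
    and orth: "\<And>\<alpha> \<beta>. \<alpha> \<in> I \<Longrightarrow> \<beta> \<in> I \<Longrightarrow> \<alpha> \<noteq> \<beta> \<Longrightarrow> orthogonal_ops (p \<alpha>) (p \<beta>)"
  shows "\<exists>S. sot_sum_of p I S"
proof -
  let ?U = "finite_subsets_at_top I"
  define S where "S x = (if x \<in> l2 then (\<lambda>i. infsum (\<lambda>\<alpha>. p \<alpha> x i) I) else 0)" for x
  have b: "bounded_op (p \<alpha>)" if "\<alpha> \<in> I" for \<alpha> using P that by (simp add: projection_def)
  have ns: "(\<lambda>\<alpha>. (l2norm (p \<alpha> x))^2) summable_on I" if "x \<in> l2" for x
    by (rule projection_norm_summable[OF P orth that])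
  have sm: "(\<lambda>\<alpha>. p \<alpha> x i) summable_on I" if x: "x \<in> l2" for x i
  proof (rule Infinite_Sum.abs_summable_summable, rule summable_on_comparison_test)
    show "(\<lambda>\<alpha>. (l2norm (p \<alpha> (std_basis i)))^2 + (l2norm (p \<alpha> x))^2) summable_on I"
      using x by (intro summable_on_add ns) auto
    fix \<alpha> assume \<alpha>: "\<alpha> \<in> I"
    let ?e = "p \<alpha> (std_basis i)"
    \<comment> \<open>Idempotence supplies a second copy of \<open>p \<alpha>\<close> that is moved
      to the basis vector; the coordinate is then dominated by two families that Bessel makes
      summable.\<close>
    have "p \<alpha> x i = l2inner (std_basis i) (p \<alpha> (p \<alpha> x))"
      using P[OF \<alpha>] x by (simp add: projection_def)
    also have "\<dots> = l2inner ?e (p \<alpha> x)"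
      using P[OF \<alpha>] bounded_op_l2[OF b[OF \<alpha>] x] by (simp add: projection_def)
    also have "cmod \<dots> \<le> l2norm ?e * l2norm (p \<alpha> x)"
      using x by (intro l2_Cauchy_Schwarz bounded_op_l2[OF b[OF \<alpha>]]) auto
    also have "\<dots> \<le> (l2norm ?e)^2 + (l2norm (p \<alpha> x))^2"
      using sum_squares_bound[of "l2norm ?e" "l2norm (p \<alpha> x)"]
        mult_nonneg_nonneg[OF l2norm_nonneg l2norm_nonneg, of ?e "p \<alpha> x"] by linarith
    finally show "cmod (p \<alpha> x i) \<le> (l2norm ?e)^2 + (l2norm (p \<alpha> x))^2" .
  qed simp
  have lim: "((\<lambda>F. (\<Sum>\<alpha>\<in>F. p \<alpha> x) i) \<longlongrightarrow> S x i) ?U" if x: "x \<in> l2" for x i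
    using has_sum_infsum[OF sm[OF x, of i]] x unfolding has_sum_def S_def sum_vec_apply by simp
  have evI: "eventually (\<lambda>F. F \<subseteq> I \<and> finite F) ?U"
    by (rule eventually_finite_subsets_at_top_weakI) auto
  have ev: "eventually (\<lambda>F. (\<Sum>\<alpha>\<in>F. p \<alpha> x) \<in> l2 \<and> l2norm (\<Sum>\<alpha>\<in>F. p \<alpha> x) \<le> 1 * l2norm x) ?U"
    if x: "x \<in> l2" for x
  proof (rule eventually_mono[OF evI])
    fix F assume F: "F \<subseteq> I \<and> finite F"
    then have "l2norm (\<Sum>\<alpha>\<in>F. p \<alpha> x) \<le> l2norm x"
      by (intro projection_Bessel(2) P orth x) auto
    moreover have "(\<Sum>\<alpha>\<in>F. p \<alpha> x) \<in> l2" using F b x bounded_op_l2 by (intro l2_sum) blast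
    ultimately show "(\<Sum>\<alpha>\<in>F. p \<alpha> x) \<in> l2 \<and> l2norm (\<Sum>\<alpha>\<in>F. p \<alpha> x) \<le> 1 * l2norm x" by simp
  qed
  have "bounded_op S"
  proof (rule bounded_opI)
    show "S x \<in> l2" if "x \<in> l2" for x
      by (rule l2_limit_of_bounded(1)[OF finite_subsets_at_top_neq_bot lim[OF that] ev[OF that]])
    show "l2norm (S x) \<le> 1 * l2norm x" if "x \<in> l2" for x
      by (rule l2_limit_of_bounded(2)[OF finite_subsets_at_top_neq_bot lim[OF that] ev[OF that]])
    show "S x = 0" if "x \<notin> l2" for x using that by (simp add: S_def)
    show "S (x + y) = S x + S y" if "x \<in> l2" "y \<in> l2" for x y
    proof
      fix i
      have "infsum (\<lambda>\<alpha>. p \<alpha> (x + y) i) I = infsum (\<lambda>\<alpha>. p \<alpha> x i + p \<alpha> y i) I"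
        using bounded_op_plus[OF b that] by (intro infsum_cong) simp
      then show "S (x + y) i = (S x + S y) i"
        using that sm by (simp add: S_def infsum_add)
    qed
    show "S (\<lambda>i. c * x i) = (\<lambda>i. c * S x i)" if "x \<in> l2" for x c
    proof
      fix i
      have "infsum (\<lambda>\<alpha>. p \<alpha> (\<lambda>i. c * x i) i) I = infsum (\<lambda>\<alpha>. c * p \<alpha> x i) I"
        using bounded_op_cmult[OF b that] by (intro infsum_cong) simp
      then show "S (\<lambda>i. c * x i) i = c * S x i"
        using that by (simp add: S_def infsum_cmult_right')
    qed
  qed
  moreover have "((\<lambda>F. l2norm ((\<Sum>\<alpha>\<in>F. p \<alpha> x) - S x)) \<longlongrightarrow> 0) ?U" if x: "x \<in> l2" for x
  proof (rule tendstoI)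
    fix e :: real assume e: "e > 0"
    let ?n = "\<lambda>\<alpha>. (l2norm (p \<alpha> x))^2"
    have "(sum ?n \<longlongrightarrow> infsum ?n I) ?U"
      using has_sum_infsum[OF ns[OF x]] unfolding has_sum_def .
    then have "eventually (\<lambda>F. dist (sum ?n F) (infsum ?n I) < (e/2)^2) ?U"
      using e by (intro tendstoD) auto
    then show "eventually (\<lambda>F. dist (l2norm ((\<Sum>\<alpha>\<in>F. p \<alpha> x) - S x)) 0 < e) ?U"
      using evI
    proof eventually_elim
      case (elim F)
      then have F: "F \<subseteq> I" "finite F" by auto
      \<comment> \<open>\<open>F\<close> stays fixed while \<open>G\<close> grows: the bound on the
        difference of partial sums is a tail of squared norms, and it passes to the difference with
        \<open>S x\<close>.\<close>
      have lm: "((\<lambda>G. ((\<Sum>\<alpha>\<in>F. p \<alpha> x) - (\<Sum>\<alpha>\<in>G. p \<alpha> x)) i) \<longlongrightarrow> ((\<Sum>\<alpha>\<in>F. p \<alpha> x) - S x) i) ?U" for i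
        using lim[OF x, of i] by (auto intro!: tendsto_intros simp: sum_vec_apply)
      have bd: "eventually (\<lambda>G. (\<Sum>\<alpha>\<in>F. p \<alpha> x) - (\<Sum>\<alpha>\<in>G. p \<alpha> x) \<in> l2 \<and>
          l2norm ((\<Sum>\<alpha>\<in>F. p \<alpha> x) - (\<Sum>\<alpha>\<in>G. p \<alpha> x)) \<le> e/2) ?U"
        unfolding eventually_finite_subsets_at_top
      proof (intro exI[of _ F] conjI allI impI F)
        fix G assume "finite G \<and> F \<subseteq> G \<and> G \<subseteq> I"
        then have G: "finite G" "F \<subseteq> G" "G \<subseteq> I" by auto
        show "(\<Sum>\<alpha>\<in>F. p \<alpha> x) - (\<Sum>\<alpha>\<in>G. p \<alpha> x) \<in> l2"
          using F G b x by (intro l2_diff l2_sum bounded_op_l2[of "p _" x]) auto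
        have "(\<Sum>\<alpha>\<in>G. p \<alpha> x) - (\<Sum>\<alpha>\<in>F. p \<alpha> x) = (\<Sum>\<alpha>\<in>G - F. p \<alpha> x)"
          using G by (simp add: sum_diff)
        then have "(l2norm ((\<Sum>\<alpha>\<in>F. p \<alpha> x) - (\<Sum>\<alpha>\<in>G. p \<alpha> x)))^2 = (l2norm (\<Sum>\<alpha>\<in>G - F. p \<alpha> x))^2"
          by (metis l2norm_minus_commute)
        also have "\<dots> = sum ?n (G - F)"
          using G by (intro projection_Bessel(1) P orth x) auto
        also have "\<dots> = sum ?n G - sum ?n F" using G by (simp add: sum_diff)
        also have "\<dots> \<le> infsum ?n I - sum ?n F"
          using finite_sum_le_infsum[OF ns[OF x] G(1,3)] by simp
        also have "\<dots> \<le> (e/2)^2" using elim(1) by (simp add: dist_real_def)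
        finally show "l2norm ((\<Sum>\<alpha>\<in>F. p \<alpha> x) - (\<Sum>\<alpha>\<in>G. p \<alpha> x)) \<le> e/2"
          by (rule power2_le_imp_le) (use e in simp)
      qed
      have "l2norm ((\<Sum>\<alpha>\<in>F. p \<alpha> x) - S x) \<le> e/2"
        by (rule l2_limit_of_bounded(2)[OF finite_subsets_at_top_neq_bot lm bd])
      then show ?case using e by simp
    qed
  qed
  ultimately show ?thesis unfolding sot_sum_of_def by blast
qed

lemma sot_sum_of_coord:
  assumes S: "sot_sum_of p I S" and b: "\<And>\<alpha>. \<alpha> \<in> I \<Longrightarrow> bounded_op (p \<alpha>)" and x: "x \<in> l2"
  shows "((\<lambda>\<alpha>. p \<alpha> x i) has_sum S x i) I"
  unfolding has_sum_def
proof (rule Lim_transform2[OF tendsto_const], rule Lim_null_comparison)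
  let ?U = "finite_subsets_at_top I"
  show "((\<lambda>F. l2norm ((\<Sum>\<alpha>\<in>F. p \<alpha> x) - S x)) \<longlongrightarrow> 0) ?U"
    using S x by (simp add: sot_sum_of_def)
  show "eventually (\<lambda>F. norm (S x i - (\<Sum>\<alpha>\<in>F. p \<alpha> x i)) \<le> l2norm ((\<Sum>\<alpha>\<in>F. p \<alpha> x) - S x)) ?U"
  proof (rule eventually_finite_subsets_at_top_weakI)
    fix F assume "finite F" "F \<subseteq> I"
    then have "(\<Sum>\<alpha>\<in>F. p \<alpha> x) - S x \<in> l2"
      using S b x by (intro l2_diff l2_sum bounded_op_l2[of "p _" x] bounded_op_l2[of S x]) (auto simp: sot_sum_of_def)
    from cmod_le_l2norm[OF this, of i]
    show "norm (S x i - (\<Sum>\<alpha>\<in>F. p \<alpha> x i)) \<le> l2norm ((\<Sum>\<alpha>\<in>F. p \<alpha> x) - S x)"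
      by (simp add: sum_vec_apply norm_minus_commute)
  qed
qed

lemma sot_sum_of_unique:
  assumes S: "sot_sum_of p I S" "sot_sum_of p I S'" and b: "\<And>\<alpha>. \<alpha> \<in> I \<Longrightarrow> bounded_op (p \<alpha>)"
  shows "S = S'"
proof (intro ext)
  fix x i
  show "S x i = S' x i"
  proof (cases "x \<in> l2")
    case True
    then show ?thesis using sot_sum_of_coord[OF S(1) b] sot_sum_of_coord[OF S(2) b] has_sum_unique by blast
  next
    case False
    then show ?thesis using S bounded_op_outside[of S x] bounded_op_outside[of S' x] by (simp add: sot_sum_of_def)
  qed
qed

text \<open>Existence and uniqueness give meaning to the definite description in
  \<open>sot_sum\<close>. From here on the sum is handled through boundedness and its
  coordinates.\<close>

lemma sot_sum_projections:
  assumes "\<And>\<alpha>. \<alpha> \<in> I \<Longrightarrow> projection (p \<alpha>)"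
    and "\<And>\<alpha> \<beta>. \<alpha> \<in> I \<Longrightarrow> \<beta> \<in> I \<Longrightarrow> \<alpha> \<noteq> \<beta> \<Longrightarrow> orthogonal_ops (p \<alpha>) (p \<beta>)"
  shows "bounded_op (sot_sum p I)"
    and "x \<in> l2 \<Longrightarrow> ((\<lambda>\<alpha>. p \<alpha> x i) has_sum sot_sum p I x i) I"
proof -
  have b: "bounded_op (p \<alpha>)" if "\<alpha> \<in> I" for \<alpha> using assms that by (simp add: projection_def)
  obtain S where S: "sot_sum_of p I S" using sot_sum_of_exists[of I p] assms by blast
  have "sot_sum p I = S"
    unfolding sot_sum_def
    by (rule the_equality, rule S, rule sot_sum_of_unique[OF _ S b])
  with S have s: "sot_sum_of p I (sot_sum p I)" by simp
  then show "bounded_op (sot_sum p I)" by (simp add: sot_sum_of_def)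
  show "x \<in> l2 \<Longrightarrow> ((\<lambda>\<alpha>. p \<alpha> x i) has_sum sot_sum p I x i) I"
    by (rule sot_sum_of_coord[OF s b])
qed

lemma orthogonal_diag_proj: "A \<inter> B = {} \<Longrightarrow> orthogonal_ops (diag_proj A) (diag_proj B)"
  by (auto simp: orthogonal_ops_def diag_proj_def) (auto simp: restrict_vec_def fun_eq_iff)

text \<open>At each coordinate at most one summand is nonzero. This translates additivity of a state
  on diagonal projections into additivity of its measure.\<close>

lemma sot_sum_diag_proj:
  assumes dis: "disjoint_family_on A I"
  shows "sot_sum (\<lambda>\<alpha>. diag_proj (A \<alpha>)) I = diag_proj (\<Union>\<alpha>\<in>I. A \<alpha>)"
proof (intro ext)
  fix x i
  have "orthogonal_ops (diag_proj (A \<alpha>)) (diag_proj (A \<beta>))" if "\<alpha> \<in> I" "\<beta> \<in> I" "\<alpha> \<noteq> \<beta>" for \<alpha> \<beta>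
    using dis that by (intro orthogonal_diag_proj) (auto simp: disjoint_family_on_def)
  then have s: "bounded_op (sot_sum (\<lambda>\<alpha>. diag_proj (A \<alpha>)) I)"
    "x \<in> l2 \<Longrightarrow> ((\<lambda>\<alpha>. diag_proj (A \<alpha>) x i) has_sum sot_sum (\<lambda>\<alpha>. diag_proj (A \<alpha>)) I x i) I"
    by (intro sot_sum_projections; simp)+
  show "sot_sum (\<lambda>\<alpha>. diag_proj (A \<alpha>)) I x i = diag_proj (\<Union>\<alpha>\<in>I. A \<alpha>) x i"
  proof (cases "x \<in> l2")
    case True
    have "((\<lambda>\<alpha>. diag_proj (A \<alpha>) x i) has_sum diag_proj (\<Union>\<alpha>\<in>I. A \<alpha>) x i) I"
    proof (cases "\<exists>\<beta>\<in>I. i \<in> A \<beta>")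
      case T: True
      then obtain \<beta> where \<beta>: "\<beta> \<in> I" "i \<in> A \<beta>" by blast
      then have "i \<notin> A \<alpha>" if "\<alpha> \<in> I" "\<alpha> \<noteq> \<beta>" for \<alpha>
        using dis that by (auto simp: disjoint_family_on_def)
      then have "((\<lambda>\<alpha>. diag_proj (A \<alpha>) x i) has_sum x i) I
          \<longleftrightarrow> ((\<lambda>\<alpha>. x i) has_sum x i) {\<beta>}"
        using \<beta> True by (intro has_sum_cong_neutral) (auto simp: diag_proj_def restrict_vec_def)
      moreover have "((\<lambda>\<alpha>. x i) has_sum x i) {\<beta>}"
        using has_sum_finite[of "{\<beta>}" "\<lambda>\<alpha>. x i"] by simp
      ultimately show ?thesis using \<beta> True by (auto simp: diag_proj_def restrict_vec_def)
    next
      case False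
      then have "diag_proj (\<Union>\<alpha>\<in>I. A \<alpha>) x i = 0" "\<And>\<alpha>. \<alpha> \<in> I \<Longrightarrow> diag_proj (A \<alpha>) x i = 0"
        using True by (auto simp: diag_proj_def restrict_vec_def)
      then show ?thesis using has_sum_0[of I "\<lambda>\<alpha>. diag_proj (A \<alpha>) x i"] by simp
    qed
    then show ?thesis using s(2)[OF True] has_sum_unique by blast
  next
    case False
    then show ?thesis using bounded_op_outside[OF s(1)] by (simp add: diag_proj_def)
  qed
qed

section \<open>The state of a total measure\<close>

lemma countable_card_less:
  assumes "\<not> countable (UNIV :: 'a set)" "countable (I :: 'a set)"
  shows "(card_of I, card_of (UNIV :: 'a set)) \<in> ordLess"
proof -
  have "(card_of (UNIV :: 'a set), card_of I) \<notin> ordLeq"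
  proof
    assume "(card_of (UNIV :: 'a set), card_of I) \<in> ordLeq"
    then obtain f :: "'a \<Rightarrow> 'a" where "inj_on f UNIV" "f ` UNIV \<subseteq> I"
      unfolding card_of_ordLeq[symmetric] by blast
    then have "countable (UNIV :: 'a set)"
      using assms(2) countable_image_inj_on countable_subset by blast
    then show False using assms(1) by simp
  qed
  then show ?thesis using card_of_Well_order not_ordLeq_iff_ordLess by blast
qed

text \<open>Index sets must be subsets of \<open>'a\<close>, so the natural numbers are copied into
  \<open>'a\<close>; their image is countable, hence smaller than the uncountable
  \<open>'a\<close>.\<close>

lemma lt_kappa_imp_countably_additive:
  assumes unc: "\<not> countable (UNIV :: 'a set)" and \<mu>: "lt_kappa_additive_meas (\<mu> :: 'a set \<Rightarrow> real)"
  shows "countably_additive_meas \<mu>"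
  unfolding countably_additive_meas_def
proof (intro allI impI)
  fix A :: "nat \<Rightarrow> 'a set" assume dis: "disjoint_family A"
  have "infinite (UNIV :: 'a set)" using unc countable_finite by blast
  then obtain g :: "nat \<Rightarrow> 'a" where g: "inj g" using infinite_countable_subset by blast
  have "disjoint_family_on (A \<circ> inv g) (range g)"
    using dis g by (auto simp: disjoint_family_on_def inv_f_f inj_eq)
  then have "((\<lambda>a. \<mu> ((A \<circ> inv g) a)) has_sum \<mu> (\<Union>a\<in>range g. (A \<circ> inv g) a)) (range g)"
    using \<mu> countable_card_less[OF unc, of "range g"] unfolding lt_kappa_additive_meas_def
    by blast
  then have "((\<lambda>n. \<mu> (A n)) has_sum \<mu> (\<Union>n. A n)) UNIV"
    using g by (simp add: has_sum_reindex o_def inv_f_f)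
  then show "(\<lambda>n. \<mu> (A n)) sums \<mu> (\<Union>n. A n)" by (rule has_sum_imp_sums)
qed

text \<open>The constant family of empty sets is disjoint, and a constant series converges only if
  its term is zero.\<close>

lemma meas_empty:
  assumes "countably_additive_meas \<mu>" shows "\<mu> {} = 0"
proof -
  have "(\<lambda>n::nat. \<mu> {}) sums \<mu> (\<Union>n::nat. {})"
    using assms unfolding countably_additive_meas_def by (auto simp: disjoint_family_on_def)
  then have "summable (\<lambda>n::nat. \<mu> {})" by (rule sums_summable)
  then show ?thesis by (simp add: summable_const_iff)
qed

text \<open>Interchange of integral and possibly uncountable sum. The integrals are summable, so all
  but countably many vanish; the corresponding functions vanish almost everywhere, and
  \<open>null\<close> makes the union of their exceptional sets null. The countable rest is
  dominated convergence, with \<open>s\<close> as majorant.\<close>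

lemma has_sum_integral:
  fixes f :: "'b \<Rightarrow> 'a \<Rightarrow> real"
  assumes M: "finite_measure M" and sets: "sets M = UNIV"
    and f: "\<And>\<alpha> a. \<alpha> \<in> I \<Longrightarrow> 0 \<le> f \<alpha> a"
    and s: "\<And>a. ((\<lambda>\<alpha>. f \<alpha> a) has_sum s a) I" and B: "\<And>a. s a \<le> B"
    and null: "\<And>N. (\<And>\<alpha>. \<alpha> \<in> I \<Longrightarrow> N \<alpha> \<in> null_sets M) \<Longrightarrow> (\<Union>\<alpha>\<in>I. N \<alpha>) \<in> null_sets M"
  shows "((\<lambda>\<alpha>. integral\<^sup>L M (f \<alpha>)) has_sum integral\<^sup>L M s) I"
proof -
  interpret finite_measure M by (rule M)
  have sp: "space M = UNIV" using sets sets.sets_into_space by blast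
  have meas: "h \<in> borel_measurable M" for h :: "'a \<Rightarrow> real"
    by (rule measurableI) (auto simp: sets sp)
  have fs: "sum (\<lambda>\<alpha>. f \<alpha> a) F \<le> s a" if "finite F" "F \<subseteq> I" for F a
    using s[of a] that f by (intro has_sum_mono_neutral[OF has_sum_finite s[of a]]) auto
  have s0: "0 \<le> s a" for a using fs[of "{}"] by simp
  have ints: "integrable M s"
    by (rule integrable_const_bound[of s B]) (use s0 B meas in auto)
  have intf: "integrable M (f \<alpha>)" if "\<alpha> \<in> I" for \<alpha>
  proof (rule integrable_const_bound[of "f \<alpha>" B])
    have "f \<alpha> a \<le> B" for a using fs[of "{\<alpha>}" a] B[of a] that by simp
    then show "AE a in M. norm (f \<alpha> a) \<le> B" using f[OF that] by simp
  qed (rule meas)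
  let ?g = "\<lambda>\<alpha>. integral\<^sup>L M (f \<alpha>)"
  have g0: "0 \<le> ?g \<alpha>" if "\<alpha> \<in> I" for \<alpha> using f that by (intro integral_nonneg_AE) auto
  have gs: "sum ?g F \<le> integral\<^sup>L M s" if "finite F" "F \<subseteq> I" for F
  proof -
    have "sum ?g F = integral\<^sup>L M (\<lambda>a. \<Sum>\<alpha>\<in>F. f \<alpha> a)"
      using that intf by (subst Bochner_Integration.integral_sum) auto
    also have "\<dots> \<le> integral\<^sup>L M s"
      using that intf by (intro integral_mono fs ints Bochner_Integration.integrable_sum) auto
    finally show ?thesis .
  qed
  have sm: "?g summable_on I"
    by (rule nonneg_bdd_above_summable_on) (use g0 gs in \<open>auto intro!: bdd_aboveI2\<close>)
  define J where "J = {\<alpha>\<in>I. ?g \<alpha> \<noteq> 0}"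
  have J: "countable J" "J \<subseteq> I" unfolding J_def using summable_countable_real[OF sm] by auto
  define N where "N = (\<Union>\<alpha>\<in>I. if \<alpha> \<in> J then {} else {a. f \<alpha> a \<noteq> 0})"
  have "N \<in> null_sets M"
    unfolding N_def
  proof (rule null)
    fix \<alpha> assume \<alpha>: "\<alpha> \<in> I"
    show "(if \<alpha> \<in> J then {} else {a. f \<alpha> a \<noteq> 0}) \<in> null_sets M"
    proof (cases "\<alpha> \<in> J")
      case False
      then have "?g \<alpha> = 0" using \<alpha> by (simp add: J_def)
      then have "AE a in M. f \<alpha> a = 0"
        using integral_nonneg_eq_0_iff_AE[OF intf[OF \<alpha>]] f[OF \<alpha>] by auto
      then have "{a \<in> space M. f \<alpha> a \<noteq> 0} \<in> null_sets M"
        by (subst AE_iff_null[symmetric]) (auto simp: sets)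
      then show ?thesis using False by (simp add: sp)
    qed auto
  qed
  then have ae: "AE a in M. a \<notin> N" using AE_not_in by blast
  \<comment> \<open>An exhaustion of \<open>J\<close> by finite sets that is cofinal in the filter
    of finite subsets: it turns the unordered sum into a sequence, as dominated convergence
    requires.\<close>
  define F where "F n = {\<alpha>\<in>J. to_nat_on J \<alpha> < n}" for n :: nat
  have F: "finite (F n)" "F n \<subseteq> J" for n
  proof -
    have "inj_on (to_nat_on J) (F n)"
      using inj_on_to_nat_on[OF J(1)] by (rule inj_on_subset) (auto simp: F_def)
    then show "finite (F n)"
      by (rule inj_on_finite[where B = "{..<n}"]) (auto simp: F_def)
  qed (auto simp: F_def)
  have Flim: "filterlim F (finite_subsets_at_top J) sequentially"
  proof (rule iffD2[OF filterlim_iff], rule allI, rule impI)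
    fix P assume "eventually P (finite_subsets_at_top J)"
    then have "\<exists>X. finite X \<and> X \<subseteq> J \<and> (\<forall>Y. finite Y \<and> X \<subseteq> Y \<and> Y \<subseteq> J \<longrightarrow> P Y)"
      by (simp only: eventually_finite_subsets_at_top)
    then obtain X where "finite X \<and> X \<subseteq> J \<and> (\<forall>Y. finite Y \<and> X \<subseteq> Y \<and> Y \<subseteq> J \<longrightarrow> P Y)" ..
    then have X: "finite X" "X \<subseteq> J" "\<And>Y. finite Y \<Longrightarrow> X \<subseteq> Y \<Longrightarrow> Y \<subseteq> J \<Longrightarrow> P Y" by simp_all
    obtain k where k: "\<forall>m\<in>to_nat_on J ` X. m < k"
      using finite_nat_set_iff_bounded[of "to_nat_on J ` X"] finite_imageI[OF X(1)] by blast
    have "P (F n)" if n: "n \<ge> k" for n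
    proof (rule X(3)[OF F(1) _ F(2)])
      show "X \<subseteq> F n"
      proof
        fix \<alpha> assume \<alpha>: "\<alpha> \<in> X"
        then have "to_nat_on J \<alpha> < k" using k by blast
        then show "\<alpha> \<in> F n" using n \<alpha> X(2) by (auto simp: F_def)
      qed
    qed
    then show "eventually (\<lambda>n. P (F n)) sequentially" unfolding eventually_sequentially by blast
  qed
  have "(\<lambda>n. integral\<^sup>L M (\<lambda>a. \<Sum>\<alpha>\<in>F n. f \<alpha> a)) \<longlonglongrightarrow> integral\<^sup>L M s"
  proof (rule integral_dominated_convergence[where w = s])
    show "AE a in M. (\<lambda>n. \<Sum>\<alpha>\<in>F n. f \<alpha> a) \<longlonglongrightarrow> s a"
      using ae
    proof eventually_elim
      case (elim a)
      have "((\<lambda>\<alpha>. f \<alpha> a) has_sum s a) J \<longleftrightarrow> ((\<lambda>\<alpha>. f \<alpha> a) has_sum s a) I"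
        using elim J(2) by (intro has_sum_cong_neutral) (auto simp: N_def split: if_splits)
      then have "((\<lambda>\<alpha>. f \<alpha> a) has_sum s a) J" using s by blast
      then show ?case unfolding has_sum_def by (rule filterlim_compose[OF _ Flim])
    qed
    show "AE a in M. norm (\<Sum>\<alpha>\<in>F n. f \<alpha> a) \<le> s a" for n
    proof (rule AE_I2)
      fix a
      have "0 \<le> (\<Sum>\<alpha>\<in>F n. f \<alpha> a)" using F J(2) f by (intro sum_nonneg) blast
      then show "norm (\<Sum>\<alpha>\<in>F n. f \<alpha> a) \<le> s a" using fs[of "F n" a] F[of n] J(2) by simp
    qed
  qed (use ints meas in auto)
  moreover have "integral\<^sup>L M (\<lambda>a. \<Sum>\<alpha>\<in>F n. f \<alpha> a) \<le> infsum ?g I" for n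
  proof -
    have "integral\<^sup>L M (\<lambda>a. \<Sum>\<alpha>\<in>F n. f \<alpha> a) = sum ?g (F n)"
      using F J(2) intf by (intro Bochner_Integration.integral_sum) blast
    also have "\<dots> \<le> infsum ?g I"
      using F[of n] J(2) g0 by (intro finite_sum_le_infsum[OF sm]) auto
    finally show ?thesis .
  qed
  ultimately have "integral\<^sup>L M s \<le> infsum ?g I"
    by (intro LIMSEQ_le_const2) auto
  moreover have "infsum ?g I \<le> integral\<^sup>L M s"
    by (rule infsum_le_finite_sums[OF sm gs])
  ultimately show ?thesis using has_sum_infsum[OF sm] by simp
qed

section \<open>The measure space on all subsets and its diagonal state\<close>

definition total_measure :: "('a set \<Rightarrow> real) \<Rightarrow> 'a measure" where
  "total_measure \<mu> = measure_of UNIV UNIV (\<lambda>A. ennreal (\<mu> A))"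

definition diag_state :: "('a set \<Rightarrow> real) \<Rightarrow> 'a op \<Rightarrow> complex" where
  "diag_state \<mu> T = integral\<^sup>L (total_measure \<mu>) (\<lambda>a. T (std_basis a) a)"

locale total_prob =
  fixes \<mu> :: "'a set \<Rightarrow> real"
  assumes prob: "probability_meas \<mu>" and ca: "countably_additive_meas \<mu>"
begin

lemma nonneg: "\<mu> A \<ge> 0"
  using prob by (simp add: probability_meas_def)

lemma whole: "\<mu> UNIV = 1"
  using prob by (simp add: probability_meas_def)

abbreviation M where "M \<equiv> total_measure \<mu>"

lemma sets_M [simp]: "sets M = UNIV"
proof -
  have "sets M = sigma_sets UNIV UNIV" unfolding total_measure_def by (rule sets_measure_of) simp
  then show ?thesis by (auto intro: sigma_sets.Basic)
qed

lemma space_M [simp]: "space M = UNIV"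
  using sets_M sets.sets_into_space by blast

lemma emeasure_M: "emeasure M A = ennreal (\<mu> A)"
  unfolding total_measure_def
proof (rule emeasure_measure_of_sigma)
  show "sigma_algebra UNIV (UNIV :: 'a set set)" using sigma_algebra_Pow[of "UNIV :: 'a set"] by simp
  show "positive UNIV (\<lambda>A. ennreal (\<mu> A))" by (simp add: positive_def meas_empty[OF ca])
  show "countably_additive UNIV (\<lambda>A. ennreal (\<mu> A))"
  proof (rule countably_additiveI)
    fix A :: "nat \<Rightarrow> 'a set" assume "disjoint_family A"
    then have "(\<lambda>n. \<mu> (A n)) sums \<mu> (\<Union>n. A n)" using ca by (simp add: countably_additive_meas_def)
    then show "(\<Sum>n. ennreal (\<mu> (A n))) = ennreal (\<mu> (\<Union>n. A n))"
      using nonneg by (intro suminf_ennreal_eq) auto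
  qed
qed simp

lemma measure_M: "measure M A = \<mu> A"
  by (simp add: measure_def emeasure_M nonneg)

sublocale finite_measure M
  by (rule finite_measureI) (simp add: emeasure_M)

lemma null_iff: "A \<in> null_sets M \<longleftrightarrow> \<mu> A = 0"
  using nonneg[of A] by (auto simp: null_sets_def emeasure_M)

text \<open>As every subset is measurable, integrability of diagonal entries below is only a
  question of boundedness.\<close>

lemma measurable_M: "f \<in> borel_measurable M"
  by (rule measurableI) auto

lemma meas_mono: "A \<subseteq> B \<Longrightarrow> \<mu> A \<le> \<mu> B"
  using finite_measure_mono[of A B] by (simp add: measure_M)

lemma meas_Un: "A \<inter> B = {} \<Longrightarrow> \<mu> (A \<union> B) = \<mu> A + \<mu> B"
  using finite_measure_Union[of A B] by (simp add: measure_M)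

lemma integrable_op:
  assumes "bounded_op T" shows "integrable M (\<lambda>a. T (std_basis a) a)"
proof -
  obtain C where C: "\<And>x. x \<in> l2 \<Longrightarrow> l2norm (T x) \<le> C * l2norm x"
    using bounded_op_bound[OF assms] by blast
  have "cmod (T (std_basis a) a) \<le> C" for a
    using cmod_le_l2norm[OF bounded_op_l2[OF assms std_basis_l2], of a a] C[of "std_basis a"] by simp
  then show ?thesis by (intro integrable_const_bound[where B = C] measurable_M) auto
qed

lemma diag_state_real:
  assumes "hermitian_op T"
  shows "diag_state \<mu> T = complex_of_real (integral\<^sup>L M (\<lambda>a. Re (T (std_basis a) a)))"
proof -
  have "T (std_basis a) a = complex_of_real (Re (T (std_basis a) a))" for a
    using assms by (auto simp: hermitian_op_def qform_def complex_eq_iff dest: bspec[of _ _ "std_basis a"])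
  then have "diag_state \<mu> T = integral\<^sup>L M (\<lambda>a. complex_of_real (Re (T (std_basis a) a)))"
    unfolding diag_state_def by simp
  then show ?thesis by simp
qed

lemma diag_state_state: "state (diag_state \<mu>)"
  unfolding state_def
proof (intro conjI allI impI)
  fix S T :: "'a op" assume "bounded_op S \<and> bounded_op T"
  then show "diag_state \<mu> (S + T) = diag_state \<mu> S + diag_state \<mu> T"
    unfolding diag_state_def by (simp add: integrable_op)
next
  fix c and T :: "'a op" assume "bounded_op T"
  then show "diag_state \<mu> (\<lambda>x i. c * T x i) = c * diag_state \<mu> T"
    unfolding diag_state_def by (simp add: integrable_op)
next
  fix T :: "'a op" assume T: "positive_op T"
  then have eq: "diag_state \<mu> T = complex_of_real (integral\<^sup>L M (\<lambda>a. Re (T (std_basis a) a)))"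
    by (intro diag_state_real positive_imp_hermitian)
  then show "Im (diag_state \<mu> T) = 0" by simp
  have "0 \<le> Re (T (std_basis a) a)" for a
    using T by (auto simp: positive_op_iff qform_def dest: bspec[of _ _ "std_basis a"])
  then show "0 \<le> Re (diag_state \<mu> T)" using eq by (simp add: integral_nonneg_AE)
next
  have "diag_state \<mu> id_op = integral\<^sup>L M (\<lambda>a. 1)"
    unfolding diag_state_def by (simp add: id_op_def) (simp add: std_basis_def)
  then show "diag_state \<mu> id_op = 1" by (simp add: measure_M whole)
qed

lemma diag_state_diag_proj: "diag_state \<mu> (diag_proj A) = complex_of_real (\<mu> A)"
proof -
  have "diag_proj A (std_basis a) a = complex_of_real (indicat_real A a)" for a
    by (simp add: diag_proj_def restrict_vec_def) (simp add: std_basis_def)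
  then have "diag_state \<mu> (diag_proj A) = complex_of_real (integral\<^sup>L M (indicat_real A))"
    unfolding diag_state_def by (simp only: integral_complex_of_real)
  then show ?thesis by (simp add: measure_M)
qed

lemma countable_null:
  assumes "vanishes_on_singletons \<mu>" "countable A" shows "\<mu> A = 0"
proof -
  have "(\<Union>a\<in>A. {a}) \<in> null_sets M"
    using assms by (intro null_sets_UN') (auto simp: null_iff vanishes_on_singletons_def)
  then show ?thesis by (simp add: null_iff)
qed

text \<open>The diagonal of a rank one projection lives on the support of \<open>e\<close>, which is
  countable and hence null.\<close>

lemma diag_state_singular:
  assumes "vanishes_on_singletons \<mu>"
  shows "singular_state (diag_state \<mu>)"
  unfolding singular_state_def
proof (intro conjI ballI impI diag_state_state)
  fix e :: "'a vec" assume e: "e \<in> l2"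
  then have "countable {i\<in>UNIV. (cmod (e i))^2 \<noteq> 0}"
    unfolding l2_def by (intro summable_countable_real) auto
  then have "\<mu> {i. e i \<noteq> 0} = 0" using countable_null[OF assms] by simp
  then have "{i. e i \<noteq> 0} \<in> null_sets M" by (simp add: null_iff)
  then have "AE a in M. a \<notin> {i. e i \<noteq> 0}" by (rule AE_not_in)
  then have "AE a in M. rank_one_proj e (std_basis a) a = 0"
    by eventually_elim (simp add: rank_one_proj_def)
  then have "diag_state \<mu> (rank_one_proj e) = integral\<^sup>L M (\<lambda>a. 0)"
    unfolding diag_state_def by (intro integral_cong_AE measurable_M) auto
  then show "diag_state \<mu> (rank_one_proj e) = 0" by simp
qed

text \<open>The diagonal entries \<open>l2norm (p \<alpha> (std_basis a)) ^ 2\<close> are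
  nonnegative and sum to the bounded diagonal of the strong sum, so sum and integral may be
  interchanged. The additivity of \<open>\<mu>\<close> relevant to the size of \<open>I\<close>
  enters only as \<open>null\<close>, which covers both kinds of additivity.\<close>

lemma diag_state_additive:
  assumes P: "\<And>\<alpha>. \<alpha> \<in> I \<Longrightarrow> projection (p \<alpha>)"
    and orth: "\<And>\<alpha> \<beta>. \<alpha> \<in> I \<Longrightarrow> \<beta> \<in> I \<Longrightarrow> \<alpha> \<noteq> \<beta> \<Longrightarrow> orthogonal_ops (p \<alpha>) (p \<beta>)"
    and null: "\<And>N. (\<And>\<alpha>. \<alpha> \<in> I \<Longrightarrow> \<mu> (N \<alpha>) = 0) \<Longrightarrow> \<mu> (\<Union>\<alpha>\<in>I. N \<alpha>) = 0"
  shows "((\<lambda>\<alpha>. diag_state \<mu> (p \<alpha>)) has_sum diag_state \<mu> (sot_sum p I)) I"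
proof -
  define f where "f \<alpha> a = (l2norm (p \<alpha> (std_basis a)))^2" for \<alpha> a
  define s where "s a = infsum (\<lambda>\<alpha>. f \<alpha> a) I" for a
  have fs: "((\<lambda>\<alpha>. f \<alpha> a) has_sum s a) I" for a
    unfolding s_def f_def by (rule has_sum_infsum[OF projection_norm_summable[OF P orth]]) auto
  have pf: "p \<alpha> (std_basis a) a = complex_of_real (f \<alpha> a)" if "\<alpha> \<in> I" for \<alpha> a
    using projection_qform[OF P[OF that], of "std_basis a"] by (simp add: qform_def f_def)
  have Ss: "sot_sum p I (std_basis a) a = complex_of_real (s a)" for a
  proof -
    have "((\<lambda>\<alpha>. p \<alpha> (std_basis a) a) has_sum complex_of_real (s a)) I
        \<longleftrightarrow> ((\<lambda>\<alpha>. complex_of_real (f \<alpha> a)) has_sum complex_of_real (s a)) I"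
      by (rule has_sum_cong) (simp add: pf)
    then have "((\<lambda>\<alpha>. p \<alpha> (std_basis a) a) has_sum complex_of_real (s a)) I"
      using has_sum_of_real[OF fs] by blast
    then show ?thesis using sot_sum_projections(2)[of I p, OF P orth std_basis_l2] has_sum_unique by blast
  qed
  have b: "bounded_op (sot_sum p I)" using sot_sum_projections(1)[of I p] P orth by blast
  obtain C where C: "\<And>x. x \<in> l2 \<Longrightarrow> l2norm (sot_sum p I x) \<le> C * l2norm x"
    using bounded_op_bound[OF b] by blast
  have "s a \<le> C" for a
    using cmod_le_l2norm[OF bounded_op_l2[OF b std_basis_l2], of a a] C[of "std_basis a"]
    by (simp add: Ss)
  then have "((\<lambda>\<alpha>. integral\<^sup>L M (f \<alpha>)) has_sum integral\<^sup>L M s) I"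
    by (intro has_sum_integral[where B = C, OF finite_measure_axioms sets_M _ fs])
      (auto simp: f_def null_iff null)
  then have *: "((\<lambda>\<alpha>. complex_of_real (integral\<^sup>L M (f \<alpha>))) has_sum complex_of_real (integral\<^sup>L M s)) I"
    by (rule has_sum_of_real)
  have "diag_state \<mu> (p \<alpha>) = complex_of_real (integral\<^sup>L M (f \<alpha>))" if "\<alpha> \<in> I" for \<alpha>
    unfolding diag_state_def pf[OF that] by simp
  moreover have "diag_state \<mu> (sot_sum p I) = complex_of_real (integral\<^sup>L M s)"
    unfolding diag_state_def Ss by simp
  ultimately show ?thesis using * has_sum_cong[of I "\<lambda>\<alpha>. diag_state \<mu> (p \<alpha>)"
        "\<lambda>\<alpha>. complex_of_real (integral\<^sup>L M (f \<alpha>))"] by metis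
qed

lemma diag_state_countably_additive: "countably_additive_state (diag_state \<mu>)"
  unfolding countably_additive_state_def
proof (intro allI impI diag_state_additive)
  fix N :: "nat \<Rightarrow> 'a set" assume "\<And>\<alpha>. \<alpha> \<in> UNIV \<Longrightarrow> \<mu> (N \<alpha>) = 0"
  then show "\<mu> (\<Union>\<alpha>. N \<alpha>) = 0"
    using null_sets_UN[of N M] by (simp add: null_iff)
qed auto

lemma diag_state_lt_kappa_additive:
  assumes lt: "lt_kappa_additive_meas \<mu>"
  shows "lt_kappa_additive_state (diag_state \<mu>)"
  unfolding lt_kappa_additive_state_def
proof (intro allI impI, rule diag_state_additive)
  fix I :: "'a set" and p :: "'a \<Rightarrow> 'a op" and N :: "'a \<Rightarrow> 'a set"
  assume I: "(card_of I, card_of (UNIV :: 'a set)) \<in> ordLess \<and> (\<forall>\<alpha>\<in>I. projection (p \<alpha>)) \<and>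
        (\<forall>\<alpha>\<in>I. \<forall>\<beta>\<in>I. \<alpha> \<noteq> \<beta> \<longrightarrow> orthogonal_ops (p \<alpha>) (p \<beta>))"
    and N: "\<And>\<alpha>. \<alpha> \<in> I \<Longrightarrow> \<mu> (N \<alpha>) = 0"
  \<comment> \<open>Disjointification without an order on \<open>I\<close>: each point of the union
    is assigned to one chosen index, and the pieces \<open>D \<alpha>\<close> are null as subsets of
    \<open>N \<alpha>\<close>.\<close>
  define c where "c x = (SOME \<alpha>. \<alpha> \<in> I \<and> x \<in> N \<alpha>)" for x
  define D where "D \<alpha> = {x \<in> (\<Union>\<alpha>\<in>I. N \<alpha>). c x = \<alpha>}" for \<alpha>
  have c: "c x \<in> I \<and> x \<in> N (c x)" if "x \<in> (\<Union>\<alpha>\<in>I. N \<alpha>)" for x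
    unfolding c_def by (rule someI_ex) (use that in blast)
  have "disjoint_family_on D I" by (auto simp: disjoint_family_on_def D_def)
  then have "((\<lambda>\<alpha>. \<mu> (D \<alpha>)) has_sum \<mu> (\<Union>\<alpha>\<in>I. D \<alpha>)) I"
    using lt[unfolded lt_kappa_additive_meas_def, rule_format, of I D] I by simp
  moreover have "(\<Union>\<alpha>\<in>I. D \<alpha>) = (\<Union>\<alpha>\<in>I. N \<alpha>)" using c by (auto simp: D_def)
  moreover have "\<mu> (D \<alpha>) = 0" if "\<alpha> \<in> I" for \<alpha>
  proof -
    have "D \<alpha> \<subseteq> N \<alpha>" using c by (auto simp: D_def)
    then show ?thesis using meas_mono[of "D \<alpha>" "N \<alpha>"] N[OF that] nonneg[of "D \<alpha>"] by linarith
  qed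
  ultimately have "((\<lambda>\<alpha>. 0) has_sum \<mu> (\<Union>\<alpha>\<in>I. N \<alpha>)) I"
    using has_sum_cong[of I "\<lambda>\<alpha>. \<mu> (D \<alpha>)" "\<lambda>_. 0"] by simp
  then show "\<mu> (\<Union>\<alpha>\<in>I. N \<alpha>) = 0" using has_sum_0[of I "\<lambda>_. 0"] has_sum_unique by blast
qed auto

end

text \<open>If \<open>A\<close> has value \<open>1\<close>, the whole space has value
  \<open>1 + \<mu> (- A)\<close>, and only \<open>0\<close> and \<open>1\<close> are
  available.\<close>

lemma two_valued_imp_probability:
  assumes tv: "two_valued_nonzero \<mu>" and ca: "countably_additive_meas \<mu>"
  shows "probability_meas \<mu>"
proof -
  have 01: "\<mu> A = 0 \<or> \<mu> A = 1" for A using tv by (auto simp: two_valued_nonzero_def)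
  obtain A where A: "\<mu> A = 1" using tv 01 by (auto simp: two_valued_nonzero_def)
  have "(\<lambda>n. \<mu> (binaryset A (- A) n)) sums (\<mu> A + \<mu> (- A))"
    by (rule binaryset_sums) (rule meas_empty[OF ca])
  moreover have "disjoint_family (binaryset A (- A))"
    by (auto simp: disjoint_family_on_def binaryset_def)
  then have "(\<lambda>n. \<mu> (binaryset A (- A) n)) sums \<mu> (\<Union>n. binaryset A (- A) n)"
    using ca by (simp add: countably_additive_meas_def)
  moreover have "(\<Union>n. binaryset A (- A) n) = UNIV" by (simp add: UN_binaryset_eq)
  ultimately have "\<mu> UNIV = \<mu> A + \<mu> (- A)" using sums_unique2[of _ "\<mu> UNIV"] by simp
  then have "\<mu> UNIV = 1 + \<mu> (- A)" using A by simp
  then have "\<mu> UNIV = 1" using 01[of "- A"] 01[of UNIV] by auto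
  moreover have "\<mu> A \<ge> 0" for A using 01[of A] by auto
  ultimately show ?thesis by (simp add: probability_meas_def)
qed

section \<open>Purity of the state of a two-valued measure\<close>

lemma countable_rtrancl_image:
  assumes "\<And>i. countable (r `` {i})" shows "countable (r\<^sup>* `` {i})"
proof -
  have "countable ((r ^^ n) `` {i})" for n
  proof (induction n)
    case (Suc n)
    have "(r ^^ Suc n) `` {i} = (\<Union>j\<in>(r ^^ n) `` {i}. r `` {j})" by auto
    then show ?case using Suc assms by (auto intro!: countable_UN)
  qed auto
  then have "countable (\<Union>n. (r ^^ n) `` {i})" by (intro countable_UN) auto
  moreover have "r\<^sup>* `` {i} = (\<Union>n. (r ^^ n) `` {i})" by (auto simp: rtrancl_is_UN_relpow)
  ultimately show ?thesis by simp
qed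

text \<open>Components of \<open>r\<close> are countable, so each can be numbered, and
  \<open>?A n\<close> collects the points with number \<open>n\<close> in their own component. The
  numbering depends only on the component as a set, hence is shared by all of its members and
  separates them.\<close>

lemma component_transversals:
  fixes r :: "('a \<times> 'a) set"
  assumes "sym r" "\<And>i. countable (r `` {i})"
  obtains A :: "nat \<Rightarrow> 'a set" where "(\<Union>n. A n) = UNIV" "disjoint_family A"
    "\<And>n i j. i \<in> A n \<Longrightarrow> j \<in> A n \<Longrightarrow> (i, j) \<in> r\<^sup>* \<Longrightarrow> i = j"
proof
  let ?A = "\<lambda>n. {i. to_nat_on (r\<^sup>* `` {i}) i = n}"
  show "(\<Union>n. ?A n) = UNIV" by auto
  show "disjoint_family ?A" by (auto simp: disjoint_family_on_def)
  fix n i j assume ij: "i \<in> ?A n" "j \<in> ?A n" "(i, j) \<in> r\<^sup>*"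
  have "sym (r\<^sup>*)" using assms(1) by (rule sym_rtrancl)
  then have "(j, i) \<in> r\<^sup>*" using ij(3) by (meson symD)
  then have "r\<^sup>* `` {i} = r\<^sup>* `` {j}" using ij(3) by (auto intro: rtrancl_trans)
  then have "to_nat_on (r\<^sup>* `` {i}) i = to_nat_on (r\<^sup>* `` {i}) j" using ij by simp
  then show "i = j"
    using inj_on_to_nat_on[OF countable_rtrancl_image[OF assms(2), of i]] ij(3)
    by (auto simp: inj_on_def)
qed

lemma l2_countable_support:
  assumes "x \<in> l2" shows "countable {i. x i \<noteq> 0}"
proof -
  have "countable {i\<in>UNIV. (cmod (x i))^2 \<noteq> 0}"
    using assms unfolding l2_def by (intro summable_countable_real) auto
  then show ?thesis by simp
qed

lemma hermitian_entry_swap: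
  assumes "hermitian_op H" shows "H (std_basis i) j = cnj (H (std_basis j) i)"
  using hermitian_op_swap[OF assms, of "std_basis j" "std_basis i"] by simp

context total_prob
begin

text \<open>If the set where \<open>X\<close> lies below its mean had measure one, the mean would be
  strictly smaller than itself; likewise above.\<close>

lemma two_valued_constant:
  fixes X :: "'a \<Rightarrow> real"
  assumes tv: "two_valued_nonzero \<mu>" and X: "integrable M X"
  shows "\<mu> {a. X a \<noteq> integral\<^sup>L M X} = 0"
proof -
  let ?E = "integral\<^sup>L M X"
  have 01: "\<mu> A = 0 \<or> \<mu> A = 1" for A using tv by (auto simp: two_valued_nonzero_def)
  have ae: "AE a in M. a \<in> A" if "\<mu> A = 1" for A
  proof -
    have "\<mu> (A \<union> - A) = \<mu> A + \<mu> (- A)" by (rule meas_Un) auto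
    then have "\<mu> (- A) = 0" using that whole by simp
    then have "AE a in M. a \<notin> - A" by (intro AE_not_in) (simp add: null_iff)
    then show ?thesis by simp
  qed
  have c: "integral\<^sup>L M (\<lambda>a. ?E) = ?E" by (simp add: measure_M whole)
  have ne: "emeasure M (space M) \<noteq> 0" by (simp add: emeasure_M whole)
  have "\<mu> {a. X a < ?E} = 0"
  proof (rule ccontr)
    assume "\<mu> {a. X a < ?E} \<noteq> 0"
    then have "AE a in M. a \<in> {a. X a < ?E}" using 01 ae by blast
    then have "integral\<^sup>L M X < integral\<^sup>L M (\<lambda>a. ?E)"
      by (intro integral_less_AE_space[OF X _ _ ne]) auto
    then show False unfolding c by simp
  qed
  moreover have "\<mu> {a. ?E < X a} = 0"
  proof (rule ccontr)
    assume "\<mu> {a. ?E < X a} \<noteq> 0"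
    then have "AE a in M. a \<in> {a. ?E < X a}" using 01 ae by blast
    then have "integral\<^sup>L M (\<lambda>a. ?E) < integral\<^sup>L M X"
      by (intro integral_less_AE_space[OF _ X _ ne]) auto
    then show False unfolding c by simp
  qed
  moreover have "\<mu> ({a. X a < ?E} \<union> {a. ?E < X a}) = \<mu> {a. X a < ?E} + \<mu> {a. ?E < X a}"
    by (rule meas_Un) auto
  moreover have "{a. X a < ?E} \<union> {a. ?E < X a} = {a. X a \<noteq> ?E}" by auto
  ultimately show ?thesis by simp
qed

lemma two_valued_paving:
  assumes tv: "two_valued_nonzero \<mu>" and H: "hermitian_op H"
  obtains A where "\<mu> (- A) = 0" "\<And>a b. a \<in> A \<Longrightarrow> b \<in> A \<Longrightarrow> a \<noteq> b \<Longrightarrow> H (std_basis a) b = 0"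
    "\<And>a. a \<in> A \<Longrightarrow> H (std_basis a) a = diag_state \<mu> H"
proof -
  have 01: "\<mu> A = 0 \<or> \<mu> A = 1" for A using tv by (auto simp: two_valued_nonzero_def)
  define r where "r = {(i, j). H (std_basis i) j \<noteq> 0}"
  have "sym r" unfolding sym_def r_def using hermitian_entry_swap[OF H] by (metis case_prodD case_prodI complex_cnj_zero mem_Collect_eq)
  moreover have "countable (r `` {i})" for i
    using l2_countable_support[OF bounded_op_l2[OF hermitian_bounded[OF H] std_basis_l2], of i]
    by (simp add: r_def Image_def)
  ultimately obtain A :: "nat \<Rightarrow> 'a set" where A: "(\<Union>n. A n) = UNIV" "disjoint_family A"
    "\<And>n i j. i \<in> A n \<Longrightarrow> j \<in> A n \<Longrightarrow> (i, j) \<in> r\<^sup>* \<Longrightarrow> i = j"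
    using component_transversals by metis
  have "\<exists>n. \<mu> (A n) \<noteq> 0"
  proof (rule ccontr)
    assume "\<not> ?thesis"
    then have "\<mu> (\<Union>n. A n) = 0" using null_sets_UN[of A M] by (simp add: null_iff)
    then show False using A(1) whole by simp
  qed
  then obtain n where n: "\<mu> (A n) = 1" using 01 by blast
  have "\<mu> (A n \<union> - A n) = \<mu> (A n) + \<mu> (- A n)" by (rule meas_Un) auto
  then have n0: "\<mu> (- A n) = 0" using n whole by simp
  let ?X = "\<lambda>a. Re (H (std_basis a) a)"
  have "integrable M ?X" using integrable_op[OF hermitian_bounded[OF H]] by simp
  then have X0: "\<mu> {a. ?X a \<noteq> integral\<^sup>L M ?X} = 0" by (rule two_valued_constant[OF tv])
  \<comment> \<open>The transversal removes the off-diagonal entries, the level set makes the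
    diagonal constant; both have null complement.\<close>
  let ?B = "A n \<inter> {a. ?X a = integral\<^sup>L M ?X}"
  have "- ?B = - A n \<union> {a. ?X a \<noteq> integral\<^sup>L M ?X}" by auto
  then have "- ?B \<in> null_sets M" using n0 X0 by (simp add: null_sets.Un null_iff[symmetric])
  then have 1: "\<mu> (- ?B) = 0" by (simp only: null_iff)
  have 2: "H (std_basis a) b = 0" if "a \<in> ?B" "b \<in> ?B" "a \<noteq> b" for a b
    using A(3)[of a n b] that by (auto simp: r_def)
  have 3: "H (std_basis a) a = diag_state \<mu> H" if "a \<in> ?B" for a
    using that diag_state_real[OF H] hermitian_entry_swap[OF H, of a a]
    by (simp add: complex_eq_iff)
  show ?thesis by (rule that[of ?B, OF 1 2 3])
qed

end

text \<open>With \<open>P\<close> the projection onto the complement of \<open>A\<close>, the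
  operators \<open>e + K P \<plusminus> (H - r)\<close> are positive once \<open>K\<close> is large.
  As \<open>\<psi>\<close> vanishes at \<open>P\<close>, this leaves
  \<open>\<bar>\<psi> H - r\<bar> \<le> e\<close> for every \<open>e > 0\<close>.\<close>

lemma state_determined_on_corner:
  assumes \<psi>: "state \<psi>" and H: "hermitian_op H" and null: "\<psi> (diag_proj (- A)) = 0"
    and off: "\<And>a b. a \<in> A \<Longrightarrow> b \<in> A \<Longrightarrow> a \<noteq> b \<Longrightarrow> H (std_basis a) b = 0"
    and diag: "\<And>a. a \<in> A \<Longrightarrow> H (std_basis a) a = complex_of_real r"
  shows "\<psi> H = complex_of_real r"
proof -
  have b: "bounded_op H" using H by (rule hermitian_bounded)
  obtain C where C: "C \<ge> 0" "\<And>x. x \<in> l2 \<Longrightarrow> l2norm (H x) \<le> C * l2norm x"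
    using bounded_op_bound[OF b] by blast
  have CS: "cmod (l2inner u (H v)) \<le> C * (l2norm u * l2norm v)" if "u \<in> l2" "v \<in> l2" for u v
  proof -
    have "cmod (l2inner u (H v)) \<le> l2norm u * l2norm (H v)"
      using that by (intro l2_Cauchy_Schwarz bounded_op_l2[OF b])
    also have "\<dots> \<le> l2norm u * (C * l2norm v)" using C that by (intro mult_left_mono) auto
    finally show ?thesis by (simp add: mult_ac)
  qed
  have corner: "qform H (restrict_vec A x) = complex_of_real (r * (l2norm (restrict_vec A x))^2)"
    if x: "x \<in> l2" for x
  proof -
    let ?y = "restrict_vec A x"
    have y: "?y \<in> l2" using x by simp
    have "H ?y i = complex_of_real r * x i" if i: "i \<in> A" for i
    proof -
      have "H ?y i = l2inner (H (std_basis i)) ?y"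
        using hermitian_op_swap[OF H std_basis_l2 y, of i] by simp
      also have "\<dots> = infsum (\<lambda>j. cnj (H (std_basis i) j) * ?y j) {i}"
        unfolding l2inner_def by (rule infsum_cong_neutral) (use off i in \<open>auto simp: restrict_vec_def\<close>)
      also have "\<dots> = complex_of_real r * x i" using i diag by (simp add: restrict_vec_def)
      finally show ?thesis .
    qed
    then have "restrict_vec A (H ?y) = (\<lambda>i. complex_of_real r * ?y i)"
      by (auto simp: restrict_vec_def fun_eq_iff)
    moreover have "qform H ?y = l2inner ?y (restrict_vec A (H ?y))"
    proof -
      have "restrict_vec A ?y = ?y" by (auto simp: restrict_vec_def)
      then show ?thesis using l2inner_restrict_vec_cong(2)[of A ?y "H ?y"] by (simp add: qform_def)
    qed
    ultimately show ?thesis using l2inner_self[OF y] by (simp add: l2inner_scale_right)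
  qed
  have key: "\<bar>Re (\<psi> H) - r\<bar> \<le> e \<and> Im (\<psi> H) = 0" if e: "e > 0" for e
  proof -
    \<comment> \<open>For parts of \<open>x\<close> with norms \<open>n\<close> on \<open>A\<close>
      and \<open>m\<close> off \<open>A\<close>, the mixed terms \<open>2 C n m\<close> are at most
      \<open>e n^2 + (C^2 / e) m^2\<close>; the summands \<open>C\<close> and
      \<open>\<bar>r\<bar>\<close> absorb what \<open>H\<close> and the scalar \<open>r\<close>
      contribute off \<open>A\<close>.\<close>
    define K where "K = C^2 / e + C + \<bar>r\<bar>"
    define W where "W \<sigma> = (op_scale (complex_of_real e) id_op + op_scale (complex_of_real K) (diag_proj (- A)))
      + op_scale (complex_of_real \<sigma>) (H - op_scale (complex_of_real r) id_op)" for \<sigma>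
    have bW: "bounded_op (W \<sigma>)" for \<sigma> unfolding W_def using b by simp
    have est: "\<bar>Re (qform H x) - r * (l2norm x)^2\<bar> \<le> e * (l2norm x)^2 + K * (l2norm (restrict_vec (- A) x))^2"
      if x: "x \<in> l2" for x
    proof -
      let ?y = "restrict_vec A x" let ?z = "restrict_vec (- A) x"
      let ?n = "l2norm ?y" let ?m = "l2norm ?z"
      have yz: "?y \<in> l2" "?z \<in> l2" using x by auto
      have "qform H (?y + ?z) = qform H ?y + l2inner ?y (H ?z) + l2inner ?z (H ?y) + l2inner ?z (H ?z)"
        using yz unfolding qform_def
        by (simp add: bounded_op_plus[OF b] l2inner_add_left l2inner_add_right bounded_op_l2[OF b])
      then have q: "Re (qform H x) = r * ?n^2 + Re (l2inner ?y (H ?z)) + Re (l2inner ?z (H ?y)) + Re (l2inner ?z (H ?z))"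
        using corner[OF x] by (simp flip: restrict_vec_split)
      have 1: "\<bar>Re (l2inner ?y (H ?z))\<bar> \<le> C * (?n * ?m)"
        using CS[OF yz] abs_Re_le_cmod order.trans by blast
      have 2: "\<bar>Re (l2inner ?z (H ?y))\<bar> \<le> C * (?n * ?m)"
        using CS[OF yz(2,1)] abs_Re_le_cmod[of "l2inner ?z (H ?y)"] by (simp add: mult_ac)
      have 3: "\<bar>Re (l2inner ?z (H ?z))\<bar> \<le> C * ?m^2"
        using CS[OF yz(2,2)] abs_Re_le_cmod[of "l2inner ?z (H ?z)"] by (simp add: power2_eq_square)
      have "0 \<le> (e * ?n - C * ?m)^2 / e" using e by simp
      also have "\<dots> = e * ?n^2 - 2 * (C * (?n * ?m)) + C^2 / e * ?m^2"
        using e by (simp add: power2_eq_square field_simps)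
      finally have 4: "2 * (C * (?n * ?m)) \<le> e * ?n^2 + C^2 / e * ?m^2" by simp
      have x2: "(l2norm x)^2 = ?n^2 + ?m^2" by (rule l2norm_split[OF x])
      have "\<bar>Re (qform H x) - r * (l2norm x)^2\<bar> \<le> 2 * (C * (?n * ?m)) + C * ?m^2 + \<bar>r * ?m^2\<bar>"
        unfolding q x2 distrib_left using 1 2 3 by linarith
      also have "\<dots> \<le> e * ?n^2 + C^2 / e * ?m^2 + C * ?m^2 + \<bar>r\<bar> * ?m^2"
        using 4 by (simp add: abs_mult)
      also have "\<dots> \<le> e * (l2norm x)^2 + K * ?m^2"
        unfolding K_def x2 using e by (simp add: algebra_simps)
      finally show ?thesis .
    qed
    have qW: "qform (W \<sigma>) x = complex_of_real (e * (l2norm x)^2 + K * (l2norm (restrict_vec (- A) x))^2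
        + \<sigma> * (Re (qform H x) - r * (l2norm x)^2))" if x: "x \<in> l2" for x \<sigma>
    proof -
      have "qform H x = complex_of_real (Re (qform H x))"
        using H x by (simp add: hermitian_op_def complex_eq_iff)
      then show ?thesis
        unfolding W_def using x b
        by (simp add: qform_add qform_diff qform_scale qform_id qform_diag_proj)
    qed
    have "positive_op (W \<sigma>)" if "\<sigma> \<in> {1, -1}" for \<sigma>
      unfolding positive_op_iff
    proof (intro conjI ballI bW)
      fix x :: "'a vec" assume x: "x \<in> l2"
      show "Im (qform (W \<sigma>) x) = 0" using qW[OF x] by simp
      show "0 \<le> Re (qform (W \<sigma>) x)"
        using est[OF x] that unfolding qW[OF x] Re_complex_of_real by auto
    qed
    then have p: "Re (\<psi> (W \<sigma>)) \<ge> 0 \<and> Im (\<psi> (W \<sigma>)) = 0" if "\<sigma> \<in> {1, -1}" for \<sigma>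
      using \<psi> that by (simp add: state_def)
    have "\<psi> (W \<sigma>) = complex_of_real e + complex_of_real \<sigma> * (\<psi> H - complex_of_real r)" for \<sigma>
      unfolding W_def using \<psi> b null
      by (simp add: state_add state_diff state_scale state_id)
    then show ?thesis using p[of 1] p[of "-1"] by auto
  qed
  have "\<bar>Re (\<psi> H) - r\<bar> \<le> 0"
    by (rule field_le_epsilon) (use key in auto)
  then show ?thesis using key[of 1] by (simp add: complex_eq_iff)
qed

lemma (in total_prob) diag_state_pure:
  assumes tv: "two_valued_nonzero \<mu>"
  shows "pure_state (diag_state \<mu>)"
  unfolding pure_state_def
proof (intro conjI allI impI diag_state_state)
  fix \<psi>1 \<psi>2 :: "'a op \<Rightarrow> complex" and t :: real and T :: "'a op"
  assume "state \<psi>1 \<and> state \<psi>2 \<and> 0 < t \<and> t < 1 \<and> (\<forall>T. bounded_op T \<longrightarrow>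
      diag_state \<mu> T = complex_of_real t * \<psi>1 T + complex_of_real (1 - t) * \<psi>2 T)"
  then have s: "state \<psi>1" "state \<psi>2" and t: "0 < t" "t < 1"
    and dec: "\<And>T. bounded_op T \<Longrightarrow>
      diag_state \<mu> T = complex_of_real t * \<psi>1 T + complex_of_real (1 - t) * \<psi>2 T" by auto
  have herm: "\<psi>1 H = diag_state \<mu> H" if H: "hermitian_op H" for H
  proof -
    obtain A where A: "\<mu> (- A) = 0" "\<And>a b. a \<in> A \<Longrightarrow> b \<in> A \<Longrightarrow> a \<noteq> b \<Longrightarrow> H (std_basis a) b = 0"
      "\<And>a. a \<in> A \<Longrightarrow> H (std_basis a) a = diag_state \<mu> H"
      using two_valued_paving[OF tv H] by blast
    let ?P = "diag_proj (- A)"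
    \<comment> \<open>A convex combination of nonnegative numbers that vanishes has vanishing terms,
      so \<open>\<psi>1\<close> inherits the null projection from the diagonal state.\<close>
    have "0 = t * Re (\<psi>1 ?P) + (1 - t) * Re (\<psi>2 ?P)"
      using arg_cong[OF dec[of ?P], of Re] A(1) by (simp add: diag_state_diag_proj)
    moreover have "Re (\<psi>1 ?P) \<ge> 0" "Re (\<psi>2 ?P) \<ge> 0" using state_pos[OF s(1), of ?P] state_pos[OF s(2), of ?P] by simp_all
    moreover have "0 \<le> (1 - t) * Re (\<psi>2 ?P)" using t calculation by simp
    moreover have "0 \<le> t * Re (\<psi>1 ?P)" using t calculation by simp
    ultimately have "t * Re (\<psi>1 ?P) = 0" by linarith
    then have "\<psi>1 ?P = 0" using t state_pos_real[OF s(1), of ?P] by (simp add: complex_eq_iff)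
    moreover obtain r where r: "diag_state \<mu> H = complex_of_real r" using diag_state_real[OF H] by blast
    ultimately show ?thesis
      using state_determined_on_corner[where A = A and r = r, OF s(1) H _ A(2)] A(3) by simp
  qed
  assume T: "bounded_op T"
  obtain H K where HK: "hermitian_op H" "hermitian_op K" "T = H + op_scale \<i> K"
    using hermitian_decomposition[OF T] by blast
  have "\<psi>1 T = \<psi>1 H + \<i> * \<psi>1 K"
    using s(1) HK by (simp add: state_add state_scale hermitian_bounded)
  also have "\<dots> = diag_state \<mu> T"
    using diag_state_state HK by (simp add: herm state_add state_scale hermitian_bounded)
  finally show "\<psi>1 T = diag_state \<mu> T" .
qed

section \<open>Hahn-Banach and pure states\<close>

text \<open>Homogeneity is asked only as an inequality; applying it with \<open>1/r\<close> gives
  the reverse one.\<close>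

definition sublinear_on :: "(real \<Rightarrow> 'v \<Rightarrow> 'v) \<Rightarrow> 'v set \<Rightarrow> ('v::ab_group_add \<Rightarrow> real) \<Rightarrow> bool" where
  "sublinear_on sc V p \<longleftrightarrow> (\<forall>x\<in>V. \<forall>y\<in>V. p (x + y) \<le> p x + p y) \<and>
     (\<forall>x\<in>V. \<forall>r>0. p (sc r x) \<le> r * p x)"

text \<open>Scalar action and carrier are parameters because the bounded operators are only a part
  of their function type.\<close>

locale real_subspace = vector_space sc for sc :: "real \<Rightarrow> 'v::ab_group_add \<Rightarrow> 'v" +
  fixes V :: "'v set"
  assumes V: "subspace V"
begin

lemma sublinear_add: "sublinear_on sc V p \<Longrightarrow> x \<in> V \<Longrightarrow> y \<in> V \<Longrightarrow> p (x + y) \<le> p x + p y"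
  by (simp add: sublinear_on_def)

lemma sublinear_scale: "sublinear_on sc V p \<Longrightarrow> x \<in> V \<Longrightarrow> r > 0 \<Longrightarrow> p (sc r x) \<le> r * p x"
  by (simp add: sublinear_on_def)

lemma sublinear_0:
  assumes p: "sublinear_on sc V p" shows "p 0 = 0"
  using sublinear_add[OF p, of 0 0] sublinear_scale[OF p, of 0 "1/2"] subspace_0[OF V] by simp

lemma sublinear_neg:
  assumes p: "sublinear_on sc V p" and x: "x \<in> V" shows "- p (- x) \<le> p x"
  using sublinear_add[OF p x subspace_neg[OF V x]] sublinear_0[OF p] by simp

text \<open>For sublinear \<open>p\<close> and \<open>y \<in> V\<close> this is again sublinear and
  below \<open>p\<close>, with value at most \<open>- p y\<close> at \<open>- y\<close>. A linear
  functional below it is therefore forced to take the value \<open>p y\<close> at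
  \<open>y\<close>.\<close>

definition tilt :: "('v \<Rightarrow> real) \<Rightarrow> 'v \<Rightarrow> 'v \<Rightarrow> real" where
  "tilt p y x = (if x \<in> V then Inf ((\<lambda>t. p (x + sc t y) - t * p y) ` {0..}) else 0)"

lemma tilt_bdd:
  assumes p: "sublinear_on sc V p" and x: "x \<in> V" and y: "y \<in> V" and t: "t \<ge> 0"
  shows "- p (- x) \<le> p (x + sc t y) - t * p y"
proof -
  have ty: "sc t y \<in> V" using V y by (rule subspace_scale)
  have "t * p y \<le> p (sc t y)"
  proof (cases "t = 0")
    case True then show ?thesis using sublinear_0[OF p] by simp
  next
    case False
    then have "p (sc (1/t) (sc t y)) \<le> (1/t) * p (sc t y)"
      using t by (intro sublinear_scale[OF p ty]) simp
    then show ?thesis using False t by (simp add: field_simps)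
  qed
  also have "p (sc t y) = p ((x + sc t y) + (- x))" by simp
  also have "\<dots> \<le> p (x + sc t y) + p (- x)"
    using V x ty by (intro sublinear_add[OF p] subspace_add subspace_neg)
  finally show ?thesis by simp
qed

lemma tilt_le:
  assumes p: "sublinear_on sc V p" and x: "x \<in> V" and y: "y \<in> V" and t: "t \<ge> 0"
  shows "tilt p y x \<le> p (x + sc t y) - t * p y"
proof -
  have "bdd_below ((\<lambda>t. p (x + sc t y) - t * p y) ` {0..})"
    using tilt_bdd[OF p x y] by (intro bdd_belowI2[where m = "- p (- x)"]) auto
  then show ?thesis unfolding tilt_def using x t by (auto intro: cInf_lower)
qed

lemma tilt_greatest:
  assumes "x \<in> V" "\<And>t. t \<ge> 0 \<Longrightarrow> c \<le> p (x + sc t y) - t * p y"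
  shows "c \<le> tilt p y x"
  unfolding tilt_def using assms by (auto intro!: cInf_greatest)

lemma tilt_le_self:
  assumes "sublinear_on sc V p" "x \<in> V" "y \<in> V" shows "tilt p y x \<le> p x"
  using tilt_le[OF assms, of 0] by simp

lemma tilt_neg:
  assumes p: "sublinear_on sc V p" and y: "y \<in> V" shows "tilt p y (- y) \<le> - p y"
  using tilt_le[OF p subspace_neg[OF V y] y, of 1] sublinear_0[OF p] by simp

lemma tilt_sublinear:
  assumes p: "sublinear_on sc V p" and y: "y \<in> V" shows "sublinear_on sc V (tilt p y)"
  unfolding sublinear_on_def
proof (intro conjI ballI allI impI)
  fix x z assume x: "x \<in> V" and z: "z \<in> V"
  have xz: "x + z \<in> V" using V x z by (rule subspace_add)
  have *: "tilt p y (x + z) \<le> (p (x + sc s y) - s * p y) + (p (z + sc t y) - t * p y)"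
    if "s \<ge> 0" "t \<ge> 0" for s t
  proof -
    have "tilt p y (x + z) \<le> p (x + z + sc (s + t) y) - (s + t) * p y"
      using that by (intro tilt_le[OF p xz y]) simp
    also have "x + z + sc (s + t) y = (x + sc s y) + (z + sc t y)"
      by (simp add: scale_left_distrib)
    also have "p \<dots> \<le> p (x + sc s y) + p (z + sc t y)"
      using V x y z by (intro sublinear_add[OF p] subspace_add subspace_scale)
    finally show ?thesis by (simp add: algebra_simps)
  qed
  have "tilt p y (x + z) - (p (x + sc s y) - s * p y) \<le> tilt p y z" if "s \<ge> 0" for s
    using *[OF that] by (intro tilt_greatest[OF z]) (simp add: algebra_simps)
  then have "tilt p y (x + z) - tilt p y z \<le> tilt p y x"
    by (intro tilt_greatest[OF x]) (simp add: algebra_simps)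
  then show "tilt p y (x + z) \<le> tilt p y x + tilt p y z" by simp
next
  fix x and r :: real assume x: "x \<in> V" and r: "r > 0"
  have rx: "sc r x \<in> V" using V x by (rule subspace_scale)
  have "tilt p y (sc r x) / r \<le> tilt p y x"
  proof (rule tilt_greatest[OF x])
    fix t :: real assume t: "t \<ge> 0"
    have "tilt p y (sc r x) \<le> p (sc r x + sc (r * t) y) - (r * t) * p y"
      using r t by (intro tilt_le[OF p rx y]) simp
    also have "sc r x + sc (r * t) y = sc r (x + sc t y)" by (simp add: scale_right_distrib)
    also have "p \<dots> \<le> r * p (x + sc t y)"
      using V x y r by (intro sublinear_scale[OF p] subspace_add subspace_scale)
    finally have "tilt p y (sc r x) \<le> r * (p (x + sc t y) - t * p y)" by (simp add: algebra_simps)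
    then show "tilt p y (sc r x) / r \<le> p (x + sc t y) - t * p y"
      using r by (simp add: divide_le_eq mult.commute)
  qed
  then show "tilt p y (sc r x) \<le> r * tilt p y x" using r by (simp add: divide_le_eq mult.commute)
qed

lemma minimal_sublinear:
  assumes p: "sublinear_on sc V p"
  shows "\<exists>m. sublinear_on sc V m \<and> (\<forall>x\<in>V. m x \<le> p x) \<and>
    (\<forall>q. sublinear_on sc V q \<longrightarrow> (\<forall>x\<in>V. q x \<le> m x) \<longrightarrow> (\<forall>x\<in>V. q x = m x))"
proof -
  \<comment> \<open>Vanishing off \<open>V\<close> is a normal form: comparisons on \<open>V\<close>
    become comparisons everywhere, as \<open>P\<close> requires. That order is reversed, so maximal
    elements in Zorn's lemma are minimal functionals.\<close>
  define S where "S = {q. sublinear_on sc V q \<and> (\<forall>x\<in>V. q x \<le> p x) \<and> (\<forall>x. x \<notin> V \<longrightarrow> q x = 0)}"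
  define P where "P a b \<longleftrightarrow> (\<forall>x. b x \<le> a x)" for a b :: "'v \<Rightarrow> real"
  have restr: "sublinear_on sc V (\<lambda>x. if x \<in> V then q x else 0)" if "sublinear_on sc V q" for q
    using that V by (simp add: sublinear_on_def subspace_add subspace_scale)
  have "\<exists>m\<in>S. \<forall>a\<in>S. P m a \<longrightarrow> a = m"
  proof (rule predicate_Zorn)
    show "partial_order_on S (relation_of P S)"
      by (rule partial_order_on_relation_ofI) (auto simp: P_def intro!: ext order.antisym intro: order.trans)
    fix C assume C: "C \<in> Chains (relation_of P S)"
    then have CS: "C \<subseteq> S" and tot: "\<And>a b. a \<in> C \<Longrightarrow> b \<in> C \<Longrightarrow> P a b \<or> P b a"
      by (auto simp: Chains_def relation_of_def)
    show "\<exists>u\<in>S. \<forall>a\<in>C. P a u"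
    proof (cases "C = {}")
      case True
      have "(\<lambda>x. if x \<in> V then p x else 0) \<in> S" unfolding S_def using restr[OF p] by simp
      then show ?thesis using True by blast
    next
      case False
      then obtain c0 where c0: "c0 \<in> C" by blast
      define u where "u x = (if x \<in> V then Inf ((\<lambda>c. c x) ` C) else 0)" for x
      have bd: "bdd_below ((\<lambda>c. c x) ` C)" if x: "x \<in> V" for x
      proof (rule bdd_belowI2)
        fix c assume "c \<in> C"
        then have c: "sublinear_on sc V c" "\<forall>x\<in>V. c x \<le> p x" using CS by (auto simp: S_def)
        have "- c (- x) \<le> c x" by (rule sublinear_neg[OF c(1) x])
        moreover have "c (- x) \<le> p (- x)" using c(2) subspace_neg[OF V x] by blast
        ultimately show "- p (- x) \<le> c x" by simp
      qed
      have le: "u x \<le> c x" if "c \<in> C" "x \<in> V" for c x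
        unfolding u_def using that bd[OF that(2)] by (auto intro: cInf_lower)
      have gr: "k \<le> u x" if "x \<in> V" "\<And>c. c \<in> C \<Longrightarrow> k \<le> c x" for k x
        unfolding u_def using that False by (auto intro!: cInf_greatest)
      have cs: "sublinear_on sc V c" if "c \<in> C" for c using CS that by (auto simp: S_def)
      have "sublinear_on sc V u"
        unfolding sublinear_on_def
      proof (intro conjI ballI allI impI)
        fix x y assume x: "x \<in> V" and y: "y \<in> V"
        have xy: "x + y \<in> V" using V x y by (rule subspace_add)
        \<comment> \<open>Subadditivity of the infimum over the chain: of two members the smaller
          one can serve for both arguments.\<close>
        have *: "u (x + y) \<le> c x + d y" if c: "c \<in> C" and d: "d \<in> C" for c d
          using tot[OF c d]
        proof
          assume "P c d"
          then have "d x \<le> c x" by (simp add: P_def)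
          then show ?thesis
            using le[OF d xy] sublinear_add[OF cs[OF d] x y] by linarith
        next
          assume "P d c"
          then have "c y \<le> d y" by (simp add: P_def)
          then show ?thesis
            using le[OF c xy] sublinear_add[OF cs[OF c] x y] by linarith
        qed
        have "u (x + y) - c x \<le> u y" if "c \<in> C" for c
          using *[OF that] by (intro gr[OF y]) (simp add: algebra_simps)
        then have "u (x + y) - u y \<le> u x" by (intro gr[OF x]) (simp add: algebra_simps)
        then show "u (x + y) \<le> u x + u y" by simp
      next
        fix x and r :: real assume x: "x \<in> V" and r: "r > 0"
        have rx: "sc r x \<in> V" using V x by (rule subspace_scale)
        have "u (sc r x) / r \<le> u x"
        proof (rule gr[OF x])
          fix c assume c: "c \<in> C"
          have "u (sc r x) \<le> r * c x"
            using le[OF c rx] sublinear_scale[OF cs[OF c] x r] by linarith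
          then show "u (sc r x) / r \<le> c x" using r by (simp add: divide_le_eq mult.commute)
        qed
        then show "u (sc r x) \<le> r * u x" using r by (simp add: divide_le_eq mult.commute)
      qed
      moreover have "u x \<le> p x" if "x \<in> V" for x
        using le[OF c0 that] c0 CS that by (force simp: S_def)
      ultimately have "u \<in> S" by (simp add: S_def u_def)
      moreover have "P a u" if a: "a \<in> C" for a
        unfolding P_def
      proof
        fix x show "u x \<le> a x"
          using le[OF a, of x] a CS by (cases "x \<in> V") (auto simp: S_def u_def)
      qed
      ultimately show ?thesis by blast
    qed
  qed
  then obtain m where m: "m \<in> S" and min: "\<And>a. a \<in> S \<Longrightarrow> P m a \<Longrightarrow> a = m" by blast
  have qm: "q x = m x" if q: "sublinear_on sc V q" "\<forall>x\<in>V. q x \<le> m x" and x: "x \<in> V" for q x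
  proof -
    let ?q = "\<lambda>x. if x \<in> V then q x else 0"
    have "\<forall>x\<in>V. ?q x \<le> p x" using q(2) m by (force simp: S_def)
    then have "?q \<in> S" using restr[OF q(1)] by (simp add: S_def)
    moreover have "P m ?q" using q(2) m by (simp add: P_def S_def)
    ultimately have "?q = m" by (rule min)
    then have "?q x = m x" by (rule fun_cong)
    then show ?thesis using x by simp
  qed
  show ?thesis
  proof (intro exI[of _ m] conjI allI impI ballI)
    show "sublinear_on sc V m" using m by (simp add: S_def)
    show "m x \<le> p x" if "x \<in> V" for x using m that by (simp add: S_def)
  qed (rule qm)
qed

text \<open>A minimal sublinear \<open>m\<close> is linear: \<open>tilt m y\<close> lies below
  \<open>m\<close>, hence equals it, and at \<open>- y\<close> this reads
  \<open>m (- y) \<le> - m y\<close>. Minimising below \<open>tilt p x0\<close> rather than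
  \<open>p\<close> fixes the value at \<open>x0\<close>.\<close>

theorem hahn_banach_sublinear:
  assumes p: "sublinear_on sc V p" and x0: "x0 \<in> V"
  shows "\<exists>u. (\<forall>x\<in>V. \<forall>y\<in>V. u (x + y) = u x + u y) \<and> (\<forall>x\<in>V. \<forall>r. u (sc r x) = r * u x) \<and>
    (\<forall>x\<in>V. u x \<le> p x) \<and> u x0 = p x0"
proof -
  obtain m where "sublinear_on sc V m \<and> (\<forall>x\<in>V. m x \<le> tilt p x0 x) \<and>
    (\<forall>q. sublinear_on sc V q \<longrightarrow> (\<forall>x\<in>V. q x \<le> m x) \<longrightarrow> (\<forall>x\<in>V. q x = m x))"
    using minimal_sublinear[OF tilt_sublinear[OF p x0]] ..
  then have m: "sublinear_on sc V m" "\<And>x. x \<in> V \<Longrightarrow> m x \<le> tilt p x0 x"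
    and min: "\<And>q x. sublinear_on sc V q \<Longrightarrow> (\<And>x. x \<in> V \<Longrightarrow> q x \<le> m x) \<Longrightarrow> x \<in> V \<Longrightarrow> q x = m x"
    by blast+
  have neg: "m (- y) = - m y" if y: "y \<in> V" for y
  proof -
    have "tilt m y (- y) = m (- y)"
      using y V by (intro min tilt_sublinear[OF m(1)] tilt_le_self[OF m(1)] subspace_neg)
    then have "m (- y) \<le> - m y" using tilt_neg[OF m(1) y] by simp
    then show ?thesis using sublinear_neg[OF m(1) y] by simp
  qed
  have add: "m (x + y) = m x + m y" if x: "x \<in> V" and y: "y \<in> V" for x y
  proof -
    have "m ((x + y) + (- y)) \<le> m (x + y) + m (- y)"
      using V x y by (intro sublinear_add[OF m(1)] subspace_add subspace_neg)
    then show ?thesis using neg[OF y] sublinear_add[OF m(1) x y] by simp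
  qed
  have pos: "m (sc r x) = r * m x" if x: "x \<in> V" and r: "r > 0" for r x
  proof -
    have "m (sc (1/r) (sc r x)) \<le> (1/r) * m (sc r x)"
      using r V x by (intro sublinear_scale[OF m(1)] subspace_scale) auto
    then have "r * m x \<le> m (sc r x)" using r by (simp add: field_simps)
    then show ?thesis using sublinear_scale[OF m(1) x r] by simp
  qed
  have scale: "m (sc r x) = r * m x" if x: "x \<in> V" for r x
  proof -
    consider "r > 0" | "r = 0" | "r < 0" by linarith
    then show ?thesis
    proof cases
      case 3
      have "m (sc (- r) x) = - r * m x" using 3 by (intro pos[OF x]) simp
      moreover have "m (sc (- r) x) = - m (sc r x)"
        using neg[OF subspace_scale[OF V x, of r]] by simp
      ultimately show ?thesis by simp
    qed (use pos[OF x] sublinear_0[OF m(1)] in auto)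
  qed
  have le: "m x \<le> p x" if "x \<in> V" for x
    using m(2)[OF that] tilt_le_self[OF p that x0] by simp
  have "m (- x0) \<le> - p x0"
    using m(2)[OF subspace_neg[OF V x0]] tilt_neg[OF p x0] by simp
  then have "m x0 = p x0" using neg[OF x0] le[OF x0] by simp
  then show ?thesis
    by (intro exI[of _ m] conjI allI impI ballI) (rule add scale le | assumption)+
qed

end

section \<open>Positive majorants and extremality of a pure state\<close>

lemma op_scale_scale: "op_scale c (op_scale d T) = op_scale (c * d) T"
  by (simp add: op_scale_def mult.assoc)

lemma op_scale_add_right: "op_scale c (S + T) = op_scale c S + op_scale c T"
  by (intro ext) (simp add: op_scale_def algebra_simps)

lemma op_scale_add_left: "op_scale (c + d) T = op_scale c T + op_scale d T"
  by (intro ext) (simp add: op_scale_def algebra_simps)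

lemma op_scale_1 [simp]: "op_scale 1 T = T"
  by (simp add: op_scale_def)

lemma real_subspace_bounded_op:
  "real_subspace (\<lambda>r. op_scale (complex_of_real r)) {T :: 'a op. bounded_op T}"
proof -
  have v: "vector_space (\<lambda>r. op_scale (complex_of_real r) :: 'a op \<Rightarrow> 'a op)"
    by unfold_locales (simp_all add: op_scale_scale op_scale_add_right op_scale_add_left)
  interpret vector_space "\<lambda>r. op_scale (complex_of_real r) :: 'a op \<Rightarrow> 'a op" by (rule v)
  show ?thesis by unfold_locales (auto simp: subspace_def)
qed

text \<open>The least cost under \<open>\<phi>\<close> of a positive operator dominating the real
  part of the form of \<open>T\<close>. A linear functional below it is automatically positive,
  since \<open>0\<close> majorises the negative of a positive operator, and it stays below
  \<open>Re \<phi>\<close> on positive operators, which majorise themselves.\<close>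

definition pos_majorant_inf :: "('a op \<Rightarrow> complex) \<Rightarrow> 'a op \<Rightarrow> real" where
  "pos_majorant_inf \<phi> T = Inf ((\<lambda>h. Re (\<phi> h)) `
     {h. positive_op h \<and> (\<forall>x\<in>l2. Re (qform T x) \<le> Re (qform h x))})"

lemma pos_majorant_inf_le:
  assumes "state \<phi>" "positive_op h" "\<And>x. x \<in> l2 \<Longrightarrow> Re (qform T x) \<le> Re (qform h x)"
  shows "pos_majorant_inf \<phi> T \<le> Re (\<phi> h)"
  unfolding pos_majorant_inf_def using assms
  by (intro cInf_lower) (auto intro!: bdd_belowI2[where m = 0] state_pos[OF assms(1)])

lemma pos_majorant_exists:
  assumes "bounded_op T"
  obtains h where "positive_op h" "\<And>x. x \<in> l2 \<Longrightarrow> Re (qform T x) \<le> Re (qform h x)"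
proof -
  obtain C where C: "C \<ge> 0" "\<And>x. x \<in> l2 \<Longrightarrow> cmod (qform T x) \<le> C * (l2norm x)^2"
    using qform_bound[OF assms] by blast
  have "Re (qform T x) \<le> Re (qform (op_scale (complex_of_real C) id_op) x)" if "x \<in> l2" for x
    using C(2)[OF that] complex_Re_le_cmod[of "qform T x"] that
    by (simp add: qform_scale qform_id)
  then show ?thesis using that[of "op_scale (complex_of_real C) id_op"] C(1) positive_op_scale positive_op_id
    by blast
qed

lemma pos_majorant_inf_approx:
  assumes T: "bounded_op T" and c: "pos_majorant_inf \<phi> T < c"
  obtains h where "positive_op h" "\<And>x. x \<in> l2 \<Longrightarrow> Re (qform T x) \<le> Re (qform h x)" "Re (\<phi> h) < c"
proof -
  let ?X = "{h. positive_op h \<and> (\<forall>x\<in>l2. Re (qform T x) \<le> Re (qform h x))}"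
  obtain h0 where "positive_op h0" "\<And>x. x \<in> l2 \<Longrightarrow> Re (qform T x) \<le> Re (qform h0 x)"
    using pos_majorant_exists[OF T] by blast
  then have "h0 \<in> ?X" by simp
  then have "(\<lambda>h. Re (\<phi> h)) ` ?X \<noteq> {}" by blast
  from cInf_lessD[OF this c[unfolded pos_majorant_inf_def]]
  obtain h where "h \<in> ?X" "Re (\<phi> h) < c" by (auto simp del: mem_Collect_eq)
  then show ?thesis by (intro that[of h]) simp_all
qed

lemma pos_majorant_inf_sublinear:
  assumes \<phi>: "state \<phi>"
  shows "sublinear_on (\<lambda>r. op_scale (complex_of_real r)) {T. bounded_op T} (pos_majorant_inf \<phi>)"
  unfolding sublinear_on_def
proof (intro conjI ballI allI impI; unfold mem_Collect_eq)
  fix S T :: "'a op" assume S: "bounded_op S" and T: "bounded_op T"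
  show "pos_majorant_inf \<phi> (S + T) \<le> pos_majorant_inf \<phi> S + pos_majorant_inf \<phi> T"
  proof (rule field_le_epsilon)
    fix e :: real assume e: "e > 0"
    obtain h where h: "positive_op h" "\<And>x. x \<in> l2 \<Longrightarrow> Re (qform S x) \<le> Re (qform h x)"
      "Re (\<phi> h) < pos_majorant_inf \<phi> S + e/2"
      using pos_majorant_inf_approx[OF S, of \<phi> "pos_majorant_inf \<phi> S + e/2"] e by auto
    obtain k where k: "positive_op k" "\<And>x. x \<in> l2 \<Longrightarrow> Re (qform T x) \<le> Re (qform k x)"
      "Re (\<phi> k) < pos_majorant_inf \<phi> T + e/2"
      using pos_majorant_inf_approx[OF T, of \<phi> "pos_majorant_inf \<phi> T + e/2"] e by auto
    have b: "bounded_op h" "bounded_op k" using h k positive_bounded by auto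
    have "pos_majorant_inf \<phi> (S + T) \<le> Re (\<phi> (h + k))"
      using h(1,2) k(1,2) S T b by (intro pos_majorant_inf_le[OF \<phi>]) (auto simp: qform_add add_mono)
    also have "\<dots> = Re (\<phi> h) + Re (\<phi> k)" using \<phi> b by (simp add: state_add)
    finally show "pos_majorant_inf \<phi> (S + T) \<le> pos_majorant_inf \<phi> S + pos_majorant_inf \<phi> T + e"
      using h(3) k(3) by linarith
  qed
next
  fix T :: "'a op" and r :: real assume T: "bounded_op T" and r: "r > 0"
  show "pos_majorant_inf \<phi> (op_scale (complex_of_real r) T) \<le> r * pos_majorant_inf \<phi> T"
  proof (rule field_le_epsilon)
    fix e :: real assume e: "e > 0"
    obtain h where h: "positive_op h" "\<And>x. x \<in> l2 \<Longrightarrow> Re (qform T x) \<le> Re (qform h x)"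
      "Re (\<phi> h) < pos_majorant_inf \<phi> T + e/r"
      using pos_majorant_inf_approx[OF T, of \<phi> "pos_majorant_inf \<phi> T + e/r"] e r by auto
    have "pos_majorant_inf \<phi> (op_scale (complex_of_real r) T) \<le> Re (\<phi> (op_scale (complex_of_real r) h))"
      using h(1,2) r by (intro pos_majorant_inf_le[OF \<phi>] positive_op_scale) (auto simp: qform_scale)
    also have "\<dots> = r * Re (\<phi> h)" using \<phi> positive_bounded[OF h(1)] by (simp add: state_scale)
    also have "\<dots> \<le> r * (pos_majorant_inf \<phi> T + e/r)" using h(3) r by simp
    finally show "pos_majorant_inf \<phi> (op_scale (complex_of_real r) T) \<le> r * pos_majorant_inf \<phi> T + e"
      using r by (simp add: algebra_simps)
  qed
qed

text \<open>Extremality of a pure state, tested against the Hahn-Banach functional below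
  the sublinear functional \<open>pos_majorant_inf\<close>: that functional is squeezed between \<open>0\<close> and the state.\<close>

lemma pure_state_majorant:
  assumes pure: "pure_state \<phi>" and e: "e > 0" and c: "c = Re (\<phi> (diag_proj A))"
    and T: "T = op_scale (complex_of_real \<sigma>) (diag_proj A - op_scale (complex_of_real c) id_op)"
  obtains h where "positive_op h" "\<And>x. x \<in> l2 \<Longrightarrow> Re (qform T x) \<le> Re (qform h x)" "Re (\<phi> h) < e"
proof -
  have \<phi>: "state \<phi>" using pure by (simp add: pure_state_def)
  have bT: "bounded_op T" unfolding T by simp
  interpret real_subspace "\<lambda>r. op_scale (complex_of_real r)" "{T :: 'a op. bounded_op T}"
    by (rule real_subspace_bounded_op)
  have "\<exists>u. (\<forall>S\<in>{T. bounded_op T}. \<forall>R\<in>{T. bounded_op T}. u (S + R) = u S + u R) \<and>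
    (\<forall>S\<in>{T. bounded_op T}. \<forall>r. u (op_scale (complex_of_real r) S) = r * u S) \<and>
    (\<forall>S\<in>{T. bounded_op T}. u S \<le> pos_majorant_inf \<phi> S) \<and> u T = pos_majorant_inf \<phi> T"
    by (rule hahn_banach_sublinear[OF pos_majorant_inf_sublinear[OF \<phi>]]) (simp add: bT)
  then obtain u :: "'a op \<Rightarrow> real" where
    "(\<forall>S\<in>{T. bounded_op T}. \<forall>R\<in>{T. bounded_op T}. u (S + R) = u S + u R) \<and>
    (\<forall>S\<in>{T. bounded_op T}. \<forall>r. u (op_scale (complex_of_real r) S) = r * u S) \<and>
    (\<forall>S\<in>{T. bounded_op T}. u S \<le> pos_majorant_inf \<phi> S) \<and> u T = pos_majorant_inf \<phi> T" ..
  then have uadd: "\<And>S R. bounded_op S \<Longrightarrow> bounded_op R \<Longrightarrow> u (S + R) = u S + u R"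
    and usc: "\<And>r S. bounded_op S \<Longrightarrow> u (op_scale (complex_of_real r) S) = r * u S"
    and ule: "\<And>S. bounded_op S \<Longrightarrow> u S \<le> pos_majorant_inf \<phi> S"
    and uT: "u T = pos_majorant_inf \<phi> T"
    by blast+
  have uneg: "u (- S) = - u S" if "bounded_op S" for S
    using usc[OF that, of "-1"] by (simp add: op_uminus_eq)
  have unonpos: "u S \<le> 0" if "bounded_op S" "\<And>x. x \<in> l2 \<Longrightarrow> Re (qform S x) \<le> 0" for S
  proof -
    have "u S \<le> pos_majorant_inf \<phi> S" by (rule ule[OF that(1)])
    also have "\<dots> \<le> Re (\<phi> 0)" using that(2) by (intro pos_majorant_inf_le[OF \<phi>]) auto
    finally show ?thesis using state_0[OF \<phi>] by simp
  qed
  have upos: "0 \<le> u h" if h: "positive_op h" for h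
  proof -
    have "u (- h) \<le> 0"
      using h by (intro unonpos) (auto simp: positive_bounded qform_uminus positive_op_iff)
    then show ?thesis using uneg[OF positive_bounded[OF h]] by simp
  qed
  have u\<phi>: "u h \<le> Re (\<phi> h)" if h: "positive_op h" for h
    using ule[OF positive_bounded[OF h]] pos_majorant_inf_le[OF \<phi> h, of h] by simp
  \<comment> \<open>The form of \<open>\<i> h\<close> has real part zero, so \<open>0\<close>
    majorises it with either sign. Hence the complex functional \<open>\<psi>\<close> below is real
    on positive operators.\<close>
  have uim: "u (op_scale \<i> h) = 0" if h: "positive_op h" for h
  proof -
    have b: "bounded_op (op_scale \<i> h)" using positive_bounded[OF h] by simp
    have q: "Re (qform (op_scale \<i> h) x) = 0" if "x \<in> l2" for x
      using h that by (simp add: qform_scale positive_op_iff)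
    have "u (op_scale \<i> h) \<le> 0" using q by (intro unonpos[OF b]) simp
    moreover have "u (- op_scale \<i> h) \<le> 0" using q b by (intro unonpos) (auto simp: qform_uminus)
    ultimately show ?thesis using uneg[OF b] by simp
  qed
  \<comment> \<open>The complex linear functional with real part \<open>u\<close>.\<close>
  define \<psi> where "\<psi> S = Complex (u S) (- u (op_scale \<i> S))" for S
  have \<psi>add: "\<psi> (S + R) = \<psi> S + \<psi> R" if "bounded_op S" "bounded_op R" for S R
    using that by (simp add: \<psi>_def uadd op_scale_add_right complex_eq_iff)
  have \<psi>scale: "\<psi> (op_scale z S) = z * \<psi> S" if S: "bounded_op S" for z S
  proof -
    have iS: "bounded_op (op_scale \<i> S)" using S by simp
    have 1: "op_scale z S = op_scale (complex_of_real (Re z)) S + op_scale (complex_of_real (Im z)) (op_scale \<i> S)"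
      unfolding op_scale_scale op_scale_add_left[symmetric]
      by (rule arg_cong[where f = "\<lambda>c. op_scale c S"]) (simp add: complex_eq_iff)
    have 2: "op_scale \<i> (op_scale z S) = op_scale (complex_of_real (Re z)) (op_scale \<i> S) + op_scale (complex_of_real (- Im z)) S"
      unfolding op_scale_scale op_scale_add_left[symmetric]
      by (rule arg_cong[where f = "\<lambda>c. op_scale c S"]) (simp add: complex_eq_iff)
    have "u (op_scale z S) = Re z * u S + Im z * u (op_scale \<i> S)"
      unfolding 1 using S iS by (simp only: uadd usc bounded_op_scale)
    moreover have "u (op_scale \<i> (op_scale z S)) = Re z * u (op_scale \<i> S) - Im z * u S"
      unfolding 2 using S iS by (simp only: uadd usc bounded_op_scale)
    ultimately show ?thesis by (simp add: \<psi>_def complex_eq_iff)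
  qed
  have \<psi>pos: "Im (\<psi> h) = 0 \<and> Re (\<psi> h) = u h" if "positive_op h" for h
    using uim[OF that] by (simp add: \<psi>_def)
  define s where "s = u id_op"
  have s01: "0 \<le> s" "s \<le> 1"
    unfolding s_def using upos[of id_op] u\<phi>[of id_op] state_id[OF \<phi>] by auto
  let ?P = "diag_proj A" and ?Q = "diag_proj (- A)"
  have PQ: "id_op = ?P + ?Q"
    by (intro ext) (auto simp: id_op_def diag_proj_def restrict_vec_def)
  have uPQ: "s = u ?P + u ?Q" unfolding s_def PQ by (simp add: uadd)
  have \<phi>PQ: "1 = Re (\<phi> ?P) + Re (\<phi> ?Q)"
    using state_id[OF \<phi>] state_add[OF \<phi>, of ?P ?Q] unfolding PQ[symmetric] by (simp add: complex_eq_iff)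
  \<comment> \<open>The decomposition of \<open>\<phi>\<close> into \<open>\<psi>1\<close> and
    \<open>\<psi>2\<close> needs \<open>0 < s < 1\<close>. For \<open>s = 0\<close> positivity makes
    both summands of \<open>s\<close> vanish; for \<open>s = 1\<close> neither \<open>u ?P\<close>
    nor \<open>u ?Q\<close> can fall short of its upper bound.\<close>
  have "u ?P = s * c"
  proof -
    consider "s = 0" | "s = 1" | "0 < s" "s < 1" using s01 by linarith
    then show ?thesis
    proof cases
      case 1
      then have "u ?P = 0" using uPQ upos[of ?P] upos[of ?Q] by simp
      then show ?thesis using 1 by simp
    next
      case 2
      then have "u ?P = Re (\<phi> ?P)" using uPQ \<phi>PQ u\<phi>[of ?P] u\<phi>[of ?Q] by simp
      then show ?thesis using 2 c by simp
    next
      case 3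
      define \<psi>1 where "\<psi>1 S = complex_of_real (1/s) * \<psi> S" for S
      define \<psi>2 where "\<psi>2 S = complex_of_real (1/(1-s)) * (\<phi> S - \<psi> S)" for S
      have "\<psi> id_op = complex_of_real s" using \<psi>pos[of id_op] by (simp add: s_def complex_eq_iff)
      then have "\<psi>1 id_op = complex_of_real (1/s * s)" "\<psi>2 id_op = complex_of_real (1/(1-s) * (1-s))"
        using state_id[OF \<phi>] by (simp_all only: \<psi>1_def \<psi>2_def of_real_mult of_real_diff of_real_1)
      then have n: "\<psi>1 id_op = 1" "\<psi>2 id_op = 1" using 3 by simp_all
      have "state \<psi>1"
        unfolding state_def op_scale_def[symmetric]
      proof (intro conjI allI impI n(1))
        fix h :: "'a op" assume h: "positive_op h"
        show "Im (\<psi>1 h) = 0" using \<psi>pos[OF h] by (simp add: \<psi>1_def)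
        show "0 \<le> Re (\<psi>1 h)" using \<psi>pos[OF h] upos[OF h] 3 by (simp add: \<psi>1_def)
      qed (auto simp: \<psi>1_def \<psi>add \<psi>scale algebra_simps)
      moreover have "state \<psi>2"
        unfolding state_def op_scale_def[symmetric]
      proof (intro conjI allI impI n(2))
        fix h :: "'a op" assume h: "positive_op h"
        show "Im (\<psi>2 h) = 0" using \<psi>pos[OF h] state_pos_real[OF \<phi> h] by (simp add: \<psi>2_def)
        show "0 \<le> Re (\<psi>2 h)" using \<psi>pos[OF h] u\<phi>[OF h] 3 by (simp add: \<psi>2_def)
      qed (auto simp: \<psi>2_def \<psi>add \<psi>scale state_add[OF \<phi>] state_scale[OF \<phi>] algebra_simps
          add_divide_distrib diff_divide_distrib)
      moreover have "\<phi> S = complex_of_real s * \<psi>1 S + complex_of_real (1 - s) * \<psi>2 S" for S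
      proof -
        have "complex_of_real s * complex_of_real (1/s) = 1" "complex_of_real (1 - s) * complex_of_real (1/(1-s)) = 1"
          using 3 by (simp_all flip: of_real_mult)
        then show ?thesis by (simp only: \<psi>1_def \<psi>2_def mult.assoc[symmetric]) simp
      qed
      ultimately have "\<psi>1 ?P = \<phi> ?P"
        using pure 3 unfolding pure_state_def by (meson bounded_op_diag_proj)
      then have "Re (\<psi>1 ?P) = c" using c by simp
      then show ?thesis using 3 by (simp add: \<psi>1_def \<psi>_def field_simps)
    qed
  qed
  \<comment> \<open>Together with \<open>u ?P = s * c\<close> this makes the infimum at
    \<open>T\<close> equal to zero, so majorants of cost below \<open>e\<close> exist.\<close>
  moreover have "u T = \<sigma> * (u ?P - c * s)"
  proof -
    have "T = op_scale (complex_of_real \<sigma>) (?P + op_scale (complex_of_real (- c)) id_op)"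
      unfolding T by (rule arg_cong[where f = "op_scale (complex_of_real \<sigma>)"]) (intro ext, simp add: op_scale_def)
    then show ?thesis by (simp only: usc uadd bounded_op_add bounded_op_scale bounded_op_diag_proj bounded_op_id s_def) simp
  qed
  ultimately have "pos_majorant_inf \<phi> T < e" using uT e by (simp add: mult.commute)
  then show ?thesis using pos_majorant_inf_approx[OF bT] that by blast
qed

text \<open>The two signs \<open>\<sigma> = 1\<close> and \<open>\<sigma> = -1\<close> give
  one-sided majorants; being positive, they add up to a majorant of the absolute value.\<close>

lemma pure_state_local:
  assumes pure: "pure_state \<phi>" and e: "e > 0"
  shows "\<exists>h. positive_op h \<and> Re (\<phi> h) \<le> e \<and> (\<forall>x\<in>l2.
    \<bar>(l2norm (restrict_vec A x))^2 - Re (\<phi> (diag_proj A)) * (l2norm x)^2\<bar> \<le> Re (qform h x))"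
proof -
  have \<phi>: "state \<phi>" using pure by (simp add: pure_state_def)
  define c where "c = Re (\<phi> (diag_proj A))"
  define T where "T \<sigma> = op_scale (complex_of_real \<sigma>) (diag_proj A - op_scale (complex_of_real c) id_op)" for \<sigma>
  have qT: "Re (qform (T \<sigma>) x) = \<sigma> * ((l2norm (restrict_vec A x))^2 - c * (l2norm x)^2)" if "x \<in> l2" for \<sigma> x
    using that by (simp add: T_def qform_scale qform_diff qform_diag_proj qform_id)
  have e2: "e/2 > 0" using e by simp
  obtain h where h: "positive_op h" "\<And>x. x \<in> l2 \<Longrightarrow> Re (qform (T 1) x) \<le> Re (qform h x)" "Re (\<phi> h) < e/2"
    using pure_state_majorant[OF pure e2 c_def T_def[of 1]] by blast
  obtain k where k: "positive_op k" "\<And>x. x \<in> l2 \<Longrightarrow> Re (qform (T (-1)) x) \<le> Re (qform k x)" "Re (\<phi> k) < e/2"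
    using pure_state_majorant[OF pure e2 c_def T_def[of "-1"]] by blast
  have b: "bounded_op h" "bounded_op k" using h k positive_bounded by auto
  have "\<bar>(l2norm (restrict_vec A x))^2 - c * (l2norm x)^2\<bar> \<le> Re (qform (h + k) x)" if x: "x \<in> l2" for x
  proof -
    have "0 \<le> Re (qform h x)" "0 \<le> Re (qform k x)" using h(1) k(1) x by (auto simp: positive_op_iff)
    then show ?thesis using h(2)[OF x] k(2)[OF x] qT[OF x] b x by (simp add: qform_add)
  qed
  moreover have "Re (\<phi> (h + k)) \<le> e" using h(3) k(3) \<phi> b by (simp add: state_add)
  ultimately show ?thesis using h(1) k(1) positive_op_add unfolding c_def by blast
qed

section \<open>Vectors representing a pure state on countably many sets\<close>

lemma qform_vec_add:
  assumes T: "hermitian_op T" and u: "u \<in> l2" and v: "v \<in> l2"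
  shows "Re (qform T (u + v)) = Re (qform T u) + 2 * Re (l2inner u (T v)) + Re (qform T v)"
proof -
  have b: "bounded_op T" using T by (rule hermitian_bounded)
  have "l2inner v (T u) = cnj (l2inner u (T v))"
    using hermitian_op_swap[OF T v u] l2inner_commute[of "T v" u] by simp
  then show ?thesis
    using u v by (simp add: qform_def bounded_op_plus[OF b] l2inner_add_left l2inner_add_right bounded_op_l2[OF b])
qed

lemma qform_vec_scale:
  assumes "bounded_op T" "x \<in> l2"
  shows "qform T (\<lambda>i. c * x i) = complex_of_real ((cmod c)^2) * qform T x"
proof -
  have "cnj c * c = complex_of_real ((cmod c)^2)"
    by (metis complex_norm_square mult.commute)
  then show ?thesis
    using assms(2) by (simp add: qform_def bounded_op_cmult[OF assms(1)] l2inner_scale_left l2inner_scale_right flip: mult.assoc)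
qed

lemma qform_parallelogram:
  assumes T: "hermitian_op T" and u: "u \<in> l2" and v: "v \<in> l2"
  shows "Re (qform T (u + v)) + Re (qform T (u - v)) = 2 * Re (qform T u) + 2 * Re (qform T v)"
proof -
  have b: "bounded_op T" using T by (rule hermitian_bounded)
  have "T (- v) = - T v" using bounded_op_minus[OF b, of 0 v] bounded_op_minus[OF b, of 0 0] v by simp
  then have "Re (qform T (u + - v)) = Re (qform T u) - 2 * Re (l2inner u (T v)) + Re (qform T v)"
    using v by (subst qform_vec_add[OF T u]) (auto simp: qform_def)
  then show ?thesis using qform_vec_add[OF T u v] by simp
qed

text \<open>The vectors chosen below nearly minimise \<open>qform (Q N) + norm\<^sup>2\<close> on the hyperplane \<open>z i = 1\<close>; by the
  parallelogram law and monotonicity in \<open>N\<close> they form a Cauchy sequence, and the limit works for all \<open>N\<close>.\<close>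

lemma bounded_forms_common_vector:
  fixes Q :: "nat \<Rightarrow> 'a op"
  assumes Q: "\<And>N. positive_op (Q N)"
    and mono: "\<And>N K z. N \<le> K \<Longrightarrow> z \<in> l2 \<Longrightarrow> Re (qform (Q N) z) \<le> Re (qform (Q K) z)"
    and ex: "\<And>N. \<exists>z\<in>l2. Re (qform (Q N) z) + (l2norm z)^2 < B * (cmod (z i))^2"
  shows "\<exists>w\<in>l2. w i = 1 \<and> (\<forall>N. Re (qform (Q N) w) \<le> B + 1)"
proof -
  define g where "g N z = Re (qform (Q N + id_op) z)" for N z
  have pos: "positive_op (Q N + id_op)" for N using Q by simp
  have herm: "hermitian_op (Q N + id_op)" for N using pos by (rule positive_imp_hermitian)
  have geq: "g N z = Re (qform (Q N) z) + (l2norm z)^2" if "z \<in> l2" for N z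
    using that positive_bounded[OF Q] by (simp add: g_def qform_add qform_id)
  have q0: "0 \<le> Re (qform (Q N) z)" if "z \<in> l2" for N z using Q that by (simp add: positive_op_iff)
  have g0: "0 \<le> g N z" if "z \<in> l2" for N z using geq[OF that] q0[OF that] by simp
  have gmono: "g N z \<le> g K z" if "N \<le> K" "z \<in> l2" for N K z
    using geq[OF that(2)] mono[OF that] by simp
  have gscale: "g N (\<lambda>j. c * z j) = (cmod c)^2 * g N z" if "z \<in> l2" for N c z
    using qform_vec_scale[OF positive_bounded[OF pos] that] by (simp add: g_def)
  define H where "H = {z \<in> (l2 :: 'a vec set). z i = 1}"
  define m where "m N = Inf (g N ` H)" for N
  have bdd: "bdd_below (g N ` H)" for N using g0 by (intro bdd_belowI2[where m = 0]) (auto simp: H_def)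
  have mle: "m N \<le> g N z" if "z \<in> H" for N z
    unfolding m_def using that bdd by (intro cInf_lower) auto
  have He: "std_basis i \<in> H" by (simp add: H_def) (simp add: std_basis_def)
  have Hne: "g N ` H \<noteq> {}" for N using He by blast
  \<comment> \<open>The hypothesis is homogeneous in \<open>z\<close>, and the strict inequality
    forces \<open>z i \<noteq> 0\<close>; dividing by \<open>z i\<close> lands in the
    hyperplane.\<close>
  have mB: "m N \<le> B" for N
  proof -
    obtain z where z: "z \<in> l2" "Re (qform (Q N) z) + (l2norm z)^2 < B * (cmod (z i))^2" using ex by blast
    have "0 \<le> Re (qform (Q N) z) + (l2norm z)^2" using q0[OF z(1)] by simp
    then have zi: "z i \<noteq> 0" using z(2) by auto
    let ?w = "\<lambda>j. (1 / z i) * z j"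
    have "?w \<in> l2" by (rule l2_scale[OF z(1)])
    moreover have "?w i = 1" using zi by simp
    ultimately have "?w \<in> H" by (simp only: H_def mem_Collect_eq)
    then have "m N \<le> g N ?w" by (rule mle)
    also have "\<dots> = g N z / (cmod (z i))^2"
      using gscale[OF z(1), of N "1 / z i"] by (simp add: norm_divide power_divide)
    also have "\<dots> \<le> B" using z(2) geq[OF z(1)] zi by (simp add: divide_le_eq)
    finally show ?thesis .
  qed
  have mmono: "m N \<le> m K" if "N \<le> K" for N K
    unfolding m_def[of K]
  proof (rule cInf_greatest[OF Hne])
    fix y assume "y \<in> g K ` H"
    then obtain z where z: "z \<in> H" "y = g K z" by blast
    then show "m N \<le> y" using mle[OF z(1), of N] gmono[OF that, of z] by (simp add: H_def)
  qed
  have "\<exists>z\<in>H. g N z < m N + 1 / real (Suc N)" for N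
  proof -
    have "Inf (g N ` H) < m N + 1 / real (Suc N)" by (simp add: m_def)
    from cInf_lessD[OF Hne this] show ?thesis by blast
  qed
  then obtain z where z: "\<And>N. z N \<in> H" and zg: "\<And>N. g N (z N) < m N + 1 / real (Suc N)" by metis
  have zl: "z N \<in> l2" for N using z by (simp add: H_def)
  have "bdd_above (range m)" using mB by (intro bdd_aboveI2)
  then have mlim: "m \<longlonglongrightarrow> (SUP N. m N)" using mmono by (intro LIMSEQ_incseq_SUP) (auto simp: incseq_def)
  define L where "L = (SUP N. m N)"
  have mL: "m N \<le> L" for N unfolding L_def using \<open>bdd_above (range m)\<close> by (intro cSUP_upper) auto
  \<comment> \<open>The first term is the remaining growth of the minima, the second the slack by
    which the chosen vectors miss them.\<close>
  define d where "d N = 2 * (L - m N) + 4 / real (Suc N)" for N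
  have dist: "(l2norm (z N - z K))^2 \<le> d N" if NK: "N \<le> K" for N K
  proof -
    \<comment> \<open>The midpoint stays in the hyperplane, so it cannot beat the minimum
      \<open>m N\<close>; this is the lower bound fed into the parallelogram law.\<close>
    let ?u = "\<lambda>j. (1/2) * (z N + z K) j"
    have "?u \<in> l2" by (rule l2_scale[OF l2_add[OF zl zl]])
    moreover have "?u i = 1" using z[of N] z[of K] by (simp add: H_def)
    ultimately have "?u \<in> H" by (simp add: H_def)
    then have "m N \<le> g N ?u" by (rule mle)
    also have "g N ?u = (1/4) * g N (z N + z K)"
      unfolding gscale[OF l2_add[OF zl zl]] by (simp add: power2_eq_square)
    finally have 1: "4 * m N \<le> g N (z N + z K)" by simp
    have "(l2norm (z N - z K))^2 \<le> g N (z N - z K)" using geq[of "z N - z K"] q0[of "z N - z K"] zl by simp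
    also have "\<dots> = 2 * g N (z N) + 2 * g N (z K) - g N (z N + z K)"
      using qform_parallelogram[OF herm zl zl, of N N K] by (simp add: g_def)
    also have "\<dots> \<le> 2 * g N (z N) + 2 * g K (z K) - 4 * m N"
      using 1 gmono[OF NK zl, of K] by simp
    also have "\<dots> \<le> 2 * (m N + 1 / real (Suc N)) + 2 * (m K + 1 / real (Suc K)) - 4 * m N"
      using less_imp_le[OF zg[of N]] less_imp_le[OF zg[of K]]
      by (intro diff_right_mono add_mono mult_left_mono) simp_all
    also have "\<dots> \<le> d N"
    proof -
      have "1 / real (Suc K) \<le> 1 / real (Suc N)" using NK by (simp add: frac_le)
      then show ?thesis using mL[of K] unfolding d_def by (simp add: algebra_simps)
    qed
    finally show ?thesis .
  qed
  have "(\<lambda>N. 2 * (L - m N) + 4 * (1 / real (Suc N))) \<longlonglongrightarrow> 2 * (L - L) + 4 * 0"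
    using mlim[folded L_def] LIMSEQ_inverse_real_of_nat by (intro tendsto_intros) (auto simp: inverse_eq_divide)
  then have dlim: "d \<longlonglongrightarrow> 0" by (simp add: d_def[abs_def])
  obtain w where w: "w \<in> l2" "(\<lambda>N. l2norm (z N - w)) \<longlonglongrightarrow> 0"
  proof (rule l2_complete[OF zl])
    fix e :: real assume e: "e > 0"
    then have "eventually (\<lambda>N. d N < e^2) sequentially" using dlim by (intro order_tendstoD(2)) auto
    then obtain N where N: "\<And>n. n \<ge> N \<Longrightarrow> d n < e^2" unfolding eventually_sequentially by blast
    have *: "l2norm (z a - z b) \<le> e" if "N \<le> a" "a \<le> b" for a b
    proof (rule power2_le_imp_le)
      show "(l2norm (z a - z b))^2 \<le> e^2" using dist[OF that(2)] N[OF that(1)] by simp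
    qed (use e in simp)
    have "l2norm (z a - z b) \<le> e" if "N \<le> a" "N \<le> b" for a b
      using *[of a b] *[of b a] that l2norm_minus_commute[of "z a" "z b"] by (cases "a \<le> b") auto
    then show "\<exists>N. \<forall>m\<ge>N. \<forall>n\<ge>N. l2norm (z m - z n) \<le> e" by blast
  qed
  have "w i = 1"
  proof -
    have "cmod (1 - w i) \<le> l2norm (z N - w)" for N
      using cmod_le_l2norm[of "z N - w" i] zl w(1) z[of N] by (simp add: H_def)
    then have "cmod (1 - w i) \<le> 0" using LIMSEQ_le_const[OF w(2)] by blast
    then show ?thesis by simp
  qed
  moreover have "Re (qform (Q N) w) \<le> B + 1" for N
  proof -
    let ?C = "l2norm (Q N w)"
    have hQ: "hermitian_op (Q N)" using Q by (rule positive_imp_hermitian)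
    have bQ: "bounded_op (Q N)" using Q by (rule positive_bounded)
    \<comment> \<open>Expand \<open>z K = (z K - w) + w\<close> and drop the nonnegative form at
      \<open>z K - w\<close>; the mixed term vanishes in the limit. The \<open>1\<close> in
      \<open>B + 1\<close> bounds the slack \<open>1 / Suc K\<close>.\<close>
    have "Re (qform (Q N) w) \<le> B + 1 + 2 * (l2norm (z K - w) * ?C)" if K: "K \<ge> N" for K
    proof -
      have zw: "z K - w \<in> l2" using zl w(1) by simp
      have "z K = (z K - w) + w" by simp
      then have "Re (qform (Q N) (z K)) = Re (qform (Q N) (z K - w)) + 2 * Re (l2inner (z K - w) (Q N w)) + Re (qform (Q N) w)"
        using qform_vec_add[OF hQ zw w(1)] by simp
      moreover have "\<bar>Re (l2inner (z K - w) (Q N w))\<bar> \<le> l2norm (z K - w) * ?C"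
        using l2_Cauchy_Schwarz[OF zw bounded_op_l2[OF bQ w(1)]] abs_Re_le_cmod order.trans by blast
      moreover have "Re (qform (Q N) (z K)) \<le> B + 1"
      proof -
        have "Re (qform (Q N) (z K)) \<le> g K (z K)"
          using geq[OF zl, of K K] mono[OF K zl, of K] by (smt (verit) zero_le_power2)
        also have "\<dots> \<le> m K + 1 / real (Suc K)" using zg[of K] by simp
        also have "\<dots> \<le> B + 1" using mB[of K] by (intro add_mono) auto
        finally show ?thesis .
      qed
      ultimately show ?thesis using q0[OF zw, of N] by linarith
    qed
    moreover have "(\<lambda>K. B + 1 + 2 * (l2norm (z K - w) * ?C)) \<longlonglongrightarrow> B + 1 + 2 * (0 * ?C)"
      using w(2) by (intro tendsto_intros)
    ultimately have "Re (qform (Q N) w) \<le> B + 1 + 2 * (0 * ?C)"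
      using LIMSEQ_le_const[of _ _ "Re (qform (Q N) w)"] by blast
    then show ?thesis by simp
  qed
  ultimately show ?thesis using w(1) by blast
qed

text \<open>A set closed under the nonzero entries of \<open>T\<close> reduces \<open>T\<close>: by
  symmetry no entry leads back into it, so the mixed term vanishes.\<close>

lemma qform_block_split:
  assumes T: "hermitian_op T" and c: "\<And>i j. i \<in> c \<Longrightarrow> T (std_basis i) j \<noteq> 0 \<Longrightarrow> j \<in> c"
    and x: "x \<in> l2"
  shows "Re (qform T x) = Re (qform T (restrict_vec c x)) + Re (qform T (restrict_vec (- c) x))"
proof -
  let ?y = "restrict_vec c x" and ?z = "restrict_vec (- c) x"
  have l: "?y \<in> l2" "?z \<in> l2" using x by auto
  have "T ?z i = 0" if i: "i \<in> c" for i
  proof -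
    have "T ?z i = l2inner (T (std_basis i)) ?z"
      using hermitian_op_swap[OF T std_basis_l2 l(2), of i] by simp
    also have "\<dots> = 0"
      unfolding l2inner_def by (rule infsum_0) (use c[OF i] in \<open>auto simp: restrict_vec_def\<close>)
    finally show ?thesis .
  qed
  then have "l2inner ?y (T ?z) = 0"
    unfolding l2inner_def by (intro infsum_0) (auto simp: restrict_vec_def)
  then show ?thesis using qform_vec_add[OF T l] by (simp flip: restrict_vec_split)
qed

text \<open>Bounds at single coordinates do not add up in general. Here the points of
  \<open>E\<close> lie in different blocks and the form splits along blocks, so peeling off one
  block at a time adds the bounds, giving \<open>B\<close> times the projection onto
  \<open>E\<close> below \<open>T\<close>.\<close>

lemma transversal_form_bound:
  fixes r :: "('a \<times> 'a) set"
  assumes T: "positive_op T" and r: "\<And>i j. T (std_basis i) j \<noteq> 0 \<Longrightarrow> (i, j) \<in> r\<^sup>*" and sym: "sym r"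
    and tr: "\<And>i j. i \<in> E \<Longrightarrow> j \<in> E \<Longrightarrow> (i, j) \<in> r\<^sup>* \<Longrightarrow> i = j"
    and B: "B > 0"
    and E: "\<And>i z. i \<in> E \<Longrightarrow> z \<in> l2 \<Longrightarrow> B * (cmod (z i))^2 \<le> Re (qform T z)"
    and x: "x \<in> l2"
  shows "B * (l2norm (restrict_vec E x))^2 \<le> Re (qform T x)"
proof -
  have fin: "B * (\<Sum>i\<in>F. (cmod (x i))^2) \<le> Re (qform T x)" if "finite F" "F \<subseteq> E" "x \<in> l2" for F x
    using that
  proof (induction F arbitrary: x)
    case empty
    then show ?case using T by (simp add: positive_op_iff)
  next
    case (insert i F)
    let ?c = "r\<^sup>* `` {i}"
    let ?y = "restrict_vec ?c x" and ?z = "restrict_vec (- ?c) x"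
    have "j \<in> ?c" if "k \<in> ?c" "T (std_basis k) j \<noteq> 0" for k j
      using that r[OF that(2)] by (auto intro: rtrancl_trans)
    then have split: "Re (qform T x) = Re (qform T ?y) + Re (qform T ?z)"
      using insert.prems positive_imp_hermitian[OF T] by (intro qform_block_split) auto
    have "j \<notin> ?c" if "j \<in> F" for j
      using tr[of i j] that insert by auto
    then have "(\<Sum>j\<in>F. (cmod (?z j))^2) = (\<Sum>j\<in>F. (cmod (x j))^2)"
      by (intro sum.cong) (auto simp: restrict_vec_def)
    moreover have "B * (\<Sum>j\<in>F. (cmod (?z j))^2) \<le> Re (qform T ?z)"
      using insert by auto
    moreover have "B * (cmod (?y i))^2 \<le> Re (qform T ?y)" using insert.prems by (intro E) auto
    moreover have "?y i = x i" by (simp add: restrict_vec_def)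
    ultimately show ?case using split insert.hyps by (simp add: distrib_left)
  qed
  have "(\<Sum>i\<in>F. (cmod (restrict_vec E x i))^2) \<le> Re (qform T x) / B" if F: "finite F" for F
  proof -
    have "(\<Sum>i\<in>F. (cmod (restrict_vec E x i))^2) = (\<Sum>i\<in>F \<inter> E. (cmod (x i))^2)"
      using F by (intro sum.mono_neutral_cong_right) (auto simp: restrict_vec_def)
    also have "\<dots> \<le> Re (qform T x) / B"
      using fin[of "F \<inter> E" x] F x B by (simp add: pos_le_divide_eq mult.commute)
    finally show ?thesis .
  qed
  then have "(l2norm (restrict_vec E x))^2 \<le> Re (qform T x) / B" by (rule l2_bounded_sums(2))
  then show ?thesis using B by (simp add: pos_le_divide_eq mult.commute)
qed

text \<open>If every nonzero vector made the partial sums unbounded, each point of a transversal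
  would eventually satisfy the coordinate bound with any prescribed \<open>B\<close>. The state,
  which sees partial sums of size at most \<open>2\<close>, then forces every transversal to be
  null.\<close>

lemma summable_forms_common_vector:
  fixes h :: "nat \<Rightarrow> 'a op"
  assumes \<phi>: "state \<phi>" and \<mu>: "total_prob \<mu>" and \<mu>\<phi>: "\<And>A. \<mu> A = Re (\<phi> (diag_proj A))"
    and h: "\<And>k. positive_op (h k)" and bd: "\<And>N. Re (\<phi> (\<Sum>k<N. h k)) \<le> 2"
  shows "\<exists>x\<in>l2. x \<noteq> 0 \<and> (\<exists>C. \<forall>N. Re (qform (\<Sum>k<N. h k) x) \<le> C)"
proof (rule ccontr)
  assume none: "\<not> ?thesis"
  interpret total_prob \<mu> by (rule \<mu>)
  define Q where "Q N = (\<Sum>k<N. h k)" for N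
  have Q: "positive_op (Q N)" for N unfolding Q_def using h by (intro positive_op_sum)
  have qQ: "Re (qform (Q N) z) = (\<Sum>k<N. Re (qform (h k) z))" if "z \<in> l2" for N z
    unfolding Q_def using positive_bounded[OF h] by (simp add: qform_sum[OF that])
  have mono: "Re (qform (Q N) z) \<le> Re (qform (Q K) z)" if "N \<le> K" "z \<in> l2" for N K z
    unfolding qQ[OF that(2)] using that h by (intro sum_mono2) (auto simp: positive_op_iff)
  define r where "r = {(i, j). \<exists>k. h k (std_basis i) j \<noteq> 0}"
  have sym: "sym r"
  proof (rule symI)
    fix i j assume "(i, j) \<in> r"
    then obtain k where "h k (std_basis i) j \<noteq> 0" by (auto simp: r_def)
    then have "h k (std_basis j) i \<noteq> 0"
      using hermitian_entry_swap[OF positive_imp_hermitian[OF h], of k i j] by auto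
    then show "(j, i) \<in> r" by (auto simp: r_def)
  qed
  have cnt: "countable (r `` {i})" for i
  proof -
    have "r `` {i} = (\<Union>k. {j. h k (std_basis i) j \<noteq> 0})" by (auto simp: r_def)
    moreover have "countable {j. h k (std_basis i) j \<noteq> 0}" for k
      by (rule l2_countable_support[OF bounded_op_l2[OF positive_bounded[OF h] std_basis_l2]])
    ultimately show ?thesis by auto
  qed
  obtain A :: "nat \<Rightarrow> 'a set" where A: "(\<Union>n. A n) = UNIV"
    "\<And>n i j. i \<in> A n \<Longrightarrow> j \<in> A n \<Longrightarrow> (i, j) \<in> r\<^sup>* \<Longrightarrow> i = j"
    using component_transversals[OF sym cnt] by metis
  have "\<mu> (A n) = 0" for n
  proof (rule ccontr)
    assume "\<mu> (A n) \<noteq> 0"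
    then have An: "\<mu> (A n) > 0" using nonneg[of "A n"] by simp
    \<comment> \<open>\<open>\<phi>\<close> is at most \<open>2 + 1\<close> on \<open>T N\<close>,
      while \<open>B * \<mu> (E N)\<close> tends to \<open>B * \<mu> (A n) = 4\<close>.\<close>
    define B where "B = 4 / \<mu> (A n)"
    have B: "B > 0" using An by (simp add: B_def)
    \<comment> \<open>The added identity supplies the squared norm that keeps minimising vectors
      under control in \<open>bounded_forms_common_vector\<close>; it costs only \<open>1\<close>
      under \<open>\<phi>\<close>.\<close>
    define T where "T N = Q N + id_op" for N
    have T: "positive_op (T N)" for N using Q by (simp add: T_def)
    have qT: "Re (qform (T N) z) = Re (qform (Q N) z) + (l2norm z)^2" if "z \<in> l2" for N z
      using that positive_bounded[OF Q] by (simp add: T_def qform_add qform_id)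
    have Tr: "(i, j) \<in> r\<^sup>*" if "T N (std_basis i) j \<noteq> 0" for N i j
    proof (cases "i = j")
      case False
      have "id_op (std_basis i) j = 0" using False by (simp add: id_op_def) (simp add: std_basis_def)
      then have "Q N (std_basis i) j \<noteq> 0" using that by (simp add: T_def)
      then have "(\<Sum>k<N. h k (std_basis i) j) \<noteq> 0" by (simp add: Q_def sum_vec_apply)
      then obtain k where "h k (std_basis i) j \<noteq> 0" by (meson sum.neutral)
      then show ?thesis by (auto simp: r_def)
    qed simp
    define E where "E N = {i \<in> A n. \<forall>z\<in>l2. B * (cmod (z i))^2 \<le> Re (qform (T N) z)}" for N
    have bound: "B * \<mu> (E N) \<le> 3" for N
    proof -
      let ?W = "T N - op_scale (complex_of_real B) (diag_proj (E N))"
      have bT: "bounded_op (T N)" using T by (rule positive_bounded)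
      have "positive_op ?W"
        unfolding positive_op_iff
      proof (intro conjI ballI)
        fix x :: "'a vec" assume x: "x \<in> l2"
        have q: "qform ?W x = qform (T N) x - complex_of_real (B * (l2norm (restrict_vec (E N) x))^2)"
          using x bT by (simp add: qform_diff qform_scale qform_diag_proj)
        show "Im (qform ?W x) = 0" unfolding q using T[of N] x by (simp add: positive_op_iff)
        have "B * (l2norm (restrict_vec (E N) x))^2 \<le> Re (qform (T N) x)"
          by (rule transversal_form_bound[OF T Tr sym _ B _ x]) (auto simp: E_def intro: A(2))
        then show "0 \<le> Re (qform ?W x)" unfolding q by simp
      qed (use bT in simp)
      then have "0 \<le> Re (\<phi> ?W)" by (rule state_pos[OF \<phi>])
      also have "\<phi> ?W = \<phi> (Q N) + 1 - complex_of_real B * \<phi> (diag_proj (E N))"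
        using \<phi> positive_bounded[OF Q, of N] by (simp add: T_def state_diff state_add state_scale state_id)
      finally show ?thesis using bd[of N] by (simp add: \<mu>\<phi> Q_def)
    qed
    have inc: "incseq E"
    proof (rule incseq_SucI, rule subsetI)
      fix N i assume i: "i \<in> E N"
      have "Re (qform (T N) z) \<le> Re (qform (T (Suc N)) z)" if "z \<in> l2" for z
        using qT[OF that] mono[of N "Suc N" z] that by simp
      then show "i \<in> E (Suc N)" using i by (auto simp: E_def intro: order.trans)
    qed
    have "(\<Union>N. E N) = A n"
    proof (intro equalityI subsetI)
      fix i assume i: "i \<in> A n"
      show "i \<in> (\<Union>N. E N)"
      proof (rule ccontr)
        assume "i \<notin> (\<Union>N. E N)"
        then have "\<exists>z\<in>l2. Re (qform (T N) z) < B * (cmod (z i))^2" for N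
          using i by (auto simp: E_def not_le)
        then have small: "\<exists>z\<in>l2. Re (qform (Q N) z) + (l2norm z)^2 < B * (cmod (z i))^2" for N
          using qT by metis
        have "\<exists>w\<in>l2. w i = 1 \<and> (\<forall>N. Re (qform (Q N) w) \<le> B + 1)"
          by (rule bounded_forms_common_vector[where Q = Q, OF Q mono small])
        then obtain w where w: "w \<in> l2" "w i = 1" "\<forall>N. Re (qform (\<Sum>k<N. h k) w) \<le> B + 1"
          unfolding Q_def by (elim bexE conjE)
        have "w \<noteq> 0" using w(2) by auto
        then have "w \<noteq> 0 \<and> (\<exists>C. \<forall>N. Re (qform (\<Sum>k<N. h k) w) \<le> C)" using w(3) by (intro conjI exI)
        then show False using none w(1) by (meson bexI)
      qed
    qed (auto simp: E_def)
    moreover have "(\<lambda>N. measure M (E N)) \<longlonglongrightarrow> measure M (\<Union>N. E N)"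
      using inc by (intro finite_Lim_measure_incseq) auto
    ultimately have "(\<lambda>N. \<mu> (E N)) \<longlonglongrightarrow> \<mu> (A n)" by (simp add: measure_M)
    then have "(\<lambda>N. B * \<mu> (E N)) \<longlonglongrightarrow> B * \<mu> (A n)" by (intro tendsto_intros)
    then have "B * \<mu> (A n) \<le> 3" using bound LIMSEQ_le_const2 by blast
    then show False using An by (simp add: B_def)
  qed
  then have "\<mu> (\<Union>n. A n) = 0" using null_sets_UN[of A M] by (simp add: null_iff)
  then show False using A(1) whole by simp
qed

lemma pure_state_vector:
  fixes S :: "nat \<Rightarrow> 'a set"
  assumes pure: "pure_state \<phi>" and \<mu>: "total_prob \<mu>" and \<mu>\<phi>: "\<And>A. \<mu> A = Re (\<phi> (diag_proj A))"
  shows "\<exists>x\<in>l2. x \<noteq> 0 \<and> (\<forall>n. (l2norm (restrict_vec (S n) x))^2 = \<mu> (S n) * (l2norm x)^2)"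
proof -
  have \<phi>: "state \<phi>" using pure by (simp add: pure_state_def)
  \<comment> \<open>Every set of the sequence is listed infinitely often, so it is tested by
    majorants of arbitrarily small cost.\<close>
  define s where "s k = S (fst (prod_decode k))" for k
  have "\<exists>h. positive_op h \<and> Re (\<phi> h) \<le> (1/4)^k \<and> (\<forall>x\<in>l2.
      \<bar>(l2norm (restrict_vec (s k) x))^2 - \<mu> (s k) * (l2norm x)^2\<bar> \<le> Re (qform h x))" for k :: nat
    unfolding \<mu>\<phi> by (rule pure_state_local[OF pure]) simp
  then obtain h where h: "\<And>k. positive_op (h k)" and h\<phi>: "\<And>k. Re (\<phi> (h k)) \<le> (1/4)^k"
    and hq: "\<And>k x. x \<in> l2 \<Longrightarrow>
      \<bar>(l2norm (restrict_vec (s k) x))^2 - \<mu> (s k) * (l2norm x)^2\<bar> \<le> Re (qform (h k) x)"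
    by metis
  \<comment> \<open>Costs \<open>(1/4)^k\<close> leave room for weights \<open>2^k\<close>: the
    total cost stays below \<open>2\<close>, and a bound \<open>C\<close> on the weighted form at
    \<open>x\<close> makes the form of \<open>h k\<close> at most
    \<open>C * (1/2)^k\<close>.\<close>
  define g where "g k = op_scale (complex_of_real (2^k)) (h k)" for k
  have g: "positive_op (g k)" for k unfolding g_def by (rule positive_op_scale[OF h]) simp
  have "Re (\<phi> (\<Sum>k<N. g k)) \<le> 2" for N
  proof -
    have "Re (\<phi> (\<Sum>k<N. g k)) = (\<Sum>k<N. 2^k * Re (\<phi> (h k)))"
    proof -
      have "\<phi> (\<Sum>k<N. g k) = (\<Sum>k<N. \<phi> (g k))"
        by (rule state_sum[OF \<phi>]) (rule positive_bounded[OF g])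
      moreover have "\<phi> (g k) = complex_of_real (2^k) * \<phi> (h k)" for k
        unfolding g_def by (rule state_scale[OF \<phi> positive_bounded[OF h]])
      ultimately show ?thesis by (simp only: Re_sum Re_complex_of_real times_complex.sel Im_complex_of_real) simp
    qed
    also have "\<dots> \<le> (\<Sum>k<N. 2^k * (1/4)^k)" using h\<phi> by (intro sum_mono mult_left_mono) auto
    also have "\<dots> = (\<Sum>k<N. (1/2)^k)" by (simp flip: power_mult_distrib)
    also have "\<dots> \<le> 2" by (simp add: sum_gp_strict)
    finally show ?thesis .
  qed
  from summable_forms_common_vector[OF \<phi> \<mu> \<mu>\<phi> g this]
  obtain x C where x: "x \<in> l2" "x \<noteq> 0" and C: "\<And>N. Re (qform (\<Sum>k<N. g k) x) \<le> C" by blast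
  have hC: "Re (qform (h k) x) \<le> C * (1/2)^k" for k
  proof -
    have "Re (qform (g k) x) \<le> (\<Sum>k<Suc k. Re (qform (g k) x))"
      using g x(1) by (intro member_le_sum) (auto simp: positive_op_iff)
    also have "\<dots> = Re (qform (\<Sum>k<Suc k. g k) x)"
      using positive_bounded[OF g] by (simp only: qform_sum[OF x(1)] Re_sum)
    also have "\<dots> \<le> C" by (rule C)
    finally show ?thesis by (simp add: g_def qform_scale field_simps)
  qed
  have "(l2norm (restrict_vec (S n) x))^2 = \<mu> (S n) * (l2norm x)^2" for n
  proof -
    let ?d = "\<bar>(l2norm (restrict_vec (S n) x))^2 - \<mu> (S n) * (l2norm x)^2\<bar>"
    have C0: "0 \<le> C" using C[of 0] by simp
    have "?d \<le> C * (1/2)^m" for m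
    proof -
      \<comment> \<open>The \<open>m\<close>-th occurrence of \<open>S n\<close> has position at
        least \<open>m\<close>, so the deviation of this one set is below \<open>C * (1/2)^m\<close>
        for all \<open>m\<close>.\<close>
      let ?k = "prod_encode (n, m)"
      have "?d \<le> C * (1/2)^?k" using hq[OF x(1), of ?k] hC[of ?k] by (simp add: s_def)
      also have "\<dots> \<le> C * (1/2)^m"
        using le_prod_encode_2[of m n] C0 by (intro mult_left_mono power_decreasing) auto
      finally show ?thesis .
    qed
    moreover have "(\<lambda>m. C * (1/2)^m) \<longlonglongrightarrow> C * 0" by (intro tendsto_intros LIMSEQ_power_zero) simp
    ultimately have "?d \<le> C * 0" using LIMSEQ_le_const by blast
    then show ?thesis by simp
  qed
  then show ?thesis using x by blast
qed

section \<open>Atoms\<close>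

text \<open>If no atom exists, split each set greedily, removing at least half of the largest possible
  smaller piece. Along every branch the measures tend to \<open>0\<close>, since otherwise the intersection of the
  branch would be splittable; but a branch through the support of the vector has measures bounded below.\<close>

lemma (in total_prob) atom_exists:
  assumes vec: "\<And>S :: nat \<Rightarrow> 'a set. \<exists>x\<in>l2. x \<noteq> 0 \<and>
      (\<forall>n. (l2norm (restrict_vec (S n) x))^2 = \<mu> (S n) * (l2norm x)^2)"
  shows "\<exists>A. \<mu> A > 0 \<and> (\<forall>B\<subseteq>A. \<mu> B = 0 \<or> \<mu> B = \<mu> A)"
proof (rule ccontr)
  assume noatom: "\<not> ?thesis"
  \<comment> \<open>The best size of the smaller half over all ways to cut \<open>A\<close> in
    two.\<close>
  define v where "v A = Sup ((\<lambda>B. min (\<mu> B) (\<mu> (A - B))) ` Pow A)" for A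
  have bdd: "bdd_above ((\<lambda>B. min (\<mu> B) (\<mu> (A - B))) ` Pow A)" for A
    using meas_mono whole by (intro bdd_aboveI2[where M = 1]) (metis min.coboundedI1 subset_UNIV)
  have vge: "min (\<mu> B) (\<mu> (A - B)) \<le> v A" if "B \<subseteq> A" for A B
    unfolding v_def using that bdd by (intro cSup_upper) auto
  have "\<exists>B\<subseteq>A. v A / 2 \<le> min (\<mu> B) (\<mu> (A - B))" for A
  proof (cases "v A > 0")
    case True
    then have "v A / 2 < Sup ((\<lambda>B. min (\<mu> B) (\<mu> (A - B))) ` Pow A)" by (simp flip: v_def)
    then obtain y where "y \<in> (\<lambda>B. min (\<mu> B) (\<mu> (A - B))) ` Pow A" "v A / 2 < y"
      using less_cSupD[of "(\<lambda>B. min (\<mu> B) (\<mu> (A - B))) ` Pow A" "v A / 2"] by blast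
    then show ?thesis using less_imp_le by blast
  next
    case False
    then show ?thesis using nonneg by (intro exI[of _ "{}"]) (auto simp: min_def meas_empty[OF ca])
  qed
  then obtain sp where sp: "\<And>A. sp A \<subseteq> A" "\<And>A. v A / 2 \<le> min (\<mu> (sp A)) (\<mu> (A - sp A))" by metis
  \<comment> \<open>Boolean lists are countable, so all nodes can be given to \<open>vec\<close> as
    one sequence before the branch is known; the branch depends on the vector obtained. The head of
    a list is the latest choice.\<close>
  define tree where "tree = rec_list UNIV (\<lambda>b (l :: bool list) t. if b then sp t else t - sp t)"
  obtain x where x: "x \<in> l2" "x \<noteq> 0"
    and xS: "\<And>n. (l2norm (restrict_vec (tree (from_nat n)) x))^2 = \<mu> (tree (from_nat n)) * (l2norm x)^2"
    using vec[of "\<lambda>n. tree (from_nat n)"] by blast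
  have xt: "(l2norm (restrict_vec (tree l) x))^2 = \<mu> (tree l) * (l2norm x)^2" for l
    using xS[of "to_nat l"] by simp
  obtain a where a: "x a \<noteq> 0" using x(2) by (auto simp: fun_eq_iff)
  define l where "l = rec_nat [] (\<lambda>n l. (a \<in> sp (tree l)) # l)"
  define C where "C n = tree (l n)" for n
  have C0: "C 0 = UNIV" by (simp add: C_def l_def tree_def)
  have CS: "C (Suc n) = (if a \<in> sp (C n) then sp (C n) else C n - sp (C n))" for n
    by (simp add: C_def l_def tree_def)
  have aC: "a \<in> C n" for n by (induction n) (auto simp: C0 CS)
  have "C (Suc n) \<subseteq> C n" for n using sp(1)[of "C n"] by (auto simp: CS)
  then have dec: "decseq C" by (rule decseq_SucI)
  define D where "D = (\<Inter>n. C n)"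
  have lim: "(\<lambda>n. \<mu> (C n)) \<longlonglongrightarrow> \<mu> D"
    using finite_Lim_measure_decseq[OF _ dec] by (simp add: measure_M D_def)
  have xn: "l2norm x > 0" using l2norm_eq_0[OF x(1)] x(2) l2norm_nonneg[of x] by (auto simp: less_le)
  have lower: "(cmod (x a))^2 / (l2norm x)^2 \<le> \<mu> (C n)" for n
  proof -
    have "cmod (restrict_vec (C n) x a) \<le> l2norm (restrict_vec (C n) x)"
      using x(1) by (intro cmod_le_l2norm) simp
    then have "(cmod (x a))^2 \<le> (l2norm (restrict_vec (C n) x))^2"
      using aC[of n] by (intro power_mono) (auto simp: restrict_vec_def)
    also have "\<dots> = \<mu> (C n) * (l2norm x)^2" unfolding C_def by (rule xt)
    finally show ?thesis using xn by (simp add: divide_le_eq)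
  qed
  have "(cmod (x a))^2 / (l2norm x)^2 \<le> \<mu> D"
    by (rule LIMSEQ_le_const[OF lim]) (use lower in blast)
  moreover have "(cmod (x a))^2 / (l2norm x)^2 > 0" using a xn by simp
  ultimately have "\<mu> D > 0" by linarith
  then obtain B where B: "B \<subseteq> D" "\<mu> B \<noteq> 0" "\<mu> B \<noteq> \<mu> D" using noatom by blast
  have "\<mu> (B \<union> (D - B)) = \<mu> B + \<mu> (D - B)" by (rule meas_Un) auto
  moreover have "B \<union> (D - B) = D" using B(1) by auto
  ultimately have "\<mu> (D - B) \<noteq> 0" using B(3) by simp
  \<comment> \<open>Every \<open>C n\<close> contains \<open>D\<close>, so it can be cut into
    \<open>B\<close> and the rest with both halves at least \<open>\<eta>\<close>. The greedy cut
    thus removes at least \<open>\<eta> / 2\<close> at each step, whichever half contains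
    \<open>a\<close>.\<close>
  define \<eta> where "\<eta> = min (\<mu> B) (\<mu> (D - B))"
  have \<eta>: "\<eta> > 0" unfolding \<eta>_def using B(2) \<open>\<mu> (D - B) \<noteq> 0\<close> nonneg[of B] nonneg[of "D - B"] by simp
  have drop: "\<mu> (C (Suc n)) \<le> \<mu> (C n) - \<eta> / 2" for n
  proof -
    have DC: "D \<subseteq> C n" by (auto simp: D_def)
    have "\<mu> (D - B) \<le> \<mu> (C n - B)" using DC by (intro meas_mono) auto
    then have "\<eta> \<le> min (\<mu> B) (\<mu> (C n - B))" unfolding \<eta>_def by auto
    also have "\<dots> \<le> v (C n)" using B(1) DC by (intro vge) auto
    finally have *: "\<eta> / 2 \<le> min (\<mu> (sp (C n))) (\<mu> (C n - sp (C n)))" using sp(2)[of "C n"] by linarith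
    have "\<mu> (sp (C n) \<union> (C n - sp (C n))) = \<mu> (sp (C n)) + \<mu> (C n - sp (C n))" by (rule meas_Un) auto
    moreover have "sp (C n) \<union> (C n - sp (C n)) = C n" using sp(1)[of "C n"] by auto
    ultimately show ?thesis using * by (auto simp: CS)
  qed
  have le: "\<mu> (C n) \<le> 1 - real n * (\<eta> / 2)" for n
  proof (induction n)
    case (Suc n)
    then show ?case using drop[of n] by (simp add: algebra_simps add_divide_distrib)
  qed (simp add: C0 whole)
  have "\<exists>n. 1 < real n * (\<eta> / 2)"
    by (rule reals_Archimedean3[rule_format]) (use \<eta> in simp)
  then obtain n where "1 < real n * (\<eta> / 2)" ..
  then show False using le[of n] nonneg[of "C n"] by linarith
qed

section \<open>From states to measures\<close>

definition state_meas :: "('a op \<Rightarrow> complex) \<Rightarrow> 'a set \<Rightarrow> real" where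
  "state_meas \<phi> A = Re (\<phi> (diag_proj A))"

lemma state_meas_prob: "state \<phi> \<Longrightarrow> probability_meas (state_meas \<phi>)"
  by (simp add: probability_meas_def state_meas_def state_pos state_id flip: id_op_eq_diag_proj)

lemma state_meas_vanishes:
  assumes "singular_state \<phi>" shows "vanishes_on_singletons (state_meas \<phi>)"
proof -
  have "diag_proj {a} = rank_one_proj (std_basis a)" for a :: 'a
    by (intro ext, simp add: diag_proj_def rank_one_proj_def restrict_vec_def) (simp add: std_basis_def)
  then show ?thesis
    using assms by (simp add: vanishes_on_singletons_def state_meas_def singular_state_def)
qed

lemma state_meas_countably_additive:
  assumes "countably_additive_state \<phi>" shows "countably_additive_meas (state_meas \<phi>)"
  unfolding countably_additive_meas_def
proof (intro allI impI)
  fix A :: "nat \<Rightarrow> 'a set" assume dis: "disjoint_family A"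
  have "((\<lambda>n. \<phi> (diag_proj (A n))) has_sum \<phi> (sot_sum (\<lambda>n. diag_proj (A n)) UNIV)) UNIV"
    using assms[unfolded countably_additive_state_def, rule_format, of "\<lambda>n. diag_proj (A n)"] dis
    by (simp add: orthogonal_diag_proj disjoint_family_on_def)
  then have "((\<lambda>n. state_meas \<phi> (A n)) has_sum state_meas \<phi> (\<Union>n. A n)) UNIV"
    unfolding sot_sum_diag_proj[OF dis] state_meas_def by (rule has_sum_Re)
  then show "(\<lambda>n. state_meas \<phi> (A n)) sums state_meas \<phi> (\<Union>n. A n)" by (rule has_sum_imp_sums)
qed

lemma state_meas_lt_kappa_additive:
  assumes "lt_kappa_additive_state \<phi>" shows "lt_kappa_additive_meas (state_meas \<phi>)"
  unfolding lt_kappa_additive_meas_def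
proof (intro allI impI, elim conjE)
  fix I :: "'a set" and A :: "'a \<Rightarrow> 'a set"
  assume I: "(card_of I, card_of (UNIV :: 'a set)) \<in> ordLess" and dis: "disjoint_family_on A I"
  have "((\<lambda>\<alpha>. \<phi> (diag_proj (A \<alpha>))) has_sum \<phi> (sot_sum (\<lambda>\<alpha>. diag_proj (A \<alpha>)) I)) I"
    using assms[unfolded lt_kappa_additive_state_def, rule_format, of I "\<lambda>\<alpha>. diag_proj (A \<alpha>)"] I dis
    by (simp add: orthogonal_diag_proj disjoint_family_on_def)
  then show "((\<lambda>\<alpha>. state_meas \<phi> (A \<alpha>)) has_sum state_meas \<phi> (\<Union>\<alpha>\<in>I. A \<alpha>)) I"
    unfolding sot_sum_diag_proj[OF dis] state_meas_def by (rule has_sum_Re)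
qed

text \<open>\<open>\<nu>\<close> is the conditional measure on one atom of
  \<open>state_meas \<phi>\<close>. Conditioning keeps whatever additivity the measure has, so the
  same \<open>\<nu>\<close> serves the Ulam case and, by the last clause, the
  \<open><\<kappa>\<close>-additive one.\<close>

lemma pure_state_two_valued:
  fixes \<phi> :: "'a op \<Rightarrow> complex"
  assumes pure: "pure_state \<phi>" and sing: "singular_state \<phi>" and ca: "countably_additive_meas (state_meas \<phi>)"
  obtains \<nu> :: "'a set \<Rightarrow> real" where "two_valued_nonzero \<nu>" "countably_additive_meas \<nu>" "vanishes_on_singletons \<nu>"
    "lt_kappa_additive_meas (state_meas \<phi>) \<Longrightarrow> lt_kappa_additive_meas \<nu>"
proof -
  let ?\<mu> = "state_meas \<phi>"
  have \<phi>: "state \<phi>" using pure by (simp add: pure_state_def)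
  have tp: "total_prob ?\<mu>" using state_meas_prob[OF \<phi>] ca by unfold_locales
  interpret total_prob ?\<mu> by (rule tp)
  obtain A where A: "?\<mu> A > 0" "\<And>B. B \<subseteq> A \<Longrightarrow> ?\<mu> B = 0 \<or> ?\<mu> B = ?\<mu> A"
    using atom_exists[OF pure_state_vector[OF pure tp state_meas_def]] by blast
  define \<nu> where "\<nu> B = ?\<mu> (B \<inter> A) / ?\<mu> A" for B
  have "\<nu> B \<in> {0, 1}" for B using A(1) A(2)[of "B \<inter> A"] by (auto simp: \<nu>_def)
  moreover have "\<nu> A \<noteq> 0" using A(1) by (simp add: \<nu>_def)
  ultimately have 1: "two_valued_nonzero \<nu>" by (auto simp: two_valued_nonzero_def)
  have 2: "countably_additive_meas \<nu>"
    unfolding countably_additive_meas_def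
  proof (intro allI impI)
    fix S :: "nat \<Rightarrow> 'a set" assume "disjoint_family S"
    then have "disjoint_family (\<lambda>n. S n \<inter> A)" by (auto simp: disjoint_family_on_def)
    then have "(\<lambda>n. ?\<mu> (S n \<inter> A)) sums ?\<mu> (\<Union>n. S n \<inter> A)"
      using ca[unfolded countably_additive_meas_def, rule_format, of "\<lambda>n. S n \<inter> A"] by simp
    then show "(\<lambda>n. \<nu> (S n)) sums \<nu> (\<Union>n. S n)"
      unfolding \<nu>_def by (intro sums_divide) (simp only: UN_simps)
  qed
  have 3: "vanishes_on_singletons \<nu>"
    unfolding vanishes_on_singletons_def
  proof
    fix a
    have "?\<mu> ({a} \<inter> A) \<le> ?\<mu> {a}" by (rule meas_mono) auto
    then show "\<nu> {a} = 0"
      using state_meas_vanishes[OF sing] nonneg[of "{a} \<inter> A"]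
      by (simp add: \<nu>_def vanishes_on_singletons_def)
  qed
  have 4: "lt_kappa_additive_meas \<nu>" if lt: "lt_kappa_additive_meas ?\<mu>"
    unfolding lt_kappa_additive_meas_def
  proof (intro allI impI, elim conjE)
    fix I :: "'a set" and S :: "'a \<Rightarrow> 'a set"
    assume I: "(card_of I, card_of (UNIV :: 'a set)) \<in> ordLess" and "disjoint_family_on S I"
    then have "disjoint_family_on (\<lambda>\<alpha>. S \<alpha> \<inter> A) I" by (auto simp: disjoint_family_on_def)
    then have "((\<lambda>\<alpha>. ?\<mu> (S \<alpha> \<inter> A)) has_sum ?\<mu> (\<Union>\<alpha>\<in>I. S \<alpha> \<inter> A)) I"
      using lt[unfolded lt_kappa_additive_meas_def, rule_format, of I "\<lambda>\<alpha>. S \<alpha> \<inter> A"] I by simp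
    then have "((\<lambda>\<alpha>. ?\<mu> (S \<alpha> \<inter> A) * (1 / ?\<mu> A)) has_sum ?\<mu> (\<Union>\<alpha>\<in>I. S \<alpha> \<inter> A) * (1 / ?\<mu> A)) I"
      by (rule has_sum_cmult_left)
    then show "((\<lambda>\<alpha>. \<nu> (S \<alpha>)) has_sum \<nu> (\<Union>\<alpha>\<in>I. S \<alpha>)) I"
      by (simp add: \<nu>_def)
  qed
  show ?thesis by (intro that[of \<nu>] 1 2 3 4)
qed

theorem theorem2p4:
  assumes "\<not> countable (UNIV :: 'a set)"
  shows "(ulam_real_valued_measurable TYPE('a) \<longleftrightarrow>
            (\<exists>\<phi> :: 'a op \<Rightarrow> complex. singular_state \<phi> \<and> countably_additive_state \<phi>))
       \<and> (ulam_measurable TYPE('a) \<longleftrightarrow>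
            (\<exists>\<phi> :: 'a op \<Rightarrow> complex. singular_state \<phi> \<and> countably_additive_state \<phi> \<and> pure_state \<phi>))
       \<and> (real_valued_measurable TYPE('a) \<longleftrightarrow>
            (\<exists>\<phi> :: 'a op \<Rightarrow> complex. singular_state \<phi> \<and> lt_kappa_additive_state \<phi>))
       \<and> (measurable_card TYPE('a) \<longleftrightarrow>
            (\<exists>\<phi> :: 'a op \<Rightarrow> complex. singular_state \<phi> \<and> lt_kappa_additive_state \<phi> \<and> pure_state \<phi>))"
proof (intro conjI iffI)
  assume "ulam_real_valued_measurable TYPE('a)"
  then obtain \<mu> :: "'a set \<Rightarrow> real"
    where \<mu>: "probability_meas \<mu>" "countably_additive_meas \<mu>" "vanishes_on_singletons \<mu>"
    by (auto simp: ulam_real_valued_measurable_def)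
  interpret total_prob \<mu> using \<mu> by unfold_locales
  show "\<exists>\<phi> :: 'a op \<Rightarrow> complex. singular_state \<phi> \<and> countably_additive_state \<phi>"
    using diag_state_singular[OF \<mu>(3)] diag_state_countably_additive by (intro exI conjI)
next
  assume "\<exists>\<phi> :: 'a op \<Rightarrow> complex. singular_state \<phi> \<and> countably_additive_state \<phi>"
  then obtain \<phi> :: "'a op \<Rightarrow> complex" where \<phi>: "singular_state \<phi>" "countably_additive_state \<phi>" by (elim exE conjE)
  have "state \<phi>" using \<phi>(1) by (simp add: singular_state_def)
  note facts = state_meas_prob[OF this] state_meas_countably_additive[OF \<phi>(2)] state_meas_vanishes[OF \<phi>(1)]
  show "ulam_real_valued_measurable TYPE('a)"
    unfolding ulam_real_valued_measurable_def using assms facts by (intro conjI exI)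
next
  assume "ulam_measurable TYPE('a)"
  then obtain \<mu> :: "'a set \<Rightarrow> real"
    where \<mu>: "two_valued_nonzero \<mu>" "countably_additive_meas \<mu>" "vanishes_on_singletons \<mu>"
    by (auto simp: ulam_measurable_def)
  interpret total_prob \<mu> using two_valued_imp_probability \<mu> by unfold_locales
  show "\<exists>\<phi> :: 'a op \<Rightarrow> complex. singular_state \<phi> \<and> countably_additive_state \<phi> \<and> pure_state \<phi>"
    using diag_state_singular[OF \<mu>(3)] diag_state_countably_additive diag_state_pure[OF \<mu>(1)]
    by (intro exI conjI)
next
  assume "\<exists>\<phi> :: 'a op \<Rightarrow> complex. singular_state \<phi> \<and> countably_additive_state \<phi> \<and> pure_state \<phi>"
  then obtain \<phi> :: "'a op \<Rightarrow> complex"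
    where \<phi>: "singular_state \<phi>" "countably_additive_state \<phi>" "pure_state \<phi>" by (elim exE conjE)
  obtain \<nu> :: "'a set \<Rightarrow> real"
    where "two_valued_nonzero \<nu>" "countably_additive_meas \<nu>" "vanishes_on_singletons \<nu>"
    by (rule pure_state_two_valued[OF \<phi>(3,1) state_meas_countably_additive[OF \<phi>(2)]])
  then show "ulam_measurable TYPE('a)"
    unfolding ulam_measurable_def using assms by (intro conjI exI)
next
  assume "real_valued_measurable TYPE('a)"
  then obtain \<mu> :: "'a set \<Rightarrow> real"
    where \<mu>: "probability_meas \<mu>" "lt_kappa_additive_meas \<mu>" "vanishes_on_singletons \<mu>"
    by (auto simp: real_valued_measurable_def)
  \<comment> \<open>The state is an integral, so countable additivity has to be extracted first;
    uncountability of \<open>'a\<close> enters here.\<close>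
  interpret total_prob \<mu>
    using \<mu>(1) lt_kappa_imp_countably_additive[OF assms \<mu>(2)] by unfold_locales
  show "\<exists>\<phi> :: 'a op \<Rightarrow> complex. singular_state \<phi> \<and> lt_kappa_additive_state \<phi>"
    using diag_state_singular[OF \<mu>(3)] diag_state_lt_kappa_additive[OF \<mu>(2)] by (intro exI conjI)
next
  assume "\<exists>\<phi> :: 'a op \<Rightarrow> complex. singular_state \<phi> \<and> lt_kappa_additive_state \<phi>"
  then obtain \<phi> :: "'a op \<Rightarrow> complex" where \<phi>: "singular_state \<phi>" "lt_kappa_additive_state \<phi>" by (elim exE conjE)
  have "state \<phi>" using \<phi>(1) by (simp add: singular_state_def)
  note facts = state_meas_prob[OF this] state_meas_lt_kappa_additive[OF \<phi>(2)] state_meas_vanishes[OF \<phi>(1)]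
  show "real_valued_measurable TYPE('a)"
    unfolding real_valued_measurable_def using assms facts by (intro conjI exI)
next
  assume "measurable_card TYPE('a)"
  then obtain \<mu> :: "'a set \<Rightarrow> real"
    where \<mu>: "two_valued_nonzero \<mu>" "lt_kappa_additive_meas \<mu>" "vanishes_on_singletons \<mu>"
    by (auto simp: measurable_card_def)
  note ca = lt_kappa_imp_countably_additive[OF assms \<mu>(2)]
  interpret total_prob \<mu>
    using two_valued_imp_probability[OF \<mu>(1) ca] ca by unfold_locales
  show "\<exists>\<phi> :: 'a op \<Rightarrow> complex. singular_state \<phi> \<and> lt_kappa_additive_state \<phi> \<and> pure_state \<phi>"
    using diag_state_singular[OF \<mu>(3)] diag_state_lt_kappa_additive[OF \<mu>(2)] diag_state_pure[OF \<mu>(1)]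
    by (intro exI conjI)
next
  assume "\<exists>\<phi> :: 'a op \<Rightarrow> complex. singular_state \<phi> \<and> lt_kappa_additive_state \<phi> \<and> pure_state \<phi>"
  then obtain \<phi> :: "'a op \<Rightarrow> complex"
    where \<phi>: "singular_state \<phi>" "lt_kappa_additive_state \<phi>" "pure_state \<phi>" by (elim exE conjE)
  note lt = state_meas_lt_kappa_additive[OF \<phi>(2)]
  obtain \<nu> :: "'a set \<Rightarrow> real"
    where "two_valued_nonzero \<nu>" "vanishes_on_singletons \<nu>" "lt_kappa_additive_meas \<nu>"
    using pure_state_two_valued[OF \<phi>(3,1) lt_kappa_imp_countably_additive[OF assms lt]] lt by metis
  then show "measurable_card TYPE('a)"
    unfolding measurable_card_def using assms by (intro conjI exI)
qed

end
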